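(* Let $P,Q\in\mathsf{RSP}_n$ be regular Schur labeled skew shape posets. Then $\mathsf M_P\cong\mathsf M_Q$ as $H_n(0)$-modules if and only if $\mathrm{sh}(\tau_P)=\mathrm{sh}(\tau_Q)$.
   Context: $\mathfrak S_n$ is the symmetric group on $[n]=\{1,\dots,n\}$ with length function $\ell$ and simple transpositions $s_i=(i,i+1)$; $\mathrm{Des}_L(\sigma)=\{i\in[n-1]\mid\ell(s_i\sigma)<\ell(\sigma)\}$. The $0$-Hecke algebra $H_n(0)$ is the unital associative $\mathbb C$-algebra generated by $\pi_1,\dots,\pi_{n-1}$ with $\pi_i^2=\pi_i$, $\pi_i\pi_{i+1}\pi_i=\pi_{i+1}\pi_i\pi_{i+1}$, and $\pi_i\pi_j=\pi_j\pi_i$ for $|i-j|\ge2$. A skew partition $\lambda/\mu$ is a pair of partitions with $\mu_i\le\lambda_i$ for all $i$ (missing parts are $0$); its Young diagram is the set of boxes $(i,j)$ (row $i$ counted from the top, column $j$ from the left) with $\mu_i<j\le\lambda_i$; its size is $|\lambda|-|\mu|$. Every skew partition is assumed basic: its Young diagram has no empty rows and no empty columns. It is connected if for each pair of consecutive rows there are two boxes, one in each row, sharing an edge; in general the diagram splits into connected components, ordered from the top. A bijective tableau of shape $\lambda/\mu$ (of size $n$) is a filling of the Young diagram in which each element of $[n]$ appears exactly once; $\mathrm{sh}(\tau)$ is the shape of $\tau$. For a bijective tableau $\tau$, $\mathsf{poset}(\tau)$ is the poset on $[n]$ with $i\preceq_\tau j$ iff the box of $i$ is weakly above and weakly left of the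 box of $j$ in $\tau$. A Schur labeling is a bijective tableau whose rows decrease from left to right and whose columns increase from top to bottom. $\mathsf P_n$ is the set of posets with underlying set $[n]$. $\mathsf{SP}_n$ (Schur labeled skew shape posets) is the set of all $\mathsf{poset}(\tau)$ with $\tau$ a Schur labeling of some skew shape of size $n$. $P\in\mathsf P_n$ is regular if for all $x,y,z\in[n]$ with $x\preceq_P z$ and ($x<y<z$ or $z<y<x$), one has $x\preceq_P y$ or $y\preceq_P z$. $\mathsf{RSP}_n$ is the set of regular posets in $\mathsf{SP}_n$. For $P\in\mathsf{SP}_n$, $\tau_P$ is the unique Schur labeling $\tau$ of basic shape with $\mathsf{poset}(\tau)=P$ such that the minimum entry of the $i$th connected component of $\tau$ from the top is smaller than that of the $j$th component whenever $i<j$. For $P\in\mathsf P_n$, $\Sigma_L(P)=\{\sigma\in\mathfrak S_n\mid \sigma(i)\le\sigma(j)\text{ for all } i\preceq_P j\}$, and $\mathsf M_P$ is the left $H_n(0)$-module with underlying space $\mathbb C\Sigma_L(P)$ and action $\pi_i\cdot\gamma=\gamma$ if $i\in\mathrm{Des}_L(\gamma)$; $\pi_i\cdot\gamma=0$ if $i\notin\mathrm{Des}_L(\gamma)$ and $s_i\gamma\notin\Sigma_L(P)$; $\pi_i\cdot\gamma=s_i\gamma$ if $i\notin\mathrm{Des}_L(\gamma)$ and $s_i\gamma\in\Sigma_L(P)$. *)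

theory Defs
  imports
    Complex_Main
    "HOL-Library.FuncSet"
    "HOL-Library.Poly_Mapping"
    "HOL-Combinatorics.Permutations"
    "HOL-Algebra.QuotRing"
    "HOL-Algebra.Module"
begin

section \<open>The symmetric group\<close>

text \<open>Permutations of \<open>[n]\<close> are functions with \<^term>\<open>\<sigma> permutes {1..n}\<close>; products are
  compositions from right to left, so that \<open>s_i \<sigma>\<close> exchanges the values \<open>i\<close> and \<open>i + 1\<close>.\<close>

definition simple_transp :: "nat \<Rightarrow> nat \<Rightarrow> nat" where
  "simple_transp i = Transposition.transpose i (Suc i)"

definition perm_length :: "nat \<Rightarrow> (nat \<Rightarrow> nat) \<Rightarrow> nat" where
  "perm_length n \<sigma> =
     (LEAST k. \<exists>ws \<in> lists {1..n - 1}. length ws = k \<and> \<sigma> = foldr (\<circ>) (map simple_transp ws) id)"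

definition Des_L :: "nat \<Rightarrow> (nat \<Rightarrow> nat) \<Rightarrow> nat set" where
  "Des_L n \<sigma> = {i \<in> {1..n - 1}. perm_length n (simple_transp i \<circ> \<sigma>) < perm_length n \<sigma>}"


section \<open>The 0-Hecke algebra\<close>

text \<open>Lists form the free monoid under concatenation, so \<^typ>\<open>nat list \<Rightarrow>\<^sub>0 complex\<close> is the free
  associative \<open>\<complex>\<close>-algebra on generators indexed by \<^typ>\<open>nat\<close>.\<close>

instantiation list :: (type) monoid_add
begin
definition zero_list :: "'a list" where "0 = []"
definition plus_list :: "'a list \<Rightarrow> 'a list \<Rightarrow> 'a list" where "xs + ys = xs @ ys"
instance by standard (simp_all add: zero_list_def plus_list_def)
end

definition free_algebra :: "nat \<Rightarrow> (nat list \<Rightarrow>\<^sub>0 complex) ring" where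
  "free_algebra n =
     \<lparr>carrier = {f. Poly_Mapping.keys f \<subseteq> lists {1..n - 1}}, mult = (*), one = 1, zero = 0, add = (+)\<rparr>"

definition gen :: "nat \<Rightarrow> nat list \<Rightarrow>\<^sub>0 complex" where
  "gen i = Poly_Mapping.single [i] 1"

definition hecke0_relators :: "nat \<Rightarrow> (nat list \<Rightarrow>\<^sub>0 complex) set" where
  "hecke0_relators n =
     {gen i * gen i - gen i | i. i \<in> {1..n - 1}} \<union>
     {gen i * gen (i + 1) * gen i - gen (i + 1) * gen i * gen (i + 1) | i.
        i \<in> {1..n - 1} \<and> i + 1 \<in> {1..n - 1}} \<union>
     {gen i * gen j - gen j * gen i | i j.
        i \<in> {1..n - 1} \<and> j \<in> {1..n - 1} \<and> \<bar>int i - int j\<bar> \<ge> 2}"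

definition hecke0 :: "nat \<Rightarrow> (nat list \<Rightarrow>\<^sub>0 complex) set ring" where
  "hecke0 n = free_algebra n Quot (Idl\<^bsub>free_algebra n\<^esub> (hecke0_relators n))"

lemma gen_carrier: "i \<in> {1..n - 1} \<Longrightarrow> gen i \<in> carrier (free_algebra n)"
  by (simp add: gen_def free_algebra_def)

lemma free_algebra_mult_closed:
  assumes "f \<in> carrier (free_algebra n)" "g \<in> carrier (free_algebra n)"
  shows "f * g \<in> carrier (free_algebra n)"
proof -
  have "Poly_Mapping.keys (f * g) \<subseteq> {a + b | a b. a \<in> Poly_Mapping.keys f \<and> b \<in> Poly_Mapping.keys g}"
    by (rule keys_mult)
  then show ?thesis
    using assms by (fastforce simp: free_algebra_def plus_list_def)
qed

lemma free_algebra_diff_closed: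
  assumes "f \<in> carrier (free_algebra n)" "g \<in> carrier (free_algebra n)"
  shows "f - g \<in> carrier (free_algebra n)"
  using assms keys_diff[of f g] by (auto simp: free_algebra_def)

lemma ring_free_algebra: "ring (free_algebra n)"
proof (rule ringI)
  show "abelian_group (free_algebra n)"
  proof (rule abelian_groupI)
    fix x y assume "x \<in> carrier (free_algebra n)" "y \<in> carrier (free_algebra n)"
    then show "x \<oplus>\<^bsub>free_algebra n\<^esub> y \<in> carrier (free_algebra n)"
      using keys_add[of x y] by (auto simp: free_algebra_def)
  next
    fix x assume "x \<in> carrier (free_algebra n)"
    then show "\<exists>y\<in>carrier (free_algebra n). y \<oplus>\<^bsub>free_algebra n\<^esub> x = \<zero>\<^bsub>free_algebra n\<^esub>"
      by (intro bexI[of _ "- x"]) (auto simp: free_algebra_def keys_minus)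
  qed (auto simp: free_algebra_def algebra_simps)
  show "monoid (free_algebra n)"
  proof (rule monoidI)
    show "\<one>\<^bsub>free_algebra n\<^esub> \<in> carrier (free_algebra n)"
      by (simp add: free_algebra_def zero_list_def flip: single_one)
  qed (use free_algebra_mult_closed[of _ n] in \<open>auto simp: free_algebra_def algebra_simps\<close>)
qed (auto simp: free_algebra_def algebra_simps)

lemma ring_hecke0: "ring (hecke0 n)"
proof -
  interpret ring "free_algebra n" by (rule ring_free_algebra)
  have "hecke0_relators n \<subseteq> carrier (free_algebra n)"
    unfolding hecke0_relators_def
    by (auto intro!: free_algebra_diff_closed free_algebra_mult_closed gen_carrier)
  then show ?thesis
    unfolding hecke0_def by (intro ideal.quotient_is_ring genideal_ideal)
qed


section \<open>Left modules over a ring\<close>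

text \<open>Same axioms as the locale \<^locale>\<open>module\<close>, whose ring of scalars has to be commutative.\<close>

locale left_module = R?: ring R + M?: abelian_group M for R (structure) and M (structure) +
  assumes smult_closed:
      "\<lbrakk>a \<in> carrier R; x \<in> carrier M\<rbrakk> \<Longrightarrow> a \<odot>\<^bsub>M\<^esub> x \<in> carrier M"
    and smult_l_distr:
      "\<lbrakk>a \<in> carrier R; b \<in> carrier R; x \<in> carrier M\<rbrakk> \<Longrightarrow>
        (a \<oplus>\<^bsub>R\<^esub> b) \<odot>\<^bsub>M\<^esub> x = a \<odot>\<^bsub>M\<^esub> x \<oplus>\<^bsub>M\<^esub> b \<odot>\<^bsub>M\<^esub> x"
    and smult_r_distr:
      "\<lbrakk>a \<in> carrier R; x \<in> carrier M; y \<in> carrier M\<rbrakk> \<Longrightarrow>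
        a \<odot>\<^bsub>M\<^esub> (x \<oplus>\<^bsub>M\<^esub> y) = a \<odot>\<^bsub>M\<^esub> x \<oplus>\<^bsub>M\<^esub> a \<odot>\<^bsub>M\<^esub> y"
    and smult_assoc1:
      "\<lbrakk>a \<in> carrier R; b \<in> carrier R; x \<in> carrier M\<rbrakk> \<Longrightarrow>
        (a \<otimes>\<^bsub>R\<^esub> b) \<odot>\<^bsub>M\<^esub> x = a \<odot>\<^bsub>M\<^esub> (b \<odot>\<^bsub>M\<^esub> x)"
    and smult_one:
      "x \<in> carrier M \<Longrightarrow> \<one>\<^bsub>R\<^esub> \<odot>\<^bsub>M\<^esub> x = x"

text \<open>Over \<^term>\<open>hecke0 n\<close>, \<open>\<complex>\<close>-linearity is part of linearity over the ring, since the ring contains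
  the scalars as the classes of \<open>single [] c\<close>.\<close>

definition modules_isomorphic ::
    "('r, 'k) ring_scheme \<Rightarrow> ('r, 'a, 'c) module_scheme \<Rightarrow> ('r, 'b, 'd) module_scheme \<Rightarrow> bool" where
  "modules_isomorphic R M N \<longleftrightarrow>
     left_module R M \<and> left_module R N \<and>
     (\<exists>f. bij_betw f (carrier M) (carrier N) \<and>
          (\<forall>x\<in>carrier M. \<forall>y\<in>carrier M. f (x \<oplus>\<^bsub>M\<^esub> y) = f x \<oplus>\<^bsub>N\<^esub> f y) \<and>
          (\<forall>a\<in>carrier R. \<forall>x\<in>carrier M. f (a \<odot>\<^bsub>M\<^esub> x) = a \<odot>\<^bsub>N\<^esub> f x))"


section \<open>Posets on \<open>[n]\<close> and their modules\<close>

text \<open>A poset is identified with its order relation: \<open>(i, j) \<in> P\<close> means \<open>i \<preceq> j\<close>.\<close>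

definition posets :: "nat \<Rightarrow> nat rel set" where
  "posets n = {P. P \<subseteq> {1..n} \<times> {1..n} \<and> partial_order_on {1..n} P}"

definition Sigma_L :: "nat \<Rightarrow> nat rel \<Rightarrow> (nat \<Rightarrow> nat) set" where
  "Sigma_L n P = {\<sigma>. \<sigma> permutes {1..n} \<and> (\<forall>(i, j) \<in> P. \<sigma> i \<le> \<sigma> j)}"

definition scale :: "complex \<Rightarrow> ('a \<Rightarrow>\<^sub>0 complex) \<Rightarrow> ('a \<Rightarrow>\<^sub>0 complex)" where
  "scale c v = Poly_Mapping.map ((*) c) v"

definition linear_extension :: "('a \<Rightarrow> 'b \<Rightarrow>\<^sub>0 complex) \<Rightarrow> ('a \<Rightarrow>\<^sub>0 complex) \<Rightarrow> ('b \<Rightarrow>\<^sub>0 complex)" where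
  "linear_extension g v = (\<Sum>x\<in>Poly_Mapping.keys v. scale (Poly_Mapping.lookup v x) (g x))"

definition gen_on_basis :: "nat \<Rightarrow> nat rel \<Rightarrow> nat \<Rightarrow> (nat \<Rightarrow> nat) \<Rightarrow> ((nat \<Rightarrow> nat) \<Rightarrow>\<^sub>0 complex)" where
  "gen_on_basis n P i \<gamma> =
     (if i \<in> Des_L n \<gamma> then Poly_Mapping.single \<gamma> 1
      else if simple_transp i \<circ> \<gamma> \<in> Sigma_L n P then Poly_Mapping.single (simple_transp i \<circ> \<gamma>) 1
      else 0)"

definition word_action ::
    "nat \<Rightarrow> nat rel \<Rightarrow> nat list \<Rightarrow> ((nat \<Rightarrow> nat) \<Rightarrow>\<^sub>0 complex) \<Rightarrow> ((nat \<Rightarrow> nat) \<Rightarrow>\<^sub>0 complex)" where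
  "word_action n P ws = foldr (\<lambda>i. linear_extension (gen_on_basis n P i)) ws"

definition free_action ::
    "nat \<Rightarrow> nat rel \<Rightarrow> (nat list \<Rightarrow>\<^sub>0 complex) \<Rightarrow> ((nat \<Rightarrow> nat) \<Rightarrow>\<^sub>0 complex) \<Rightarrow> ((nat \<Rightarrow> nat) \<Rightarrow>\<^sub>0 complex)" where
  "free_action n P f v = linear_extension (\<lambda>ws. word_action n P ws v) f"

text \<open>Elements of \<^term>\<open>hecke0 n\<close> are cosets, all of whose members act in the same way; this common
  value is extracted by \<^const>\<open>the_elem\<close>. The ring multiplication fields of the record are irrelevant.\<close>

definition poset_module ::
    "nat \<Rightarrow> nat rel \<Rightarrow> ((nat list \<Rightarrow>\<^sub>0 complex) set, (nat \<Rightarrow> nat) \<Rightarrow>\<^sub>0 complex) module" where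
  "poset_module n P =
     \<lparr>carrier = {v. Poly_Mapping.keys v \<subseteq> Sigma_L n P}, mult = undefined, one = undefined,
      zero = 0, add = (+), smult = (\<lambda>X v. the_elem ((\<lambda>f. free_action n P f v) ` X))\<rparr>"


section \<open>Skew partitions and Schur labelings\<close>

definition is_partition :: "nat list \<Rightarrow> bool" where
  "is_partition p \<longleftrightarrow> sorted_wrt (\<ge>) p \<and> 0 \<notin> set p"

definition part :: "nat list \<Rightarrow> nat \<Rightarrow> nat" where
  "part p i = (if 1 \<le> i \<and> i \<le> length p then p ! (i - 1) else 0)"

text \<open>The pair \<open>(l, m)\<close> stands for the skew partition \<open>l / m\<close>.\<close>

type_synonym skew = "nat list \<times> nat list"

definition diagram :: "skew \<Rightarrow> (nat \<times> nat) set" where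
  "diagram s = {(i, j). 1 \<le> i \<and> part (snd s) i < j \<and> j \<le> part (fst s) i}"

definition skew_size :: "skew \<Rightarrow> nat" where
  "skew_size s = sum_list (fst s) - sum_list (snd s)"

text \<open>The last two conditions say that the diagram has no empty row and no empty column.\<close>

definition basic_skew_partition :: "skew \<Rightarrow> bool" where
  "basic_skew_partition s \<longleftrightarrow>
     is_partition (fst s) \<and> is_partition (snd s) \<and>
     (\<forall>i\<ge>1. part (snd s) i \<le> part (fst s) i) \<and>
     (\<forall>i\<in>{1..length (fst s)}. \<exists>j. (i, j) \<in> diagram s) \<and>
     (\<forall>j\<in>{1..part (fst s) 1}. \<exists>i. (i, j) \<in> diagram s)"

text \<open>A tableau is its shape together with its filling, made extensional so that tableaux are equal
  iff they have the same shape and the same entries.\<close>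

type_synonym tableau = "skew \<times> (nat \<times> nat \<Rightarrow> nat)"

definition sh :: "tableau \<Rightarrow> skew" where
  "sh \<tau> = fst \<tau>"

definition boxes :: "tableau \<Rightarrow> (nat \<times> nat) set" where
  "boxes \<tau> = diagram (sh \<tau>)"

definition entry :: "tableau \<Rightarrow> nat \<times> nat \<Rightarrow> nat" where
  "entry \<tau> = snd \<tau>"

definition bijective_tableau :: "nat \<Rightarrow> tableau \<Rightarrow> bool" where
  "bijective_tableau n \<tau> \<longleftrightarrow>
     basic_skew_partition (sh \<tau>) \<and> skew_size (sh \<tau>) = n \<and>
     entry \<tau> \<in> extensional (boxes \<tau>) \<and> bij_betw (entry \<tau>) (boxes \<tau>) {1..n}"

definition schur_labeling :: "nat \<Rightarrow> tableau \<Rightarrow> bool" where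
  "schur_labeling n \<tau> \<longleftrightarrow>
     bijective_tableau n \<tau> \<and>
     (\<forall>i j j'. (i, j) \<in> boxes \<tau> \<and> (i, j') \<in> boxes \<tau> \<and> j < j' \<longrightarrow> entry \<tau> (i, j) > entry \<tau> (i, j')) \<and>
     (\<forall>i i' j. (i, j) \<in> boxes \<tau> \<and> (i', j) \<in> boxes \<tau> \<and> i < i' \<longrightarrow> entry \<tau> (i, j) < entry \<tau> (i', j))"

definition poset_of :: "tableau \<Rightarrow> nat rel" where
  "poset_of \<tau> = {(entry \<tau> (i, j), entry \<tau> (i', j')) | i j i' j'.
     (i, j) \<in> boxes \<tau> \<and> (i', j') \<in> boxes \<tau> \<and> i \<le> i' \<and> j \<le> j'}"

definition share_edge :: "nat \<times> nat \<Rightarrow> nat \<times> nat \<Rightarrow> bool" where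
  "share_edge b c \<longleftrightarrow>
     fst b = fst c \<and> (snd c = Suc (snd b) \<or> snd b = Suc (snd c)) \<or>
     snd b = snd c \<and> (fst c = Suc (fst b) \<or> fst b = Suc (fst c))"

definition components :: "(nat \<times> nat) set \<Rightarrow> (nat \<times> nat) set set" where
  "components D = D // {(b, c). b \<in> D \<and> c \<in> D \<and> share_edge b c}\<^sup>*"

text \<open>Distinct components of a skew diagram occupy disjoint intervals of rows, so one of them lies
  entirely above the other.\<close>

definition above :: "(nat \<times> nat) set \<Rightarrow> (nat \<times> nat) set \<Rightarrow> bool" where
  "above C C' \<longleftrightarrow> (\<forall>b\<in>C. \<forall>c\<in>C'. fst b < fst c)"

definition components_increasing :: "tableau \<Rightarrow> bool" where
  "components_increasing \<tau> \<longleftrightarrow>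
     (\<forall>C \<in> components (boxes \<tau>). \<forall>C' \<in> components (boxes \<tau>).
        above C C' \<longrightarrow> Min (entry \<tau> ` C) < Min (entry \<tau> ` C'))"

definition tableau_of :: "nat \<Rightarrow> nat rel \<Rightarrow> tableau" where
  "tableau_of n P = (THE \<tau>. schur_labeling n \<tau> \<and> poset_of \<tau> = P \<and> components_increasing \<tau>)"

definition SP :: "nat \<Rightarrow> nat rel set" where
  "SP n = {poset_of \<tau> | \<tau>. schur_labeling n \<tau>}"

definition regular :: "nat \<Rightarrow> nat rel \<Rightarrow> bool" where
  "regular n P \<longleftrightarrow> P \<in> posets n \<and>
     (\<forall>x\<in>{1..n}. \<forall>y\<in>{1..n}. \<forall>z\<in>{1..n}.
        (x, z) \<in> P \<and> (x < y \<and> y < z \<or> z < y \<and> y < x) \<longrightarrow> (x, y) \<in> P \<or> (y, z) \<in> P)"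

definition RSP :: "nat \<Rightarrow> nat rel set" where
  "RSP n = {P \<in> SP n. regular n P}"

end

theory Submission
  imports Defs
begin

text \<open>
  Let \<open>\<gamma>\<close> be a linear extension of \<open>P\<close> and let \<open>x\<close>, \<open>y\<close> be the elements
  on which it takes the values \<open>i\<close> and \<open>i + 1\<close>. Then \<open>\<pi>_i\<close> fixes \<open>\<gamma>\<close> if \<open>y < x\<close>, kills it if
  \<open>x\<close> precedes \<open>y\<close> in \<open>P\<close>, and exchanges the two values otherwise. Now place every element of \<open>P\<close> in its
  box of \<open>\<tau>_P\<close>. Inside a connected component, labels grow along every walk to the left and
  downwards, and such a walk joins any two boxes that lie south-west of each other
  (\<open>linked_southwest_less\<close>). Regularity makes the label sets of the components disjoint
  intervals (\<open>regular_linked_interval\<close>), and the components of \<open>\<tau>_P\<close> are listed from the top by increasing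
  minima. So, over the whole tableau, a box that is weakly south-west of another one has the larger
  label. It follows that \<open>y < x\<close> holds iff \<open>y\<close> is weakly above \<open>x\<close> (\<open>descent_iff_row\<close>). Thus
  the action mentions only positions of boxes, and two posets with the same shape have isomorphic
  modules (\<open>cells_eq_imp_isomorphic\<close>).

  For the converse, a basic skew shape is determined by its row lengths and by the
  numbers of columns that consecutive rows share, the overlaps (\<open>cells_determined\<close>). Call a
  pair of elements row-inverted if the upper one receives the larger value. The action can only create row
  inversions; the unique extension without any, the row reading \<open>T\<^sub>0\<close>, generates the module
  (\<open>row_reading_generates\<close>). If \<open>R\<close> is a set of rows each of which shares no column with the
  next row, the sum of the coefficients of all extensions that are inverted only across
  the boundaries in \<open>R\<close> is a homomorphism to a one-dimensional module, on which each \<open>\<pi>_i\<close> acts by \<open>1\<close> or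
  \<open>0\<close> according to whether \<open>i\<close> avoids the ends of the other rows (\<open>head_step\<close>). For
  \<open>R = {}\<close> this functional is the coefficient of \<open>T\<^sub>0\<close>. It does not vanish on any generator, and comparing it
  with the image of the other row reading shows that isomorphic modules have the same row ends, hence the same
  row lengths.

  Suppose that rows \<open>r\<close> and \<open>r + 1\<close> overlap in fewer than \<open>k\<close> columns for \<open>P\<close>
  but in \<open>k\<close> columns for \<open>Q\<close>. Then \<open>P\<close> has an extension \<open>T\<close> in which row \<open>r + 1\<close> is complete before row \<open>r\<close>
  has received \<open>k\<close> values (\<open>delayed_extension\<close>), and \<open>Q\<close> has none
  (\<open>overlap_forces_row\<close>). Choose a word \<open>w\<close> with \<open>\<pi>_w T\<^sub>0 = T\<close> in \<open>M_P\<close>. Whether a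
  letter of \<open>w\<close> fixes an extension depends only on the sequence of the rows in which the values
  stand, so in \<open>M_Q\<close> the word either produces an extension with the row sequence of \<open>T\<close> or zero; hence it
  kills the row reading of \<open>Q\<close>. An isomorphism therefore
  yields a generator \<open>u\<close> of \<open>M_P\<close> that is killed by \<open>\<pi>_w\<close> and fixed by all \<open>\<pi>_i\<close> that fix \<open>T\<^sub>0\<close>. If
  \<open>k = 1\<close>, the one-dimensional quotient for \<open>R = {r}\<close> exists and \<open>\<pi>_w\<close> acts on it by \<open>1\<close>, so the image of \<open>u\<close>
  there would be zero. If \<open>k \<ge> 2\<close>, then \<open>T\<^sub>0\<close> is the only member of the support of \<open>u\<close> that \<open>\<pi>_w\<close> can send to
  \<open>T\<close> (\<open>delayed_only_row_reading\<close>), so the coefficient of \<open>T\<close> in \<open>\<pi>_w u\<close> is that of \<open>T\<^sub>0\<close> in \<open>u\<close>,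
  which is not zero. Both cases are absurd, and this is \<open>overlap_le\<close>.
\<close>


section \<open>Inversions and left descents\<close>

lemma image_below:
  fixes f :: "'a \<Rightarrow> nat"
  assumes f: "f ` X = {1..L}" and x: "x \<in> X"
  shows "f ` {y \<in> X. f y \<le> f x} = {1..f x}"
proof
  show "f ` {y \<in> X. f y \<le> f x} \<subseteq> {1..f x}"
    using f by force
  show "{1..f x} \<subseteq> f ` {y \<in> X. f y \<le> f x}"
  proof
    fix k assume k: "k \<in> {1..f x}"
    moreover have "f x \<in> {1..L}" using f x by blast
    ultimately have "k \<in> f ` X" using f by simp
    then show "k \<in> f ` {y \<in> X. f y \<le> f x}" using k by auto
  qed
qed

text \<open>Coordinates are recovered from the preorders that they induce: the value at \<open>x\<close> counts the classes that
  are not above \<open>x\<close>. This gives the uniqueness of tableaux and of row readings.\<close>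

lemma rank_unique:
  fixes f g :: "'a \<Rightarrow> nat"
  assumes f: "f ` X = {1..L}" and g: "g ` X = {1..M}"
    and le: "\<And>x y. x \<in> X \<Longrightarrow> y \<in> X \<Longrightarrow> f x \<le> f y \<longleftrightarrow> g x \<le> g y"
    and x: "x \<in> X"
  shows "f x = g x"
proof -
  define Y where "Y = {y \<in> X. f y \<le> f x}"
  have Y: "Y = {y \<in> X. g y \<le> g x}"
    using le x by (auto simp: Y_def)
  have "f ` Y = {1..f x}" unfolding Y_def by (rule image_below[OF f x])
  moreover have "g ` Y = {1..g x}" unfolding Y by (rule image_below[OF g x])
  moreover have "card (f ` Y) = card (g ` Y)"
  proof -
    have eq: "f a = f b \<longleftrightarrow> g a = g b" if "a \<in> Y" "b \<in> Y" for a b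
      using le[of a b] le[of b a] that by (auto simp: Y_def)
    define h where "h = (\<lambda>k. g (inv_into Y f k))"
    have h: "h (f a) = g a" if "a \<in> Y" for a
      using eq[OF that inv_into_into[of "f a" f Y]] f_inv_into_f[of "f a" f Y] that
      by (auto simp: h_def)
    have "inj_on h (f ` Y)"
      using eq h by (auto simp: inj_on_def)
    moreover have "h ` f ` Y = g ` Y"
      using h by (force simp: image_iff)
    ultimately show ?thesis by (metis card_image)
  qed
  ultimately show ?thesis by simp
qed

lemma rank_exists:
  fixes k :: "'a \<Rightarrow> nat"
  assumes "finite X"
  obtains f :: "'a \<Rightarrow> nat" where "f ` X = {1..card (k ` X)}"
    and "\<And>x y. x \<in> X \<Longrightarrow> y \<in> X \<Longrightarrow> f x \<le> f y \<longleftrightarrow> k x \<le> k y"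
proof -
  define f where "f x = card {a \<in> k ` X. a \<le> k x}" for x
  have fin: "finite (k ` X)" using assms by simp
  have le: "f x \<le> f y \<longleftrightarrow> k x \<le> k y" if "x \<in> X" "y \<in> X" for x y
  proof
    assume "k x \<le> k y"
    then show "f x \<le> f y" unfolding f_def by (intro card_mono) (use fin in auto)
  next
    assume "f x \<le> f y"
    show "k x \<le> k y"
    proof (rule ccontr)
      assume "\<not> k x \<le> k y"
      then have "{a \<in> k ` X. a \<le> k y} \<subset> {a \<in> k ` X. a \<le> k x}" using that by auto
      then have "f y < f x" unfolding f_def by (intro psubset_card_mono) (use fin in auto)
      with \<open>f x \<le> f y\<close> show False by simp
    qed
  qed
  have sub: "f ` X \<subseteq> {1..card (k ` X)}"
  proof
    fix v assume "v \<in> f ` X"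
    then obtain x where x: "x \<in> X" "v = f x" by blast
    have "f x \<le> card (k ` X)" unfolding f_def by (intro card_mono) (use fin in auto)
    moreover have "f x > 0" unfolding f_def using x fin by (subst card_gt_0_iff) auto
    ultimately show "v \<in> {1..card (k ` X)}" using x by auto
  qed
  have "card (f ` X) = card (k ` X)"
  proof -
    have eq: "f x = f y \<longleftrightarrow> k x = k y" if "x \<in> X" "y \<in> X" for x y
      using le[OF that] le[OF that(2,1)] by (auto simp: eq_iff)
    define h where "h a = card {b \<in> k ` X. b \<le> a}" for a
    have "f ` X = h ` k ` X" by (auto simp: f_def h_def image_image)
    moreover have "inj_on h (k ` X)"
      using eq by (auto simp: inj_on_def f_def h_def)
    ultimately show ?thesis by (simp add: card_image)
  qed
  then have "f ` X = {1..card (k ` X)}"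
    using sub by (intro card_subset_eq) auto
  then show ?thesis using le that by blast
qed

text \<open>Permutations are read as fillings of the ground set with values, and the action only asks where a value stands.\<close>

abbreviation place :: "(nat \<Rightarrow> nat) \<Rightarrow> nat \<Rightarrow> nat" where
  "place \<sigma> \<equiv> inv_into UNIV \<sigma>"

text \<open>The set \<open>X\<close> of oriented pairs is a parameter: all pairs of positions give the length function, pairs of
  boxes in different rows give the order in which the module is traversed.\<close>

definition inversions :: "(nat \<times> nat) set \<Rightarrow> (nat \<Rightarrow> nat) \<Rightarrow> (nat \<times> nat) set" where
  "inversions X \<sigma> = {(a, b) \<in> X. \<sigma> b < \<sigma> a}"

lemma finite_inversions: "finite X \<Longrightarrow> finite (inversions X \<sigma>)"
  by (rule rev_finite_subset[of X]) (auto simp: inversions_def)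

abbreviation position_pairs :: "nat \<Rightarrow> (nat \<times> nat) set" where
  "position_pairs n \<equiv> {(a, b). a \<in> {1..n} \<and> b \<in> {1..n} \<and> a < b}"

lemma finite_position_pairs: "finite (position_pairs n)"
  by (rule finite_subset[of _ "{1..n} \<times> {1..n}"]) auto

lemma simple_transp_permutes:
  assumes "i \<in> {1..n - 1}"
  shows "simple_transp i permutes {1..n}"
  unfolding simple_transp_def using assms by (intro permutes_swap_id) auto

lemma simple_transp_simps [simp]:
  "simple_transp i i = Suc i" "simple_transp i (Suc i) = i"
  "v \<noteq> i \<Longrightarrow> v \<noteq> Suc i \<Longrightarrow> simple_transp i v = v"
  by (auto simp: simple_transp_def)

lemma simple_transp_involutive [simp]: "simple_transp i (simple_transp i v) = v"
  by (simp add: simple_transp_def)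

lemma simple_transp_comp_cancel [simp]: "simple_transp i \<circ> (simple_transp i \<circ> \<sigma>) = \<sigma>"
  by (simp add: fun_eq_iff)

lemma simple_transp_mono:
  assumes "u < v" "\<not> (u = i \<and> v = Suc i)"
  shows "simple_transp i u < simple_transp i v"
  using assms by (auto simp: simple_transp_def Transposition.transpose_def)

lemma permutes_transp_comp:
  assumes "\<sigma> permutes {1..n}" "i \<in> {1..n - 1}"
  shows "simple_transp i \<circ> \<sigma> permutes {1..n}"
  using permutes_compose[OF assms(1) simple_transp_permutes[OF assms(2)]] .

lemma inv_transp_comp:
  assumes "\<sigma> permutes {1..n}"
  shows "place (simple_transp i \<circ> \<sigma>) v = place \<sigma> (simple_transp i v)"
proof -
  have "bij \<sigma>" using assms by (rule permutes_bij)
  moreover have "bij (simple_transp i)" by (simp add: simple_transp_def)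
  moreover have "place (simple_transp i) = simple_transp i" by (simp add: simple_transp_def)
  ultimately show ?thesis by (simp add: o_inv_distrib)
qed

lemma inv_in_range:
  assumes "\<sigma> permutes {1..n}" "v \<in> {1..n}"
  shows "place \<sigma> v \<in> {1..n}"
  using permutes_in_image[OF permutes_inv[OF assms(1)]] assms(2) by blast

text \<open>Exchanging \<open>i\<close> and \<open>i + 1\<close> changes the relative order of the values at one pair of places
  only, since no other value lies between them.\<close>

lemma inversions_transp:
  assumes \<sigma>: "\<sigma> permutes {1..n}"
    and X: "(place \<sigma> i, place \<sigma> (Suc i)) \<in> X" "(place \<sigma> (Suc i), place \<sigma> i) \<notin> X"
  shows "inversions X (simple_transp i \<circ> \<sigma>) = insert (place \<sigma> i, place \<sigma> (Suc i)) (inversions X \<sigma>)"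
    and "(place \<sigma> i, place \<sigma> (Suc i)) \<notin> inversions X \<sigma>"
proof -
  have s: "\<sigma> (place \<sigma> v) = v" "place \<sigma> (\<sigma> v) = v" for v
    using permutes_inverses[OF \<sigma>] by auto
  show "(place \<sigma> i, place \<sigma> (Suc i)) \<notin> inversions X \<sigma>" by (simp add: inversions_def s)
  have "(a, b) \<in> inversions X (simple_transp i \<circ> \<sigma>) \<longleftrightarrow>
      (a, b) \<in> insert (place \<sigma> i, place \<sigma> (Suc i)) (inversions X \<sigma>)" for a b
  proof (cases "(a, b) = (place \<sigma> i, place \<sigma> (Suc i))")
    case True
    then show ?thesis using X by (simp add: inversions_def s)
  next
    case False
    have "simple_transp i (\<sigma> b) < simple_transp i (\<sigma> a) \<longleftrightarrow> \<sigma> b < \<sigma> a" if ab: "(a, b) \<in> X"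
    proof
      assume *: "\<sigma> b < \<sigma> a"
      have "\<not> (\<sigma> b = i \<and> \<sigma> a = Suc i)" using ab X(2) s(2)[of a] s(2)[of b] by auto
      then show "simple_transp i (\<sigma> b) < simple_transp i (\<sigma> a)" by (rule simple_transp_mono[OF *])
    next
      assume *: "simple_transp i (\<sigma> b) < simple_transp i (\<sigma> a)"
      have "\<not> (simple_transp i (\<sigma> b) = i \<and> simple_transp i (\<sigma> a) = Suc i)"
        using False s(2)[of a] s(2)[of b] by (metis simple_transp_involutive simple_transp_simps(1))
      from simple_transp_mono[OF * this] show "\<sigma> b < \<sigma> a" by simp
    qed
    then show ?thesis using False by (auto simp: inversions_def)
  qed
  then show "inversions X (simple_transp i \<circ> \<sigma>) = insert (place \<sigma> i, place \<sigma> (Suc i)) (inversions X \<sigma>)"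
    by auto
qed

lemma card_inversions_transp_up:
  assumes "\<sigma> permutes {1..n}" "i \<in> {1..n - 1}" "place \<sigma> i < place \<sigma> (Suc i)"
  shows "card (inversions (position_pairs n) (simple_transp i \<circ> \<sigma>)) = Suc (card (inversions (position_pairs n) \<sigma>))"
proof -
  have "place \<sigma> i \<in> {1..n}" "place \<sigma> (Suc i) \<in> {1..n}"
    using assms(2) inv_in_range[OF assms(1), of i] inv_in_range[OF assms(1), of "Suc i"] by auto
  then have "(place \<sigma> i, place \<sigma> (Suc i)) \<in> position_pairs n" "(place \<sigma> (Suc i), place \<sigma> i) \<notin> position_pairs n"
    using assms(3) by simp_all
  from inversions_transp[OF assms(1) this] show ?thesis
    by (simp only: card_insert_disjoint finite_inversions finite_position_pairs not_False_eq_True)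
qed

lemma inv_neq_Suc:
  assumes "\<sigma> permutes {1..n}"
  shows "place \<sigma> i \<noteq> place \<sigma> (Suc i)"
  using permutes_inverses(1)[OF assms, of i] permutes_inverses(1)[OF assms, of "Suc i"]
  by (metis n_not_Suc_n)

lemma card_inversions_transp_down:
  assumes \<sigma>: "\<sigma> permutes {1..n}" "i \<in> {1..n - 1}" "place \<sigma> (Suc i) < place \<sigma> i"
  shows "card (inversions (position_pairs n) \<sigma>) = Suc (card (inversions (position_pairs n) (simple_transp i \<circ> \<sigma>)))"
proof -
  have p: "simple_transp i \<circ> \<sigma> permutes {1..n}" by (rule permutes_transp_comp[OF \<sigma>(1,2)])
  have "place (simple_transp i \<circ> \<sigma>) i < place (simple_transp i \<circ> \<sigma>) (Suc i)"
    using \<sigma>(3) by (simp add: inv_transp_comp[OF \<sigma>(1)])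
  from card_inversions_transp_up[OF p \<sigma>(2) this] show ?thesis by simp
qed

lemma permutes_eqI_order:
  fixes \<sigma> \<tau> :: "nat \<Rightarrow> nat"
  assumes \<sigma>: "\<sigma> permutes {1..n}" and \<tau>: "\<tau> permutes {1..n}"
    and le: "\<And>x y. x \<in> {1..n} \<Longrightarrow> y \<in> {1..n} \<Longrightarrow> \<sigma> x \<le> \<sigma> y \<longleftrightarrow> \<tau> x \<le> \<tau> y"
  shows "\<sigma> = \<tau>"
proof
  fix x
  show "\<sigma> x = \<tau> x"
  proof (cases "x \<in> {1..n}")
    case True
    show ?thesis
      using permutes_image[OF \<sigma>] permutes_image[OF \<tau>] le True by (rule rank_unique)
  next
    case False
    then show ?thesis using permutes_not_in[OF \<sigma>] permutes_not_in[OF \<tau>] by simp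
  qed
qed

lemma increasing_on_interval:
  fixes f :: "nat \<Rightarrow> 'a::order"
  assumes "\<And>i. i \<in> {1..n - 1} \<Longrightarrow> f i \<le> f (Suc i)" "u \<le> v" "1 \<le> u" "v \<le> n"
  shows "f u \<le> f v"
  using assms(2,4)
proof (induction v rule: dec_induct)
  case (step v)
  then show ?case using assms(1)[of v] assms(3) by (auto intro: order_trans)
qed simp

lemma exists_descent:
  assumes \<sigma>: "\<sigma> permutes {1..n}" and "\<sigma> \<noteq> id"
  obtains i where "i \<in> {1..n - 1}" "place \<sigma> (Suc i) < place \<sigma> i"
proof -
  have "\<exists>i\<in>{1..n - 1}. place \<sigma> (Suc i) < place \<sigma> i"
  proof (rule ccontr)
    assume "\<not> ?thesis"
    then have up: "place \<sigma> i \<le> place \<sigma> (Suc i)" if "i \<in> {1..n - 1}" for i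
      using that by (auto simp: not_less)
    have le: "place \<sigma> u \<le> place \<sigma> v" if "u \<le> v" "1 \<le> u" "v \<le> n" for u v
      using increasing_on_interval[of n "place \<sigma>" u v] up that by blast
    have inj: "place \<sigma> u = place \<sigma> v \<longleftrightarrow> u = v" for u v
      using permutes_inverses(1)[OF \<sigma>] by metis
    have "place \<sigma> = id"
    proof (rule permutes_eqI_order[OF permutes_inv[OF \<sigma>] permutes_id])
      fix x y assume "x \<in> {1..n}" "y \<in> {1..n}"
      then show "place \<sigma> x \<le> place \<sigma> y \<longleftrightarrow> id x \<le> id y"
        using le[of x y] le[of y x] inj[of x y] by (cases "x \<le> y") auto
    qed
    then show False using assms permutes_inv_inv[OF \<sigma>] by (metis inv_id)
  qed
  then show ?thesis using that by blast
qed

definition word_perm :: "nat list \<Rightarrow> nat \<Rightarrow> nat" where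
  "word_perm ws = foldr (\<circ>) (map simple_transp ws) id"

lemma word_perm_simps: "word_perm [] = id" "word_perm (i # ws) = simple_transp i \<circ> word_perm ws"
  by (simp_all add: word_perm_def)

lemma reduced_word_exists:
  assumes "\<sigma> permutes {1..n}"
  shows "\<exists>ws\<in>lists {1..n - 1}. length ws = card (inversions (position_pairs n) \<sigma>) \<and>
    \<sigma> = word_perm ws"
  using assms
proof (induction "card (inversions (position_pairs n) \<sigma>)" arbitrary: \<sigma> rule: less_induct)
  case less
  show ?case
  proof (cases "\<sigma> = id")
    case True
    then have "inversions (position_pairs n) \<sigma> = {}" by (auto simp: inversions_def)
    then show ?thesis using True by (intro bexI[of _ "[]"]) (auto simp: word_perm_simps)
  next
    case False
    then obtain i where i: "i \<in> {1..n - 1}" "place \<sigma> (Suc i) < place \<sigma> i"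
      using exists_descent less.prems by blast
    have c: "card (inversions (position_pairs n) \<sigma>) = Suc (card (inversions (position_pairs n) (simple_transp i \<circ> \<sigma>)))"
      by (rule card_inversions_transp_down[OF less.prems i])
    then have "card (inversions (position_pairs n) (simple_transp i \<circ> \<sigma>)) < card (inversions (position_pairs n) \<sigma>)" by linarith
    from less.hyps[OF this permutes_transp_comp[OF less.prems i(1)]]
    obtain ws where "ws \<in> lists {1..n - 1}" "length ws = card (inversions (position_pairs n) (simple_transp i \<circ> \<sigma>))"
      "simple_transp i \<circ> \<sigma> = word_perm ws"
      by blast
    moreover from this(3) have "\<sigma> = simple_transp i \<circ> word_perm ws"
      by (metis simple_transp_comp_cancel)
    ultimately show ?thesis using i c by (intro bexI[of _ "i # ws"] conjI) (simp_all add: word_perm_simps)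
  qed
qed

lemma word_length_ge:
  assumes "ws \<in> lists {1..n - 1}"
  shows "word_perm ws permutes {1..n} \<and>
    card (inversions (position_pairs n) (word_perm ws)) \<le> length ws"
  using assms
proof (induction ws)
  case Nil
  have "inversions (position_pairs n) id = {}" by (auto simp: inversions_def)
  then show ?case
    unfolding word_perm_simps by (intro conjI) (simp_all only: permutes_id card.empty le0)
next
  case (Cons i ws)
  let ?\<sigma> = "word_perm ws"
  have i: "i \<in> {1..n - 1}" and IH: "?\<sigma> permutes {1..n}" "card (inversions (position_pairs n) ?\<sigma>) \<le> length ws"
    using Cons by auto
  have "card (inversions (position_pairs n) (simple_transp i \<circ> ?\<sigma>)) \<le> Suc (card (inversions (position_pairs n) ?\<sigma>))"
    using card_inversions_transp_up[OF IH(1) i] card_inversions_transp_down[OF IH(1) i]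
      inv_neq_Suc[OF IH(1), of i] by linarith
  then show ?case using IH permutes_transp_comp[OF IH(1) i]
    unfolding word_perm_simps by (intro conjI) (simp_all only: list.size)
qed

lemma perm_length_eq_inversions:
  assumes "\<sigma> permutes {1..n}"
  shows "perm_length n \<sigma> = card (inversions (position_pairs n) \<sigma>)"
  unfolding perm_length_def word_perm_def[symmetric]
proof (rule Least_equality)
  fix k assume "\<exists>ws\<in>lists {1..n - 1}. length ws = k \<and> \<sigma> = word_perm ws"
  then show "card (inversions (position_pairs n) \<sigma>) \<le> k" using word_length_ge[of _ n] by blast
qed (use reduced_word_exists[OF assms] in blast)

text \<open>The length is the number of inversions, and the simple transposition on the left
  adds or removes the pair of places of \<open>i\<close> and \<open>i + 1\<close>.\<close>

lemma Des_L_iff: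
  assumes "\<sigma> permutes {1..n}" "i \<in> {1..n - 1}"
  shows "i \<in> Des_L n \<sigma> \<longleftrightarrow> place \<sigma> (Suc i) < place \<sigma> i"
proof -
  have "perm_length n (simple_transp i \<circ> \<sigma>) < perm_length n \<sigma> \<longleftrightarrow> place \<sigma> (Suc i) < place \<sigma> i"
    using card_inversions_transp_up[OF assms] card_inversions_transp_down[OF assms]
      inv_neq_Suc[OF assms(1), of i] permutes_transp_comp[OF assms]
    by (simp only: perm_length_eq_inversions assms(1)) linarith
  then show ?thesis using assms(2) by (simp add: Des_L_def)
qed


section \<open>The modules of linear extensions\<close>

abbreviation "keys \<equiv> Poly_Mapping.keys"

abbreviation "lookup \<equiv> Poly_Mapping.lookup"

abbreviation "single \<equiv> Poly_Mapping.single"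

lemma lookup_scale [simp]: "lookup (scale c v) x = c * lookup v x"
  by (simp add: scale_def Poly_Mapping.map.rep_eq when_def)

lemma scale_simps [simp]:
  "scale 1 v = v" "scale 0 v = 0" "scale c 0 = 0" "scale c (scale d v) = scale (c * d) v"
  "scale c (single x d) = single x (c * d)"
  by (auto intro!: poly_mapping_eqI simp: lookup_single when_def)

lemma scale_add_right: "scale c (v + w) = scale c v + scale c w"
  and scale_add_left: "scale (c + d) v = scale c v + scale d v"
  by (auto intro!: poly_mapping_eqI simp: lookup_add algebra_simps)

lemma keys_scale: "keys (scale c v) \<subseteq> keys v"
  by (auto simp: in_keys_iff)

lemma scale_conv_mult: "scale c v = single 0 c * v"
  by (simp add: scale_def mult_map_scale_conv_mult)

definition linear_map :: "(('a \<Rightarrow>\<^sub>0 complex) \<Rightarrow> ('b \<Rightarrow>\<^sub>0 complex)) \<Rightarrow> bool" where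
  "linear_map F \<longleftrightarrow> (\<forall>v w. F (v + w) = F v + F w) \<and> (\<forall>c v. F (scale c v) = scale c (F v))"

lemma linear_map_zero: "linear_map F \<Longrightarrow> F 0 = 0"
  unfolding linear_map_def by (metis scale_simps(2))

lemma linear_map_sum:
  assumes "linear_map F" shows "F (\<Sum>x\<in>S. g x) = (\<Sum>x\<in>S. F (g x))"
proof (induction S rule: infinite_finite_induct)
  case (insert x S)
  then show ?case using assms by (simp add: linear_map_def)
qed (simp_all add: linear_map_zero assms)

lemma linear_map_comp: "linear_map F \<Longrightarrow> linear_map G \<Longrightarrow> linear_map (\<lambda>v. F (G v))"
  by (simp add: linear_map_def)

lemma vector_expansion:
  "v = (\<Sum>x\<in>keys v. scale (lookup v x) (single x 1))"
proof (rule poly_mapping_eqI)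
  fix k
  show "lookup v k = lookup
    (\<Sum>x\<in>keys v. scale (lookup v x) (single x 1)) k"
    by (simp add: lookup_sum lookup_single when_def sum.delta in_keys_iff)
qed

lemma linear_map_eqI:
  assumes F: "linear_map F" and G: "linear_map G"
    and "\<And>x. x \<in> keys v \<Longrightarrow> F (single x 1) = G (single x 1)"
  shows "F v = G v"
proof -
  have "H v = (\<Sum>x\<in>keys v. scale (lookup v x) (H (single x 1)))"
    if "linear_map H" for H :: "('a \<Rightarrow>\<^sub>0 complex) \<Rightarrow> ('b \<Rightarrow>\<^sub>0 complex)"
  proof -
    have "H v = H (\<Sum>x\<in>keys v. scale (lookup v x) (single x 1))"
      using vector_expansion[of v] by simp
    also have "\<dots> = (\<Sum>x\<in>keys v. H (scale (lookup v x) (single x 1)))"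
      by (rule linear_map_sum[OF that])
    finally show ?thesis using that by (simp only: linear_map_def)
  qed
  then show ?thesis using F G assms(3) by (metis (mono_tags, lifting) sum.cong)
qed

lemma linear_extension_superset:
  assumes "finite S" "keys v \<subseteq> S"
  shows "linear_extension g v = (\<Sum>x\<in>S. scale (lookup v x) (g x))"
  unfolding linear_extension_def
  by (rule sum.mono_neutral_left) (use assms in \<open>auto simp: in_keys_iff\<close>)

lemma lookup_linear_extension:
  "lookup (linear_extension g v) y =
    (\<Sum>x\<in>keys v. lookup v x * lookup (g x) y)"
  by (simp add: linear_extension_def lookup_sum)

lemma linear_extension_linear: "linear_map (linear_extension g)"
  unfolding linear_map_def
proof (intro conjI allI)
  fix v w :: "'a \<Rightarrow>\<^sub>0 complex" and c :: complex
  let ?S = "keys v \<union> keys w"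
  have "linear_extension g (v + w) = (\<Sum>x\<in>?S. scale (lookup (v + w) x) (g x))"
    by (rule linear_extension_superset) (use keys_add[of v w] in auto)
  also have "\<dots> = (\<Sum>x\<in>?S. scale (lookup v x) (g x)) +
      (\<Sum>x\<in>?S. scale (lookup w x) (g x))"
    by (simp add: lookup_add scale_add_left sum.distrib)
  finally show "linear_extension g (v + w) = linear_extension g v + linear_extension g w"
    by (simp add: linear_extension_superset[of ?S])
  have "linear_extension g (scale c v) =
      (\<Sum>x\<in>keys v. scale (lookup (scale c v) x) (g x))"
    by (rule linear_extension_superset) (use keys_scale[of c v] in auto)
  then show "linear_extension g (scale c v) = scale c (linear_extension g v)"
    by (auto intro!: poly_mapping_eqI simp: lookup_sum linear_extension_def sum_distrib_left mult.assoc)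
qed

lemma linear_extension_single [simp]: "linear_extension g (single x c) = scale c (g x)"
  by (simp add: linear_extension_def)

text \<open>The generator \<open>\<pi>_i\<close> on basis elements, with \<^const>\<open>None\<close> for zero and with both case distinctions expressed
  by the places of \<open>i\<close> and \<open>i + 1\<close>.\<close>

definition step :: "nat rel \<Rightarrow> nat \<Rightarrow> (nat \<Rightarrow> nat) \<Rightarrow> (nat \<Rightarrow> nat) option" where
  "step P i \<gamma> =
     (if place \<gamma> (Suc i) < place \<gamma> i then Some \<gamma>
      else if (place \<gamma> i, place \<gamma> (Suc i)) \<in> P then None
      else Some (simple_transp i \<circ> \<gamma>))"

fun word_step :: "nat rel \<Rightarrow> nat list \<Rightarrow> (nat \<Rightarrow> nat) \<Rightarrow> (nat \<Rightarrow> nat) option" where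
  "word_step P [] \<gamma> = Some \<gamma>"
| "word_step P (i # ws) \<gamma> = Option.bind (word_step P ws \<gamma>) (step P i)"

definition basis_vec :: "'a option \<Rightarrow> ('a \<Rightarrow>\<^sub>0 complex)" where
  "basis_vec b = (case b of None \<Rightarrow> 0 | Some \<gamma> \<Rightarrow> single \<gamma> 1)"

lemma basis_vec_simps [simp]: "basis_vec None = 0" "basis_vec (Some \<gamma>) = single \<gamma> 1"
  by (simp_all add: basis_vec_def)

definition gen_action ::
    "nat \<Rightarrow> nat rel \<Rightarrow> nat \<Rightarrow> ((nat \<Rightarrow> nat) \<Rightarrow>\<^sub>0 complex) \<Rightarrow> ((nat \<Rightarrow> nat) \<Rightarrow>\<^sub>0 complex)" where
  "gen_action n P i = linear_extension (gen_on_basis n P i)"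

definition vectors :: "nat \<Rightarrow> nat rel \<Rightarrow> ((nat \<Rightarrow> nat) \<Rightarrow>\<^sub>0 complex) set" where
  "vectors n P = {v. keys v \<subseteq> Sigma_L n P}"

lemma Sigma_L_permutes: "\<gamma> \<in> Sigma_L n P \<Longrightarrow> \<gamma> permutes {1..n}"
  by (simp add: Sigma_L_def)

lemma Sigma_L_le: "\<gamma> \<in> Sigma_L n P \<Longrightarrow> (a, b) \<in> P \<Longrightarrow> \<gamma> a \<le> \<gamma> b"
  by (auto simp: Sigma_L_def)

text \<open>The values \<open>i\<close> and \<open>i + 1\<close> are adjacent, so exchanging them affects no relation except a possible one
  between the two elements that carry them.\<close>

lemma transp_in_Sigma_L_iff:
  assumes \<gamma>: "\<gamma> \<in> Sigma_L n P" and i: "i \<in> {1..n - 1}"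
  shows "simple_transp i \<circ> \<gamma> \<in> Sigma_L n P \<longleftrightarrow> (place \<gamma> i, place \<gamma> (Suc i)) \<notin> P"
proof -
  note p = Sigma_L_permutes[OF \<gamma>]
  have s: "\<gamma> (place \<gamma> v) = v" "place \<gamma> (\<gamma> v) = v" for v
    using permutes_inverses[OF p] by auto
  show ?thesis
  proof
    assume "simple_transp i \<circ> \<gamma> \<in> Sigma_L n P"
    then show "(place \<gamma> i, place \<gamma> (Suc i)) \<notin> P"
      using Sigma_L_le[of "simple_transp i \<circ> \<gamma>" n P "place \<gamma> i" "place \<gamma> (Suc i)"] by (auto simp: s)
  next
    assume *: "(place \<gamma> i, place \<gamma> (Suc i)) \<notin> P"
    have "simple_transp i (\<gamma> a) \<le> simple_transp i (\<gamma> b)" if "(a, b) \<in> P" for a b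
    proof (cases "\<gamma> a = \<gamma> b")
      case False
      then have "\<gamma> a < \<gamma> b" using Sigma_L_le[OF \<gamma> that] by simp
      moreover have "\<not> (\<gamma> a = i \<and> \<gamma> b = Suc i)" using * that s(2)[of a] s(2)[of b] by auto
      ultimately show ?thesis using simple_transp_mono by (simp add: less_imp_le)
    qed simp
    then show "simple_transp i \<circ> \<gamma> \<in> Sigma_L n P"
      using permutes_transp_comp[OF p i] by (auto simp: Sigma_L_def)
  qed
qed

lemma step_in_Sigma_L:
  assumes "\<gamma> \<in> Sigma_L n P" "i \<in> {1..n - 1}" "step P i \<gamma> = Some \<delta>"
  shows "\<delta> \<in> Sigma_L n P"
  using assms transp_in_Sigma_L_iff[OF assms(1,2)] by (auto simp: step_def split: if_splits)

lemma word_step_in_Sigma_L: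
  assumes "\<gamma> \<in> Sigma_L n P" "ws \<in> lists {1..n - 1}" "word_step P ws \<gamma> = Some \<delta>"
  shows "\<delta> \<in> Sigma_L n P"
  using assms(2,3)
proof (induction ws arbitrary: \<delta>)
  case (Cons i ws)
  then show ?case using step_in_Sigma_L[of _ n P i] by (auto simp: bind_eq_Some_conv)
qed (use assms(1) in simp)

lemma gen_on_basis_eq_step:
  assumes "\<gamma> \<in> Sigma_L n P" "i \<in> {1..n - 1}"
  shows "gen_on_basis n P i \<gamma> = basis_vec (step P i \<gamma>)"
  using Des_L_iff[OF Sigma_L_permutes[OF assms(1)] assms(2)] transp_in_Sigma_L_iff[OF assms]
  by (simp add: gen_on_basis_def step_def)

lemma word_action_Cons: "word_action n P (i # ws) v = gen_action n P i (word_action n P ws v)"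
  by (simp add: word_action_def gen_action_def)

lemma word_action_Nil [simp]: "word_action n P [] v = v"
  by (simp add: word_action_def)

lemma word_action_append: "word_action n P (ws @ us) v = word_action n P ws (word_action n P us v)"
  by (simp add: word_action_def)

lemma gen_action_linear: "linear_map (gen_action n P i)"
  by (simp add: gen_action_def linear_extension_linear)

lemma word_action_linear: "linear_map (word_action n P ws)"
proof (induction ws)
  case Nil then show ?case by (simp add: linear_map_def)
next
  case (Cons i ws)
  then show ?case
    using linear_map_comp[OF gen_action_linear Cons] by (simp add: word_action_Cons[abs_def])
qed

lemma word_action_single:
  assumes "\<gamma> \<in> Sigma_L n P" "ws \<in> lists {1..n - 1}"
  shows "word_action n P ws (single \<gamma> 1) = basis_vec (word_step P ws \<gamma>)"
  using assms(2)
proof (induction ws)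
  case (Cons i ws)
  show ?case
  proof (cases "word_step P ws \<gamma>")
    case None
    then show ?thesis using Cons by (simp add: word_action_Cons linear_map_zero[OF gen_action_linear])
  next
    case (Some \<delta>)
    then have "\<delta> \<in> Sigma_L n P" using Cons assms(1) word_step_in_Sigma_L by auto
    then show ?thesis
      using Cons Some by (simp add: word_action_Cons gen_action_def gen_on_basis_eq_step)
  qed
qed simp

lemma vectors_zero: "0 \<in> vectors n P"
  and vectors_single: "\<gamma> \<in> Sigma_L n P \<Longrightarrow> single \<gamma> c \<in> vectors n P"
  and vectors_add: "v \<in> vectors n P \<Longrightarrow> w \<in> vectors n P \<Longrightarrow> v + w \<in> vectors n P"
  and vectors_scale: "v \<in> vectors n P \<Longrightarrow> scale c v \<in> vectors n P"
  using keys_add[of v w] keys_scale[of c v] by (auto simp: vectors_def)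

lemma vectors_sum: "(\<And>x. x \<in> S \<Longrightarrow> g x \<in> vectors n P) \<Longrightarrow> (\<Sum>x\<in>S. g x) \<in> vectors n P"
  by (induction S rule: infinite_finite_induct) (auto intro: vectors_zero vectors_add)

lemma vectors_basis_vec:
  "(\<And>\<gamma>. b = Some \<gamma> \<Longrightarrow> \<gamma> \<in> Sigma_L n P) \<Longrightarrow> basis_vec b \<in> vectors n P"
  by (cases b) (auto intro: vectors_zero vectors_single)

lemma word_action_closed:
  assumes "v \<in> vectors n P" "ws \<in> lists {1..n - 1}"
  shows "word_action n P ws v \<in> vectors n P"
proof -
  let ?g = "\<lambda>\<gamma>. basis_vec (word_step P ws \<gamma>)"
  have "word_action n P ws v = linear_extension ?g v"
  proof (rule linear_map_eqI[OF word_action_linear linear_extension_linear])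
    fix \<gamma> assume "\<gamma> \<in> keys v"
    then have "\<gamma> \<in> Sigma_L n P" using assms(1) by (auto simp: vectors_def)
    then show "word_action n P ws (single \<gamma> 1) = linear_extension ?g (single \<gamma> 1)"
      using word_action_single assms(2) by simp
  qed
  also have "\<dots> \<in> vectors n P"
    unfolding linear_extension_def
  proof (intro vectors_sum vectors_scale vectors_basis_vec)
    fix \<gamma> \<delta> assume "\<gamma> \<in> keys v" "word_step P ws \<gamma> = Some \<delta>"
    then show "\<delta> \<in> Sigma_L n P"
      using assms word_step_in_Sigma_L[of \<gamma> n P ws] by (auto simp: vectors_def)
  qed
  finally show ?thesis .
qed

text \<open>In the braid relation both sides try to put three consecutive values into decreasing order of their places, and both
  vanish iff some pair that has to be exchanged on the way belongs to \<open>P\<close>.\<close>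

lemma
  assumes \<gamma>: "\<gamma> permutes {1..n}"
  shows step_idem: "word_step P [i, i] \<gamma> = word_step P [i] \<gamma>"
    and step_braid: "word_step P [i, Suc i, i] \<gamma> = word_step P [Suc i, i, Suc i] \<gamma>"
    and step_comm: "i + 2 \<le> j \<Longrightarrow> word_step P [i, j] \<gamma> = word_step P [j, i] \<gamma>"
proof -
  have ne: "place \<gamma> u = place \<gamma> v \<longleftrightarrow> u = v" for u v
    using permutes_inverses(1)[OF \<gamma>] by metis
  have pl: "place (simple_transp i \<circ> \<gamma>') v = place \<gamma>' (simple_transp i v)"
    if "bij \<gamma>'" for i v and \<gamma>' :: "nat \<Rightarrow> nat"
  proof -
    have "bij (simple_transp i)" "place (simple_transp i) = simple_transp i"
      by (simp_all add: simple_transp_def)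
    then show ?thesis using that by (simp add: o_inv_distrib)
  qed
  have bij: "bij \<gamma>" "bij \<gamma>' \<Longrightarrow> bij (simple_transp i \<circ> \<gamma>')" for i \<gamma>'
    using permutes_bij[OF \<gamma>] by (auto simp: simple_transp_def intro: bij_comp)
  show "word_step P [i, i] \<gamma> = word_step P [i] \<gamma>"
    using ne[of i "Suc i"] by (auto simp: step_def pl bij)
  have br: "simple_transp i \<circ> (simple_transp (Suc i) \<circ> (simple_transp i \<circ> \<gamma>)) =
      simple_transp (Suc i) \<circ> (simple_transp i \<circ> (simple_transp (Suc i) \<circ> \<gamma>))"
    by (auto simp: fun_eq_iff simple_transp_def Transposition.transpose_def)
  show "word_step P [i, Suc i, i] \<gamma> = word_step P [Suc i, i, Suc i] \<gamma>"
    using ne[of i "Suc i"] ne[of i "Suc (Suc i)"] ne[of "Suc i" "Suc (Suc i)"] br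
    by (auto simp: step_def pl bij)
  show "word_step P [i, j] \<gamma> = word_step P [j, i] \<gamma>" if "i + 2 \<le> j"
  proof -
    have "simple_transp i \<circ> (simple_transp j \<circ> \<gamma>) = simple_transp j \<circ> (simple_transp i \<circ> \<gamma>)"
      using that by (auto simp: fun_eq_iff simple_transp_def Transposition.transpose_def)
    then show ?thesis using that by (auto simp: step_def pl bij)
  qed
qed


lemma free_action_linear: "linear_map (\<lambda>f. free_action n P f v)"
  by (simp add: free_action_def linear_extension_linear)

lemma free_action_single [simp]: "free_action n P (single ws c) v = scale c (word_action n P ws v)"
  by (simp add: free_action_def)

lemma free_action_linear_vector: "linear_map (free_action n P f)"
proof -
  have "free_action n P f (v + w) = free_action n P f v + free_action n P f w" for v w
    using word_action_linear[of n P]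
    by (auto intro!: poly_mapping_eqI
        simp: linear_map_def free_action_def lookup_linear_extension lookup_add algebra_simps sum.distrib)
  moreover have "free_action n P f (scale c v) = scale c (free_action n P f v)" for c v
    using word_action_linear[of n P]
    by (auto intro!: poly_mapping_eqI
        simp: linear_map_def free_action_def lookup_linear_extension algebra_simps sum_distrib_left)
  ultimately show ?thesis by (simp add: linear_map_def)
qed

lemma scale_mult_left: "scale c f * g = scale c (f * g)"
  for f g :: "nat list \<Rightarrow>\<^sub>0 complex"
  by (simp add: scale_conv_mult mult.assoc)

lemma scale_mult_right: "f * scale c g = scale c (f * g)"
  for f g :: "nat list \<Rightarrow>\<^sub>0 complex"
proof -
  have lin: "linear_map (\<lambda>f. f * scale c g)" "linear_map (\<lambda>f. scale c (f * g))"
    by (simp_all add: linear_map_def distrib_right scale_mult_left scale_add_right mult.commute)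
  show ?thesis
  proof (rule linear_map_eqI[OF lin])
    fix ws :: "nat list"
    show "single ws 1 * scale c g = scale c (single ws 1 * g)"
      by (simp add: scale_conv_mult mult_single flip: mult.assoc)
  qed
qed

lemma free_action_mult: "free_action n P (f * g) v = free_action n P f (free_action n P g v)"
proof -
  have lin: "linear_map (\<lambda>f. free_action n P (f * g) v)" for g
    using free_action_linear[of n P v] by (simp add: linear_map_def distrib_right scale_mult_left)
  have lin': "linear_map (\<lambda>g. free_action n P (f * g) v)" for f
    using free_action_linear[of n P v] by (simp add: linear_map_def distrib_left scale_mult_right)
  show ?thesis
  proof (rule linear_map_eqI[OF lin free_action_linear])
    fix ws :: "nat list"
    show "free_action n P (single ws 1 * g) v =
        free_action n P (single ws 1) (free_action n P g v)"
    proof (rule linear_map_eqI[OF lin' linear_map_comp[OF free_action_linear_vector free_action_linear]])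
      fix us :: "nat list"
      show "free_action n P (single ws 1 * single us 1) v =
          free_action n P (single ws 1) (free_action n P (single us 1) v)"
        by (simp add: mult_single plus_list_def word_action_append)
    qed
  qed
qed

lemma free_action_one [simp]: "free_action n P 1 v = v"
  using free_action_single[of n P "[]" 1 v] by (simp add: zero_list_def flip: single_one)

lemma free_action_closed:
  assumes "f \<in> carrier (free_algebra n)" "v \<in> vectors n P"
  shows "free_action n P f v \<in> vectors n P"
  unfolding free_action_def linear_extension_def
  using assms by (intro vectors_sum vectors_scale word_action_closed) (auto simp: free_algebra_def)

text \<open>A two-sided ideal that contains the relators, hence the ideal of relations: this is why cosets act on the module.\<close>

definition annihilator :: "nat \<Rightarrow> nat rel \<Rightarrow> (nat list \<Rightarrow>\<^sub>0 complex) set" where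
  "annihilator n P = {f \<in> carrier (free_algebra n). \<forall>v\<in>vectors n P. free_action n P f v = 0}"

lemma free_algebra_simps:
  "\<zero>\<^bsub>free_algebra n\<^esub> = 0" "\<one>\<^bsub>free_algebra n\<^esub> = 1"
  "f \<oplus>\<^bsub>free_algebra n\<^esub> g = f + g" "f \<otimes>\<^bsub>free_algebra n\<^esub> g = f * g"
  by (simp_all add: free_algebra_def)

lemma free_algebra_a_inv:
  assumes "f \<in> carrier (free_algebra n)"
  shows "\<ominus>\<^bsub>free_algebra n\<^esub> f = - f"
proof -
  interpret ring "free_algebra n" by (rule ring_free_algebra)
  have "- f \<in> carrier (free_algebra n)" using assms by (simp add: free_algebra_def keys_minus)
  then show ?thesis
    using assms by (intro minus_equality) (simp_all add: free_algebra_simps)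
qed

lemma annihilator_ideal: "ideal (annihilator n P) (free_algebra n)"
proof (rule idealI[OF ring_free_algebra])
  interpret ring "free_algebra n" by (rule ring_free_algebra)
  note lin = free_action_linear[of n P]
  show "subgroup (annihilator n P) (add_monoid (free_algebra n))"
  proof (rule add.subgroupI)
    show "annihilator n P \<subseteq> carrier (free_algebra n)" by (auto simp: annihilator_def)
    have "0 \<in> annihilator n P"
      using zero_closed linear_map_zero[OF lin] by (simp add: annihilator_def free_algebra_simps)
    then show "annihilator n P \<noteq> {}" by blast
  next
    fix f assume f: "f \<in> annihilator n P"
    have "free_action n P (- f) v = 0" if "v \<in> vectors n P" for v
    proof -
      have "free_action n P (scale (-1) f) v = 0"
        using f lin[of v] that by (simp add: annihilator_def linear_map_def)
      moreover have "scale (-1) f = - f" by (auto intro!: poly_mapping_eqI)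
      ultimately show ?thesis by simp
    qed
    then show "\<ominus>\<^bsub>free_algebra n\<^esub> f \<in> annihilator n P"
      using f a_inv_closed[of f] free_algebra_a_inv[of f n] by (simp add: annihilator_def)
  next
    fix f g assume "f \<in> annihilator n P" "g \<in> annihilator n P"
    then show "f \<oplus>\<^bsub>free_algebra n\<^esub> g \<in> annihilator n P"
      using a_closed[of f g] lin by (simp add: annihilator_def linear_map_def free_algebra_simps)
  qed
next
  interpret ring "free_algebra n" by (rule ring_free_algebra)
  fix f x assume f: "f \<in> annihilator n P" and x: "x \<in> carrier (free_algebra n)"
  then have c: "f * x \<in> carrier (free_algebra n)" "x * f \<in> carrier (free_algebra n)"
    using free_algebra_mult_closed by (auto simp: annihilator_def)
  show "x \<otimes>\<^bsub>free_algebra n\<^esub> f \<in> annihilator n P"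
    using f c linear_map_zero[OF free_action_linear_vector]
    by (simp add: annihilator_def free_algebra_simps free_action_mult)
  show "f \<otimes>\<^bsub>free_algebra n\<^esub> x \<in> annihilator n P"
    using f c free_action_closed[OF x] by (simp add: annihilator_def free_algebra_simps free_action_mult)
qed

lemma word_action_eqI:
  assumes "v \<in> vectors n P" "ws \<in> lists {1..n - 1}" "us \<in> lists {1..n - 1}"
    and "\<And>\<gamma>. \<gamma> permutes {1..n} \<Longrightarrow> word_step P ws \<gamma> = word_step P us \<gamma>"
  shows "word_action n P ws v = word_action n P us v"
proof (rule linear_map_eqI[OF word_action_linear word_action_linear])
  fix \<gamma> assume "\<gamma> \<in> keys v"
  then have "\<gamma> \<in> Sigma_L n P" using assms(1) by (auto simp: vectors_def)
  then show "word_action n P ws (single \<gamma> 1) = word_action n P us (single \<gamma> 1)"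
    using word_action_single[OF _ assms(2)] word_action_single[OF _ assms(3)] assms(4) Sigma_L_permutes
    by metis
qed

lemma gen_products:
  "gen i * gen j = single [i, j] 1"
  "gen i * gen j * gen k = single [i, j, k] 1"
  by (simp_all add: gen_def mult_single plus_list_def)

lemma free_action_diff_words:
  "free_action n P (single ws 1 - single us 1) v =
    word_action n P ws v - word_action n P us v"
proof -
  let ?D = "single ws 1 - single us (1::complex)"
  have "free_action n P (?D + single us 1) v =
      free_action n P ?D v + free_action n P (single us 1) v"
    using free_action_linear[of n P v] by (simp only: linear_map_def)
  then show ?thesis by simp
qed

text \<open>Each relator is a difference of two words, and the two words agree on every basis element.\<close>

lemma relators_annihilate: "hecke0_relators n \<subseteq> annihilator n P"
proof
  fix f assume f: "f \<in> hecke0_relators n"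
  have "f \<in> carrier (free_algebra n)"
    using f unfolding hecke0_relators_def
    by (auto intro!: free_algebra_diff_closed free_algebra_mult_closed gen_carrier)
  moreover have "free_action n P f v = 0" if v: "v \<in> vectors n P" for v
  proof -
    have "\<exists>ws us. f = single ws 1 - single us 1 \<and>
        ws \<in> lists {1..n - 1} \<and> us \<in> lists {1..n - 1} \<and>
        (\<forall>\<gamma>. \<gamma> permutes {1..n} \<longrightarrow> word_step P ws \<gamma> = word_step P us \<gamma>)"
    proof -
      consider (idem) i where "i \<in> {1..n - 1}" "f = gen i * gen i - gen i"
        | (braid) i where "i \<in> {1..n - 1}" "Suc i \<in> {1..n - 1}"
            "f = gen i * gen (Suc i) * gen i - gen (Suc i) * gen i * gen (Suc i)"
        | (comm) i j where "i \<in> {1..n - 1}" "j \<in> {1..n - 1}" "\<bar>int i - int j\<bar> \<ge> 2"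
            "f = gen i * gen j - gen j * gen i"
        using f unfolding hecke0_relators_def Suc_eq_plus1 by blast
      then show ?thesis
      proof cases
        case idem
        have "word_step P [i, i] \<gamma> = word_step P [i] \<gamma>" if "\<gamma> permutes {1..n}" for \<gamma>
          using step_idem[OF that] .
        moreover have "f = single [i, i] 1 - single [i] 1"
          using idem(2) by (simp add: gen_products) (simp add: gen_def)
        ultimately show ?thesis using idem(1) by (intro exI[of _ "[i, i]"] exI[of _ "[i]"]) simp
      next
        case braid
        have "word_step P [i, Suc i, i] \<gamma> = word_step P [Suc i, i, Suc i] \<gamma>" if "\<gamma> permutes {1..n}" for \<gamma>
          using step_braid[OF that] .
        moreover have "f = single [i, Suc i, i] 1 - single [Suc i, i, Suc i] 1"
          unfolding braid(3) gen_products(2) by (rule refl)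
        ultimately show ?thesis
          using braid(1,2) by (intro exI[of _ "[i, Suc i, i]"] exI[of _ "[Suc i, i, Suc i]"]) simp
      next
        case comm
        have "word_step P [i, j] \<gamma> = word_step P [j, i] \<gamma>" if "\<gamma> permutes {1..n}" for \<gamma>
          using step_comm[OF that, of i j] step_comm[OF that, of j i] comm(3) by (cases "i \<le> j") auto
        then show ?thesis
          using comm by (intro exI[of _ "[i, j]"] exI[of _ "[j, i]"]) (simp add: gen_products)
      qed
    qed
    then obtain ws us where "f = single ws 1 - single us 1"
      "word_action n P ws v = word_action n P us v"
      using word_action_eqI[OF v] by blast
    then show ?thesis by (simp add: free_action_diff_words)
  qed
  ultimately show "f \<in> annihilator n P" by (simp add: annihilator_def)
qed

abbreviation hecke_ideal :: "nat \<Rightarrow> (nat list \<Rightarrow>\<^sub>0 complex) set" where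
  "hecke_ideal n \<equiv> Idl\<^bsub>free_algebra n\<^esub> (hecke0_relators n)"

lemma hecke_ideal_ideal: "ideal (hecke_ideal n) (free_algebra n)"
proof -
  interpret ring "free_algebra n" by (rule ring_free_algebra)
  have "hecke0_relators n \<subseteq> carrier (free_algebra n)"
    using relators_annihilate[of n "{}"] by (auto simp: annihilator_def)
  then show ?thesis by (rule genideal_ideal)
qed

lemma hecke_ideal_annihilates: "hecke_ideal n \<subseteq> annihilator n P"
  using ring.genideal_minimal[OF ring_free_algebra annihilator_ideal relators_annihilate] .

definition hecke_class :: "nat \<Rightarrow> (nat list \<Rightarrow>\<^sub>0 complex) \<Rightarrow> (nat list \<Rightarrow>\<^sub>0 complex) set" where
  "hecke_class n f = hecke_ideal n +>\<^bsub>free_algebra n\<^esub> f"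

lemma hecke_class_surj: "X \<in> carrier (hecke0 n) \<Longrightarrow> \<exists>f\<in>carrier (free_algebra n). X = hecke_class n f"
  by (auto simp: hecke0_def hecke_class_def FactRing_def A_RCOSETS_def' a_r_coset_def'
      RCOSETS_def r_coset_def)

lemma hecke_class_hom: "hecke_class n \<in> ring_hom (free_algebra n) (hecke0 n)"
  using ideal.rcos_ring_hom[OF hecke_ideal_ideal]
  by (simp add: hecke0_def hecke_class_def[abs_def])

text \<open>Two members of a coset differ by an element of the ideal, which acts as zero, so the set of results is a singleton.\<close>

lemma smult_hecke_class:
  assumes f: "f \<in> carrier (free_algebra n)" and v: "v \<in> vectors n P"
  shows "hecke_class n f \<odot>\<^bsub>poset_module n P\<^esub> v = free_action n P f v"
proof -
  have "free_action n P g v = free_action n P f v" if "g \<in> hecke_class n f" for g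
  proof -
    obtain h where h: "h \<in> hecke_ideal n" "g = h + f"
      using \<open>g \<in> hecke_class n f\<close> by (auto simp: hecke_class_def a_r_coset_def' free_algebra_simps)
    then have "free_action n P h v = 0" using hecke_ideal_annihilates v by (auto simp: annihilator_def)
    then show ?thesis using free_action_linear[of n P v] h(2) by (simp add: linear_map_def)
  qed
  moreover have "f \<in> hecke_class n f"
    unfolding hecke_class_def by (rule abelian_subgroup.a_rcos_self)
      (use f hecke_ideal_ideal ring_free_algebra in \<open>auto intro!: abelian_subgroupI3 ring.is_abelian_group ideal.axioms(1)\<close>)
  ultimately have "(\<lambda>g. free_action n P g v) ` hecke_class n f = {free_action n P f v}" by blast
  then show ?thesis by (simp add: poset_module_def)
qed

lemma poset_module_simps:
  "carrier (poset_module n P) = vectors n P" "\<zero>\<^bsub>poset_module n P\<^esub> = 0"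
  "v \<oplus>\<^bsub>poset_module n P\<^esub> w = v + w"
  by (simp_all add: poset_module_def vectors_def)

lemma poset_module_left_module: "left_module (hecke0 n) (poset_module n P)"
proof -
  have ag: "abelian_group (poset_module n P)"
  proof (rule abelian_groupI; (unfold poset_module_simps)?)
    fix v assume "v \<in> vectors n P"
    then show "\<exists>w\<in>vectors n P. w + v = 0"
      by (intro bexI[of _ "- v"]) (auto simp: vectors_def keys_minus)
  qed (auto simp: vectors_zero vectors_add ac_simps)
  note hom = hecke_class_hom[of n]
  interpret F: ring "free_algebra n" by (rule ring_free_algebra)
  note closed = F.a_closed[unfolded free_algebra_simps] F.m_closed[unfolded free_algebra_simps]
    F.one_closed[unfolded free_algebra_simps]
  have add: "hecke_class n f \<oplus>\<^bsub>hecke0 n\<^esub> hecke_class n g = hecke_class n (f + g)"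
    and mult: "hecke_class n f \<otimes>\<^bsub>hecke0 n\<^esub> hecke_class n g = hecke_class n (f * g)"
    if "f \<in> carrier (free_algebra n)" "g \<in> carrier (free_algebra n)" for f g
    using ring_hom_add[OF hom that] ring_hom_mult[OF hom that] by (simp_all add: free_algebra_simps)
  have one: "\<one>\<^bsub>hecke0 n\<^esub> = hecke_class n 1"
    using ring_hom_one[OF hom] by (simp add: free_algebra_simps)
  show ?thesis
    unfolding left_module_def left_module_axioms_def
  proof (intro conjI allI impI; (unfold poset_module_simps)?)
    fix X v assume X: "X \<in> carrier (hecke0 n)" and v: "v \<in> vectors n P"
    obtain f where f: "f \<in> carrier (free_algebra n)" "X = hecke_class n f"
      using hecke_class_surj[OF X] by blast
    show "X \<odot>\<^bsub>poset_module n P\<^esub> v \<in> vectors n P"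
      using f v by (simp add: smult_hecke_class free_action_closed)
    fix w assume w: "w \<in> vectors n P"
    show "X \<odot>\<^bsub>poset_module n P\<^esub> (v + w) = X \<odot>\<^bsub>poset_module n P\<^esub> v + X \<odot>\<^bsub>poset_module n P\<^esub> w"
      using f v w free_action_linear_vector[of n P f]
      by (simp add: smult_hecke_class vectors_add linear_map_def)
  next
    fix X Y v assume X: "X \<in> carrier (hecke0 n)" and Y: "Y \<in> carrier (hecke0 n)" and v: "v \<in> vectors n P"
    obtain f where f: "f \<in> carrier (free_algebra n)" "X = hecke_class n f"
      using hecke_class_surj[OF X] by blast
    obtain g where g: "g \<in> carrier (free_algebra n)" "Y = hecke_class n g"
      using hecke_class_surj[OF Y] by blast
    show "(X \<oplus>\<^bsub>hecke0 n\<^esub> Y) \<odot>\<^bsub>poset_module n P\<^esub> v = X \<odot>\<^bsub>poset_module n P\<^esub> v + Y \<odot>\<^bsub>poset_module n P\<^esub> v"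
      using f g v closed free_action_linear[of n P v]
      by (simp add: add smult_hecke_class linear_map_def)
    show "(X \<otimes>\<^bsub>hecke0 n\<^esub> Y) \<odot>\<^bsub>poset_module n P\<^esub> v = X \<odot>\<^bsub>poset_module n P\<^esub> (Y \<odot>\<^bsub>poset_module n P\<^esub> v)"
      using f g v closed free_action_closed[of g n v P] by (simp add: mult smult_hecke_class free_action_mult)
  next
    fix v assume "v \<in> vectors n P"
    then show "\<one>\<^bsub>hecke0 n\<^esub> \<odot>\<^bsub>poset_module n P\<^esub> v = v"
      using closed by (simp add: one smult_hecke_class)
  qed (rule ring_hecke0 ag)+
qed

text \<open>The content of an isomorphism of modules without reference to cosets.\<close>

definition module_iso :: "nat \<Rightarrow> nat rel \<Rightarrow> nat rel \<Rightarrow>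
    (((nat \<Rightarrow> nat) \<Rightarrow>\<^sub>0 complex) \<Rightarrow> ((nat \<Rightarrow> nat) \<Rightarrow>\<^sub>0 complex)) \<Rightarrow> bool" where
  "module_iso n P Q F \<longleftrightarrow> bij_betw F (vectors n P) (vectors n Q) \<and>
     (\<forall>v\<in>vectors n P. \<forall>w\<in>vectors n P. F (v + w) = F v + F w) \<and>
     (\<forall>v\<in>vectors n P. \<forall>c. F (scale c v) = scale c (F v)) \<and>
     (\<forall>v\<in>vectors n P. \<forall>i\<in>{1..n - 1}. F (gen_action n P i v) = gen_action n Q i (F v))"

lemma gen_action_closed:
  assumes "v \<in> vectors n P" "i \<in> {1..n - 1}"
  shows "gen_action n P i v \<in> vectors n P"
  using word_action_closed[OF assms(1), of "[i]"] assms(2) by (simp add: word_action_Cons)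

lemma module_iso_word:
  assumes F: "module_iso n P Q F" and v: "v \<in> vectors n P" and ws: "ws \<in> lists {1..n - 1}"
  shows "F (word_action n P ws v) = word_action n Q ws (F v)"
  using ws
proof (induction ws)
  case (Cons i ws)
  then show ?case using F word_action_closed[OF v, of ws] by (simp add: word_action_Cons module_iso_def)
qed simp

lemma module_iso_free:
  assumes F: "module_iso n P Q F" and v: "v \<in> vectors n P" and f: "f \<in> carrier (free_algebra n)"
  shows "F (free_action n P f v) = free_action n Q f (F v)"
proof -
  have z: "F 0 = 0" using F vectors_zero[of n P] unfolding module_iso_def by (metis scale_simps(2))
  have "F (\<Sum>ws\<in>S. scale (c ws) (word_action n P ws v)) = (\<Sum>ws\<in>S. scale (c ws) (word_action n Q ws (F v)))"
    if "S \<subseteq> lists {1..n - 1}" for S c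
    using that
  proof (induction S rule: infinite_finite_induct)
    case (insert ws S)
    have ws: "ws \<in> lists {1..n - 1}" using insert.prems by blast
    have "(\<Sum>ws\<in>S. scale (c ws) (word_action n P ws v)) \<in> vectors n P"
      using insert.prems v by (intro vectors_sum vectors_scale word_action_closed) auto
    moreover note w = word_action_closed[OF v ws]
    ultimately have "F (scale (c ws) (word_action n P ws v) + (\<Sum>ws\<in>S. scale (c ws) (word_action n P ws v)))
        = scale (c ws) (F (word_action n P ws v)) + F (\<Sum>ws\<in>S. scale (c ws) (word_action n P ws v))"
      using F vectors_scale[OF w] unfolding module_iso_def by auto
    then show ?case using insert module_iso_word[OF F v ws] by simp
  qed (simp_all add: z)
  then show ?thesis
    using f unfolding free_action_def linear_extension_def by (auto simp: free_algebra_def)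
qed

text \<open>The algebra is spanned by classes of words, so linearity over it amounts to compatibility with scalars and with
  the generators.\<close>

lemma modules_isomorphic_iff:
  "modules_isomorphic (hecke0 n) (poset_module n P) (poset_module n Q) \<longleftrightarrow> (\<exists>F. module_iso n P Q F)"
proof
  assume "\<exists>F. module_iso n P Q F"
  then obtain F where F: "module_iso n P Q F" by blast
  have "F (X \<odot>\<^bsub>poset_module n P\<^esub> v) = X \<odot>\<^bsub>poset_module n Q\<^esub> F v"
    if "X \<in> carrier (hecke0 n)" "v \<in> vectors n P" for X v
  proof -
    obtain f where "f \<in> carrier (free_algebra n)" "X = hecke_class n f"
      using hecke_class_surj[OF \<open>X \<in> carrier (hecke0 n)\<close>] by blast
    moreover have "F v \<in> vectors n Q" using F that(2) by (auto simp: module_iso_def bij_betw_def)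
    ultimately show ?thesis using that module_iso_free[OF F] by (simp add: smult_hecke_class)
  qed
  then show "modules_isomorphic (hecke0 n) (poset_module n P) (poset_module n Q)"
    unfolding modules_isomorphic_def poset_module_simps
    using F[unfolded module_iso_def] poset_module_left_module by blast
next
  assume "modules_isomorphic (hecke0 n) (poset_module n P) (poset_module n Q)"
  then obtain F where F: "bij_betw F (vectors n P) (vectors n Q)"
      "\<forall>v\<in>vectors n P. \<forall>w\<in>vectors n P. F (v + w) = F v + F w"
      "\<forall>X\<in>carrier (hecke0 n). \<forall>v\<in>vectors n P. F (X \<odot>\<^bsub>poset_module n P\<^esub> v) = X \<odot>\<^bsub>poset_module n Q\<^esub> F v"
    by (auto simp: modules_isomorphic_def poset_module_simps)
  have free: "F (free_action n P f v) = free_action n Q f (F v)"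
    if "f \<in> carrier (free_algebra n)" "v \<in> vectors n P" for f v
  proof -
    have "hecke_class n f \<in> carrier (hecke0 n)" by (rule ring_hom_closed[OF hecke_class_hom that(1)])
    moreover have "F v \<in> vectors n Q" using F(1) that(2) by (auto simp: bij_betw_def)
    ultimately show ?thesis using F(3) that by (simp add: smult_hecke_class[symmetric])
  qed
  have "F (scale c v) = scale c (F v)" if "v \<in> vectors n P" for v c
    using free[of "single [] c" v] that by (simp add: free_algebra_def)
  moreover have "F (gen_action n P i v) = gen_action n Q i (F v)"
    if "v \<in> vectors n P" "i \<in> {1..n - 1}" for v i
    using free[OF gen_carrier[OF that(2)] that(1)] by (simp add: gen_def word_action_Cons)
  ultimately have "module_iso n P Q F"
    unfolding module_iso_def using F by blast
  then show "\<exists>F. module_iso n P Q F" by blast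
qed

lemma module_iso_sym:
  assumes F: "module_iso n P Q F"
  shows "\<exists>G. module_iso n Q P G"
proof -
  define G where "G = inv_into (vectors n P) F"
  have bij: "bij_betw F (vectors n P) (vectors n Q)" using F by (simp add: module_iso_def)
  have G: "G v \<in> vectors n P" "F (G v) = v" if "v \<in> vectors n Q" for v
    using bij that by (auto simp: G_def bij_betw_def inv_into_into f_inv_into_f)
  have inj: "v = w" if "F v = F w" "v \<in> vectors n P" "w \<in> vectors n P" for v w
    using bij that by (auto simp: bij_betw_def inj_on_def)
  have "bij_betw G (vectors n Q) (vectors n P)"
    unfolding G_def by (rule bij_betw_inv_into[OF bij])
  moreover have "G (v + w) = G v + G w" if "v \<in> vectors n Q" "w \<in> vectors n Q" for v w
  proof (rule inj)
    have "F (G v + G w) = F (G v) + F (G w)" using F G that unfolding module_iso_def by blast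
    then show "F (G (v + w)) = F (G v + G w)" using that by (simp add: G vectors_add)
  qed (use that in \<open>simp_all add: G vectors_add\<close>)
  moreover have "G (scale c v) = scale c (G v)" if "v \<in> vectors n Q" for c v
  proof (rule inj)
    have "F (scale c (G v)) = scale c (F (G v))" using F G that unfolding module_iso_def by blast
    then show "F (G (scale c v)) = F (scale c (G v))" using that by (simp add: G vectors_scale)
  qed (use that in \<open>simp_all add: G vectors_scale\<close>)
  moreover have "G (gen_action n Q i v) = gen_action n P i (G v)" if "v \<in> vectors n Q" "i \<in> {1..n - 1}" for i v
  proof (rule inj)
    have "F (gen_action n P i (G v)) = gen_action n Q i (F (G v))" using F G that unfolding module_iso_def by blast
    then show "F (G (gen_action n Q i v)) = F (gen_action n P i (G v))"
      using that gen_action_closed[OF that] by (simp add: G)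
  qed (use G gen_action_closed that in blast)+
  ultimately show ?thesis unfolding module_iso_def by blast
qed


section \<open>Skew diagrams as rectangular sets of boxes\<close>

text \<open>Convexity for the order from north-west to south-east. Together with the absence of empty rows
  and columns it characterises the diagrams of basic skew partitions (\<open>skew_of_diagram\<close>), and unlike the two
  partitions it survives moving components around.\<close>

definition rectangular :: "(nat \<times> nat) set \<Rightarrow> bool" where
  "rectangular D \<longleftrightarrow> (\<forall>i j i' j' a b. (i, j) \<in> D \<longrightarrow> (i', j') \<in> D \<longrightarrow>
     i \<le> a \<longrightarrow> a \<le> i' \<longrightarrow> j \<le> b \<longrightarrow> b \<le> j' \<longrightarrow> (a, b) \<in> D)"

lemma rectangularD:
  "rectangular D \<Longrightarrow> (i, j) \<in> D \<Longrightarrow> (i', j') \<in> D \<Longrightarrow> i \<le> a \<Longrightarrow> a \<le> i' \<Longrightarrow> j \<le> b \<Longrightarrow> b \<le> j' \<Longrightarrow> (a, b) \<in> D"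
  unfolding rectangular_def by blast

lemma part_antimono:
  assumes "is_partition p" "1 \<le> i" "i \<le> i'"
  shows "part p i' \<le> part p i"
proof (cases "i' \<le> length p \<and> i < i'")
  case True
  then show ?thesis
    using assms sorted_wrt_nth_less[of "(\<ge>)" p "i - 1" "i' - 1"] by (auto simp: part_def is_partition_def)
next
  case False
  then show ?thesis using assms by (cases "i = i'") (auto simp: part_def)
qed

lemma part_pos_iff:
  assumes "is_partition p"
  shows "part p i > 0 \<longleftrightarrow> 1 \<le> i \<and> i \<le> length p"
proof -
  have "p ! (i - 1) \<noteq> 0" if "1 \<le> i" "i \<le> length p"
  proof
    assume "p ! (i - 1) = 0"
    moreover have "p ! (i - 1) \<in> set p" using that by (intro nth_mem) simp
    ultimately show False using assms by (simp add: is_partition_def)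
  qed
  then show ?thesis by (auto simp: part_def)
qed

lemma partition_eqI:
  assumes p: "is_partition p" and q: "is_partition q" and eq: "\<And>i. 1 \<le> i \<Longrightarrow> part p i = part q i"
  shows "p = q"
proof -
  have iff: "k \<le> length p \<longleftrightarrow> k \<le> length q" if "1 \<le> k" for k
    using part_pos_iff[OF p, of k] part_pos_iff[OF q, of k] eq[OF that] that by auto
  have "length p \<le> length q" using iff[of "length p"] by (cases "length p = 0") auto
  moreover have "length q \<le> length p" using iff[of "length q"] by (cases "length q = 0") auto
  ultimately have "length p = length q" by simp
  then show ?thesis
  proof (rule nth_equalityI)
    fix i assume "i < length p"
    then show "p ! i = q ! i" using eq[of "Suc i"] \<open>length p = length q\<close> by (simp add: part_def)
  qed
qed

lemma skew_rows:
  assumes "basic_skew_partition s"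
  shows "fst ` diagram s = {1..length (fst s)}"
proof (intro equalityI subsetI)
  fix i assume "i \<in> fst ` diagram s"
  then obtain j where "1 \<le> i" "part (fst s) i > 0" by (force simp: diagram_def)
  then show "i \<in> {1..length (fst s)}"
    using assms part_pos_iff by (auto simp: basic_skew_partition_def)
next
  fix i assume "i \<in> {1..length (fst s)}"
  then obtain j where "(i, j) \<in> diagram s" using assms unfolding basic_skew_partition_def by blast
  then show "i \<in> fst ` diagram s" by force
qed

lemma skew_cols:
  assumes "basic_skew_partition s"
  shows "snd ` diagram s = {1..part (fst s) 1}"
proof (intro equalityI subsetI)
  fix j assume "j \<in> snd ` diagram s"
  then obtain i where "1 \<le> i" "j \<le> part (fst s) i" "1 \<le> j" by (force simp: diagram_def)
  then show "j \<in> {1..part (fst s) 1}"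
    using assms part_antimono[of "fst s" 1 i] by (auto simp: basic_skew_partition_def)
next
  fix j assume "j \<in> {1..part (fst s) 1}"
  then obtain i where "(i, j) \<in> diagram s" using assms unfolding basic_skew_partition_def by blast
  then show "j \<in> snd ` diagram s" by force
qed

lemma skew_rectangular:
  assumes "basic_skew_partition s"
  shows "rectangular (diagram s)"
  unfolding rectangular_def
proof (intro allI impI)
  fix i j i' j' a b
  assume *: "(i, j) \<in> diagram s" "(i', j') \<in> diagram s" "i \<le> a" "a \<le> i'" "j \<le> b" "b \<le> j'"
  then have "part (fst s) i' \<le> part (fst s) a" "part (snd s) a \<le> part (snd s) i"
    using assms by (auto simp: diagram_def basic_skew_partition_def intro!: part_antimono)
  then show "(a, b) \<in> diagram s" using * by (auto simp: diagram_def)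
qed

lemma sum_list_part:
  assumes "length p \<le> L"
  shows "sum_list p = (\<Sum>i\<in>{1..L}. part p i)"
proof -
  have "(\<Sum>i\<in>{1..L}. part p i) = (\<Sum>i\<in>{1..length p}. part p i)"
    by (rule sum.mono_neutral_right) (use assms in \<open>auto simp: part_def\<close>)
  also have "\<dots> = (\<Sum>i\<in>{0..<length p}. p ! i)"
    by (rule sum.reindex_bij_witness[of _ Suc "\<lambda>i. i - 1"]) (auto simp: part_def)
  finally show ?thesis by (simp add: sum_list_sum_nth)
qed

lemma skew_size_card:
  assumes s: "basic_skew_partition s"
  shows "skew_size s = card (diagram s)"
proof -
  let ?L = "length (fst s)"
  have le: "part (snd s) i \<le> part (fst s) i" if "1 \<le> i" for i
    using s that by (simp add: basic_skew_partition_def)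
  have "length (snd s) \<le> ?L"
  proof (cases "length (snd s) \<ge> 1")
    case True
    have "part (snd s) (length (snd s)) > 0"
      using s True part_pos_iff[of "snd s" "length (snd s)"] by (simp add: basic_skew_partition_def)
    then have "part (fst s) (length (snd s)) > 0" using le[OF True] by simp
    then show ?thesis using s part_pos_iff[of "fst s"] by (simp add: basic_skew_partition_def)
  next
    case False
    then show ?thesis by linarith
  qed
  then have "skew_size s = (\<Sum>i\<in>{1..?L}. part (fst s) i) - (\<Sum>i\<in>{1..?L}. part (snd s) i)"
    by (simp add: skew_size_def sum_list_part[of _ ?L])
  also have "\<dots> = (\<Sum>i\<in>{1..?L}. part (fst s) i - part (snd s) i)"
    using le by (intro sum_subtractf_nat[symmetric]) auto
  also have "\<dots> = (\<Sum>i\<in>{1..?L}. card {part (snd s) i<..part (fst s) i})" by simp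
  also have "\<dots> = card (SIGMA i:{1..?L}. {part (snd s) i<..part (fst s) i})"
    by (rule card_SigmaI[symmetric]) auto
  also have "(SIGMA i:{1..?L}. {part (snd s) i<..part (fst s) i}) = diagram s"
  proof -
    have "i \<in> {1..?L}" if "(i, j) \<in> diagram s" for i j
      using that skew_rows[OF s] by (metis fst_conv image_eqI)
    then show ?thesis by (fastforce simp: diagram_def)
  qed
  finally show ?thesis .
qed

lemma diagram_row:
  assumes "basic_skew_partition s" "1 \<le> i"
  shows "{j. (i, j) \<in> diagram s} = {part (snd s) i<..part (fst s) i}"
  using assms by (auto simp: diagram_def)

text \<open>Row \<open>i\<close> is the interval from \<open>part m i + 1\<close> to \<open>part l i\<close>. It is nonempty for every \<open>i\<close> up to the length of \<open>l\<close>, so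
  both ends can be read off; beyond that, both parts are zero.\<close>

lemma diagram_inject:
  assumes s: "basic_skew_partition s" and t: "basic_skew_partition t" and eq: "diagram s = diagram t"
  shows "s = t"
proof -
  have len: "length (fst s) = length (fst t)"
  proof -
    have "card (fst ` diagram s) = card (fst ` diagram t)" by (simp only: eq)
    then have "card {1..length (fst s)} = card {1..length (fst t)}"
      by (simp only: skew_rows[OF s] skew_rows[OF t])
    then show ?thesis by simp
  qed
  have parts: "part (fst s) i = part (fst t) i \<and> part (snd s) i = part (snd t) i" if i: "1 \<le> i" for i
  proof (cases "i \<le> length (fst s)")
    case True
    have "{part (snd s) i<..part (fst s) i} = {part (snd t) i<..part (fst t) i}"
      using diagram_row[OF s i] diagram_row[OF t i] eq by simp
    moreover have "{part (snd s) i<..part (fst s) i} \<noteq> {}"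
      using s True i diagram_row[OF s i] unfolding basic_skew_partition_def by fastforce
    ultimately show ?thesis
      by (metis Ioc_inj greaterThanAtMost_empty_iff2 not_le)
  next
    case False
    have "part (snd u) i = 0" if "part (fst u) i = 0" "basic_skew_partition u" for u
      using that i unfolding basic_skew_partition_def by (metis le_zero_eq)
    then show ?thesis using False len s t by (simp add: part_def)
  qed
  show ?thesis
    using s t parts by (intro prod_eqI partition_eqI) (auto simp: basic_skew_partition_def)
qed

text \<open>If one of the two ends moved to the right from one row to a lower one, convexity would put a box
  beyond the end of one of the two rows.\<close>

lemma rectangular_row_bounds:
  assumes D: "rectangular D" "finite D" and rows: "fst ` D = {1..L}"
    and i: "i \<in> {1..L}" "i' \<in> {1..L}" "i \<le> i'"
  shows "Max {j. (i', j) \<in> D} \<le> Max {j. (i, j) \<in> D}"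
    and "Min {j. (i', j) \<in> D} \<le> Min {j. (i, j) \<in> D}"
proof -
  have fin: "finite {j. (k, j) \<in> D}" for k
    by (rule finite_subset[OF _ finite_imageI[OF D(2), of snd]]) force
  have ne: "{j. (k, j) \<in> D} \<noteq> {}" if "k \<in> {1..L}" for k
  proof -
    have "k \<in> fst ` D" using that rows by (rule ssubst[rotated])
    then show ?thesis by force
  qed
  obtain j where j: "(i, j) \<in> D" using ne[OF i(1)] by blast
  obtain j' where j': "(i', j') \<in> D" using ne[OF i(2)] by blast
  have m: "(k, Max {j. (k, j) \<in> D}) \<in> D" "(k, Min {j. (k, j) \<in> D}) \<in> D" if "k \<in> {1..L}" for k
    using Max_in[OF fin ne[OF that]] Min_in[OF fin ne[OF that]] by auto
  show "Max {j. (i', j) \<in> D} \<le> Max {j. (i, j) \<in> D}"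
  proof (rule ccontr)
    assume *: "\<not> ?thesis"
    then have "(i, Max {j. (i', j) \<in> D}) \<in> D"
      using rectangularD[OF D(1) m(1)[OF i(1)] m(1)[OF i(2)], of i "Max {j. (i', j) \<in> D}"] i by simp
    then show False using * Max_ge[OF fin] by blast
  qed
  show "Min {j. (i', j) \<in> D} \<le> Min {j. (i, j) \<in> D}"
  proof (rule ccontr)
    assume *: "\<not> ?thesis"
    then have "(i', Min {j. (i, j) \<in> D}) \<in> D"
      using rectangularD[OF D(1) m(2)[OF i(1)] m(2)[OF i(2)], of i' "Min {j. (i, j) \<in> D}"] i by simp
    then show False using * Min_le[OF fin] by blast
  qed
qed

text \<open>The ends of the rows are the parts of the two partitions. The inner one loses its zero parts,
  which stand at its end because the left ends of the rows move to the left.\<close>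

lemma skew_of_diagram:
  assumes D: "rectangular D" "finite D" and rows: "fst ` D = {1..L}" and cols: "snd ` D = {1..C}"
  obtains s where "basic_skew_partition s" "diagram s = D"
proof -
  let ?R = "\<lambda>i. {j. (i, j) \<in> D}"
  define l where "l = map (\<lambda>i. Max (?R i)) [1..<Suc L]"
  define m where "m = filter (\<lambda>x. x \<noteq> 0) (map (\<lambda>i. Min (?R i) - 1) [1..<Suc L])"
  have fin: "finite (?R i)" for i
    by (rule finite_subset[OF _ finite_imageI[OF D(2), of snd]]) force
  have ne: "?R i \<noteq> {}" if "i \<in> {1..L}" for i
  proof -
    have "i \<in> fst ` D" using that rows by (rule ssubst[rotated])
    then show ?thesis by force
  qed
  have "D \<subseteq> {1..L} \<times> {1..C}"
    unfolding rows[symmetric] cols[symmetric] by (rule subset_fst_snd)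
  then have pos: "j \<ge> 1" "j \<le> C" "i \<ge> 1" "i \<le> L" if "(i, j) \<in> D" for i j
    using that by auto
  have ends: "(i, Min (?R i)) \<in> D" "(i, Max (?R i)) \<in> D" if "i \<in> {1..L}" for i
    using Min_in[OF fin ne[OF that]] Max_in[OF fin ne[OF that]] by simp_all
  have row: "?R i = {Min (?R i)..Max (?R i)}" if "i \<in> {1..L}" for i
  proof (intro equalityI subsetI)
    fix j assume "j \<in> {Min (?R i)..Max (?R i)}"
    then have "(i, j) \<in> D"
      by (intro rectangularD[OF D(1) ends[OF that]]) simp_all
    then show "j \<in> ?R i" by simp
  next
    fix j assume "j \<in> ?R i"
    then show "j \<in> {Min (?R i)..Max (?R i)}"
      unfolding atLeastAtMost_iff by (intro conjI Min_le[OF fin] Max_ge[OF fin])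
  qed
  have minpos: "Min (?R i) \<ge> 1" "Max (?R i) \<ge> 1" if "i \<in> {1..L}" for i
    using pos(1)[OF ends(1)[OF that]] pos(1)[OF ends(2)[OF that]] by simp_all
  have l: "part l i = (if i \<in> {1..L} then Max (?R i) else 0)" for i
    by (auto simp: part_def l_def simp del: upt_Suc)
  \<comment> \<open>The inner partition before its trailing zeros are dropped.\<close>
  define m' where "m' = map (\<lambda>i. Min (?R i) - 1) [1..<Suc L]"
  have sm': "sorted_wrt (\<ge>) m'"
    unfolding m'_def sorted_wrt_map
    by (rule sorted_wrt_mono_rel[OF _ sorted_wrt_upt])
      (use rectangular_row_bounds(2)[OF D rows] in \<open>auto intro!: diff_le_mono\<close>)
  have filter_part: "part (filter (\<lambda>x. x \<noteq> 0) xs) i = part xs i" if "sorted_wrt (\<ge>) xs"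
    for xs :: "nat list" and i
    using that
  proof (induction xs arbitrary: i)
    case (Cons x xs)
    show ?case
    proof (cases "x = 0")
      case True
      then have z: "set (x # xs) \<subseteq> {0}" using Cons.prems by auto
      have "(x # xs) ! k = 0" if "k < length (x # xs)" for k
        using nth_mem[OF that] z by blast
      from this[of "i - 1"] have "part (x # xs) i = 0" by (auto simp: part_def)
      moreover have "filter (\<lambda>x. x \<noteq> 0) (x # xs) = []" using z by (auto simp: filter_empty_conv)
      ultimately show ?thesis by (simp add: part_def)
    next
      case False
      then show ?thesis using Cons.IH[of "i - 1"] Cons.prems
        by (auto simp: part_def nth_Cons' split: if_splits)
    qed
  qed simp
  have m: "part m i = (if i \<in> {1..L} then Min (?R i) - 1 else 0)" for i
    using filter_part[OF sm', of i]
    by (auto simp: part_def m_def m'_def simp del: upt_Suc)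
  have pl: "is_partition l"
    unfolding is_partition_def
  proof
    show "sorted_wrt (\<ge>) l"
      unfolding l_def sorted_wrt_map
      by (rule sorted_wrt_mono_rel[OF _ sorted_wrt_upt])
        (use rectangular_row_bounds(1)[OF D rows] in auto)
    show "0 \<notin> set l" using minpos(2) by (force simp: l_def)
  qed
  have pm: "is_partition m"
    using sorted_wrt_filter[OF sm'] by (simp add: is_partition_def m_def m'_def)
  have dia: "diagram (l, m) = D"
  proof (rule Set.set_eqI)
    fix b show "b \<in> diagram (l, m) \<longleftrightarrow> b \<in> D"
    proof (cases b)
      case (Pair i j)
      show ?thesis
      proof (cases "i \<in> {1..L}")
        case True
        then have "(i, j) \<in> diagram (l, m) \<longleftrightarrow> Min (?R i) \<le> j \<and> j \<le> Max (?R i)"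
          using minpos[OF True] by (auto simp: diagram_def l m)
        also have "\<dots> \<longleftrightarrow> j \<in> ?R i" using row[OF True] by auto
        finally show ?thesis using Pair by simp
      next
        case False
        then show ?thesis using Pair pos(3,4)[of i j] by (auto simp: diagram_def l m)
      qed
    qed
  qed
  have "part m i \<le> part l i" for i
    using Min_le[OF fin Max_in[OF fin ne], of i] by (auto simp: l m)
  moreover have "part l 1 \<le> C"
    using pos(2)[of 1 "Max (?R 1)"] Max_in[OF fin ne, of 1] by (auto simp: l)
  moreover have "length l = L" by (simp add: l_def)
  moreover have "\<exists>i. (i, j) \<in> D" if "j \<in> {1..C}" for j
  proof -
    have "j \<in> snd ` D" using that cols by (rule ssubst[rotated])
    then show ?thesis by force
  qed
  ultimately have "basic_skew_partition (l, m)"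
    unfolding basic_skew_partition_def dia fst_conv snd_conv using pl pm ends
    by (meson atLeastAtMost_iff order_trans)
  then show ?thesis using dia that by blast
qed


section \<open>Grids: labelled skew diagrams\<close>

text \<open>A filling of a basic skew diagram, seen from the labels: \<open>x\<close> stands in the box \<open>(row x, col x)\<close>. In this form rows and columns
  are functions on the ground set of \<open>P\<close>, where regularity and linear extensions live as well.
  The images \<open>{1..L}\<close> and \<open>{1..C}\<close> say that there are no empty rows or columns.\<close>

locale grid =
  fixes n :: nat and P :: "nat rel" and row col :: "nat \<Rightarrow> nat" and L C :: nat
  assumes inj: "x \<in> {1..n} \<Longrightarrow> y \<in> {1..n} \<Longrightarrow> row x = row y \<Longrightarrow> col x = col y \<Longrightarrow> x = y"
    and P_iff: "(x, y) \<in> P \<longleftrightarrow> x \<in> {1..n} \<and> y \<in> {1..n} \<and> row x \<le> row y \<and> col x \<le> col y"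
    and rows: "row ` {1..n} = {1..L}" and cols: "col ` {1..n} = {1..C}"
    and rect: "x \<in> {1..n} \<Longrightarrow> y \<in> {1..n} \<Longrightarrow> row x \<le> a \<Longrightarrow> a \<le> row y \<Longrightarrow> col x \<le> b \<Longrightarrow> b \<le> col y \<Longrightarrow>
      \<exists>z\<in>{1..n}. row z = a \<and> col z = b"
begin

definition cells :: "(nat \<times> nat) set" where
  "cells = (\<lambda>x. (row x, col x)) ` {1..n}"

lemma cells_iff: "(i, j) \<in> cells \<longleftrightarrow> (\<exists>x\<in>{1..n}. row x = i \<and> col x = j)"
  by (auto simp: cells_def)

lemma cells_rectangular: "rectangular cells"
  unfolding rectangular_def cells_iff using rect by metis

abbreviation comparable :: "nat rel" where "comparable \<equiv> P \<union> P\<inverse>"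

abbreviation linked :: "nat rel" where "linked \<equiv> comparable\<^sup>*"

lemma linked_sym: "(x, y) \<in> linked \<Longrightarrow> (y, x) \<in> linked"
  using sym_rtrancl[of comparable] by (auto simp: sym_def)

lemma linked_range: "(x, y) \<in> linked \<Longrightarrow> x \<in> {1..n} \<Longrightarrow> y \<in> {1..n}"
  by (induction rule: rtrancl_induct) (auto simp: P_iff)

text \<open>Depends on \<open>P\<close> only, and so names a component independently of the filling.\<close>

definition least_label :: "nat \<Rightarrow> nat" where
  "least_label x = Min (linked `` {x})"

lemma finite_linked_class: "x \<in> {1..n} \<Longrightarrow> finite (linked `` {x})"
  by (rule finite_subset[of _ "{1..n}"]) (use linked_range in \<open>blast, simp\<close>)

lemma least_label_linked: "x \<in> {1..n} \<Longrightarrow> (x, least_label x) \<in> linked"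
  unfolding least_label_def using Min_in[OF finite_linked_class, of x] by blast

lemma least_label_le: "x \<in> {1..n} \<Longrightarrow> (x, y) \<in> linked \<Longrightarrow> least_label x \<le> y"
  unfolding least_label_def by (rule Min_le[OF finite_linked_class]) auto

lemma least_label_eq_iff:
  assumes "x \<in> {1..n}" "y \<in> {1..n}"
  shows "least_label x = least_label y \<longleftrightarrow> (x, y) \<in> linked"
proof
  assume "least_label x = least_label y"
  then show "(x, y) \<in> linked"
    using least_label_linked[OF assms(1)] linked_sym[OF least_label_linked[OF assms(2)]]
    by (metis rtrancl_trans)
next
  assume xy: "(x, y) \<in> linked"
  then have "linked `` {x} = linked `` {y}"
    using linked_sym[OF xy] by (auto intro: rtrancl_trans)
  then show "least_label x = least_label y" by (simp only: least_label_def)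
qed

lemma comparable_imp_linked: "(x, y) \<in> P \<Longrightarrow> (x, y) \<in> linked"
  by (rule r_into_rtrancl) simp

definition northeast :: "nat \<Rightarrow> nat \<Rightarrow> bool" where
  "northeast x y \<longleftrightarrow> row x < row y \<and> col y < col x"

text \<open>Boxes in different components are incomparable, so one of them is strictly above and strictly to the right of the other.\<close>

lemma unlinked_northeast:
  assumes "x \<in> {1..n}" "y \<in> {1..n}" "(x, y) \<notin> linked"
  shows "northeast x y \<or> northeast y x"
proof -
  have "(x, y) \<notin> P" "(y, x) \<notin> P" using assms(3) comparable_imp_linked linked_sym by blast+
  then show ?thesis using assms by (auto simp: P_iff northeast_def)
qed

text \<open>Moving \<open>x\<close> to a comparable element \<open>v\<close> of its component could only change the relation to \<open>y\<close> into its
  opposite; then \<open>v\<close> would lie strictly south-west of \<open>x\<close> and not be comparable to it.\<close>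

lemma northeast_linked_left:
  assumes x: "x \<in> {1..n}" and y: "y \<in> {1..n}" and xy: "(x, y) \<notin> linked" and ne: "northeast x y"
    and x': "(x, x') \<in> linked"
  shows "northeast x' y"
  using x'
proof (induction rule: rtrancl_induct)
  case (step u v)
  have v: "(x, v) \<in> linked" using step by (meson rtrancl.rtrancl_into_rtrancl)
  then have "(v, y) \<notin> linked" using xy by (meson rtrancl_trans)
  then have "northeast v y \<or> northeast y v"
    using unlinked_northeast linked_range[OF v x] y by blast
  moreover have "\<not> northeast y v"
    using step(2) step.IH by (auto simp: northeast_def P_iff)
  ultimately show ?case by blast
qed (rule ne)

text \<open>So a component lies entirely above another one as soon as one of its boxes lies above one box of the other.\<close>

lemma northeast_linked:
  assumes x: "x \<in> {1..n}" and y: "y \<in> {1..n}" and xy: "(x, y) \<notin> linked" and ne: "northeast x y"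
    and x': "(x, x') \<in> linked" and y': "(y, y') \<in> linked"
  shows "northeast x' y'"
  using y'
proof (induction rule: rtrancl_induct)
  case base
  show ?case by (rule northeast_linked_left[OF x y xy ne x'])
next
  case (step u v)
  have v: "(y, v) \<in> linked" using step by (meson rtrancl.rtrancl_into_rtrancl)
  have "(x', v) \<notin> linked"
  proof
    assume "(x', v) \<in> linked"
    then have "(x, v) \<in> linked" using x' by (meson rtrancl_trans)
    then show False using xy linked_sym[OF v] by (meson rtrancl_trans)
  qed
  then have "northeast x' v \<or> northeast v x'"
    using unlinked_northeast linked_range[OF v y] linked_range[OF x' x] by blast
  moreover have "\<not> northeast v x'"
    using step(2) step.IH by (auto simp: northeast_def P_iff)
  ultimately show ?case by blast
qed

text \<open>A chain of comparable boxes that passes from row \<open>i\<close> or above to a lower row contains two comparable boxes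
  on both sides of the boundary, and the rectangle they span meets rows \<open>i\<close> and \<open>i + 1\<close> in a common column.\<close>

lemma linked_shared_column:
  assumes "(x, y) \<in> linked" "row x \<le> i" "i < row y"
  shows "\<exists>z\<in>{1..n}. \<exists>w\<in>{1..n}. row z = i \<and> row w = Suc i \<and> col z = col w"
proof (rule ccontr)
  assume no: "\<not> ?thesis"
  have "row y \<le> i"
    using assms(1)
  proof (induction rule: rtrancl_induct)
    case (step u v)
    show ?case
    proof (rule ccontr)
      assume v: "\<not> row v \<le> i"
      then have "(u, v) \<in> P" using step by (auto simp: P_iff)
      then have uv: "u \<in> {1..n}" "v \<in> {1..n}" "col u \<le> col v" by (auto simp: P_iff)
      obtain z where "z \<in> {1..n}" "row z = i" "col z = col u"
        using rect[OF uv(1,2), of i "col u"] v step.IH uv by auto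
      moreover obtain w where "w \<in> {1..n}" "row w = Suc i" "col w = col u"
        using rect[OF uv(1,2), of "Suc i" "col u"] v step.IH uv by auto
      ultimately show False using no by metis
    qed
  qed (use assms in simp)
  then show False using assms by simp
qed

end

locale schur_grid = grid +
  assumes row_dec: "x \<in> {1..n} \<Longrightarrow> y \<in> {1..n} \<Longrightarrow> row x = row y \<Longrightarrow> col x < col y \<Longrightarrow> y < x"
    and col_inc: "x \<in> {1..n} \<Longrightarrow> y \<in> {1..n} \<Longrightarrow> col x = col y \<Longrightarrow> row x < row y \<Longrightarrow> x < y"
begin

text \<open>From \<open>x\<close> one can walk to \<open>y\<close> by steps down and to the left, and each step increases the
  label: columns increase downwards, rows increase to the left.\<close>

lemma linked_southwest_less:
  assumes "x \<in> {1..n}" "y \<in> {1..n}" "(x, y) \<in> linked" "row x \<le> row y" "col y \<le> col x" "x \<noteq> y"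
  shows "x < y"
  using assms
proof (induction "(row y - row x) + (col x - col y)" arbitrary: x rule: less_induct)
  case less
  note xy = less.prems
  have walk: "x < y"
    if z: "z \<in> {1..n}" "x < z" "(x, z) \<in> P \<or> (z, x) \<in> P" "row z \<le> row y" "col y \<le> col z"
      "(row y - row z) + (col z - col y) < (row y - row x) + (col x - col y)" for z
  proof (cases "z = y")
    case False
    have "(z, x) \<in> linked" using z(3) by (intro r_into_rtrancl) auto
    then have "(z, y) \<in> linked" using xy(3) by (rule rtrancl_trans)
    then have "z < y" using less.hyps[OF z(6,1) xy(2)] z False by blast
    then show ?thesis using z(2) by simp
  qed (use z in simp)
  show ?case
  proof (cases "row x = row y \<or> col x = col y")
    case True
    then show ?thesis
      using xy row_dec[of y x] col_inc[of x y] inj[of x y] by (metis le_neq_implies_less)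
  next
    case False
    then have lt: "row x < row y" "col y < col x" using xy by auto
    \<comment> \<open>Go down if the box below exists. If not, the column shared by rows \<open>row x\<close> and \<open>row x + 1\<close> lies to the left of \<open>x\<close>, so there is a box to the left.\<close>
    show ?thesis
    proof (cases "\<exists>z\<in>{1..n}. row z = Suc (row x) \<and> col z = col x")
      case True
      then obtain z where z: "z \<in> {1..n}" "row z = Suc (row x)" "col z = col x" by blast
      have "x < z" using col_inc[OF xy(1) z(1)] z(2,3) by simp
      moreover have "(x, z) \<in> P" using z xy(1) by (simp add: P_iff)
      moreover have "(row y - row z) + (col z - col y) < (row y - row x) + (col x - col y)"
        using z(2,3) lt by linarith
      ultimately show ?thesis using z lt by (intro walk[of z]) auto
    next
      case False
      obtain u v where uv: "u \<in> {1..n}" "v \<in> {1..n}" "row u = row x" "row v = Suc (row x)" "col u = col v"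
        using linked_shared_column[OF xy(3), of "row x"] lt by auto
      have "col u < col x"
      proof (rule ccontr)
        assume "\<not> col u < col x"
        then show False using rect[of x v "Suc (row x)" "col x"] uv xy(1) False by auto
      qed
      then have "col u \<le> col x - 1" by simp
      then obtain z where z: "z \<in> {1..n}" "row z = row x" "col z = col x - 1"
        using rect[of u x "row x" "col x - 1"] uv xy(1) by auto
      have c: "col z < col x" "col y \<le> col z" using z(3) lt by simp_all
      have "x < z" by (rule row_dec[OF z(1) xy(1) z(2) c(1)])
      moreover have "(z, x) \<in> P" using z(1,2) c(1) xy(1) by (simp add: P_iff)
      moreover have "(row y - row z) + (col z - col y) < (row y - row x) + (col x - col y)"
        using z(2) c by linarith
      ultimately show ?thesis using z(1,2) c(2) xy(4) by (intro walk[of z]) auto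
    qed
  qed
qed

text \<open>If \<open>y\<close> were smaller than some element of the component of \<open>x\<close>, then on a path from the minimum of that component there would be
  a comparable pair with \<open>y\<close> strictly between its two labels; regularity would then make \<open>y\<close> comparable
  to one of them, and hence a member of the component.\<close>

lemma regular_linked_interval:
  assumes reg: "regular n P" and x: "x \<in> {1..n}" and y: "y \<in> {1..n}"
    and xy: "(x, y) \<notin> linked" and lt: "least_label x < least_label y"
  shows "x < y"
proof -
  let ?m = "least_label x"
  have m: "(x, ?m) \<in> linked" by (rule least_label_linked[OF x])
  have "?m < y" using lt least_label_le[OF y rtrancl_refl] by simp
  have "z < y" if "(?m, z) \<in> linked" for z
    using that
  proof (induction rule: rtrancl_induct)
    case (step u v)
    have xv: "(x, v) \<in> linked" using m step by (meson rtrancl.rtrancl_into_rtrancl rtrancl_trans)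
    have xu: "(x, u) \<in> linked" using m step by (meson rtrancl_trans)
    have un: "(u, y) \<notin> P" "(y, u) \<notin> P" "(v, y) \<notin> P" "(y, v) \<notin> P"
      using xy xu xv comparable_imp_linked linked_sym by (meson rtrancl_trans)+
    have "v \<noteq> y" using xv xy by blast
    moreover have "\<not> y < v"
    proof
      assume "y < v"
      have "u \<in> {1..n}" "v \<in> {1..n}" using xu xv x linked_range by blast+
      then show False
        using reg step(2) step.IH \<open>y < v\<close> un y unfolding regular_def by blast
    qed
    ultimately show ?case by simp
  qed (rule \<open>?m < y\<close>)
  then show ?thesis using linked_sym[OF m] by blast
qed

end

text \<open>Boxes in the same row or column satisfy the condition in every Schur labeling. The case of boxes strictly south-west
  of each other, possibly in different components, is what makes the module depend on positions only.\<close>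

locale regular_grid = grid +
  assumes southwest_less:
    "x \<in> {1..n} \<Longrightarrow> y \<in> {1..n} \<Longrightarrow> row x \<le> row y \<Longrightarrow> col y \<le> col x \<Longrightarrow> x \<noteq> y \<Longrightarrow> x < y"
begin

text \<open>An interval of \<open>P\<close> lies in one row iff its labels decrease along \<open>P\<close>: otherwise the rectangle has a corner below
  \<open>y\<close> in the column of \<open>y\<close>, with a larger label.\<close>

lemma same_row_iff:
  assumes yx: "(y, x) \<in> P"
  shows "row x \<le> row y \<longleftrightarrow> (\<forall>u v. (y, u) \<in> P \<and> (u, v) \<in> P \<and> (v, x) \<in> P \<longrightarrow> v \<le> u)"
proof
  assume *: "row x \<le> row y"
  show "\<forall>u v. (y, u) \<in> P \<and> (u, v) \<in> P \<and> (v, x) \<in> P \<longrightarrow> v \<le> u"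
  proof (intro allI impI)
    fix u v assume uv: "(y, u) \<in> P \<and> (u, v) \<in> P \<and> (v, x) \<in> P"
    then have "u \<in> {1..n}" "v \<in> {1..n}" "row v \<le> row u" "col u \<le> col v" "row u = row v"
      using * by (auto simp: P_iff)
    then show "v \<le> u" using southwest_less[of v u] by (cases "u = v") auto
  qed
next
  assume *: "\<forall>u v. (y, u) \<in> P \<and> (u, v) \<in> P \<and> (v, x) \<in> P \<longrightarrow> v \<le> u"
  show "row x \<le> row y"
  proof (rule ccontr)
    assume lt: "\<not> row x \<le> row y"
    obtain z where z: "z \<in> {1..n}" "row z = row x" "col z = col y"
      using rect[of y x "row x" "col y"] yx by (auto simp: P_iff)
    then have "(y, y) \<in> P" "(y, z) \<in> P" "(z, x) \<in> P" using yx by (auto simp: P_iff)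
    then have "z \<le> y" using * by blast
    have "y < z"
    proof (rule southwest_less[OF _ z(1)])
      show "y \<noteq> z" using z(2) lt by auto
    qed (use yx z in \<open>simp_all add: P_iff\<close>)
    then show False using \<open>z \<le> y\<close> by simp
  qed
qed

lemma same_col_iff:
  assumes yx: "(y, x) \<in> P"
  shows "col x \<le> col y \<longleftrightarrow> (\<forall>u v. (y, u) \<in> P \<and> (u, v) \<in> P \<and> (v, x) \<in> P \<longrightarrow> u \<le> v)"
proof
  assume *: "col x \<le> col y"
  show "\<forall>u v. (y, u) \<in> P \<and> (u, v) \<in> P \<and> (v, x) \<in> P \<longrightarrow> u \<le> v"
  proof (intro allI impI)
    fix u v assume uv: "(y, u) \<in> P \<and> (u, v) \<in> P \<and> (v, x) \<in> P"
    then have "u \<in> {1..n}" "v \<in> {1..n}" "col v \<le> col u" "row u \<le> row v" "col u = col v"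
      using * by (auto simp: P_iff)
    then show "u \<le> v" using southwest_less[of u v] by (cases "u = v") auto
  qed
next
  assume *: "\<forall>u v. (y, u) \<in> P \<and> (u, v) \<in> P \<and> (v, x) \<in> P \<longrightarrow> u \<le> v"
  show "col x \<le> col y"
  proof (rule ccontr)
    assume lt: "\<not> col x \<le> col y"
    obtain z where z: "z \<in> {1..n}" "row z = row y" "col z = col x"
      using rect[of y x "row y" "col x"] yx by (auto simp: P_iff)
    then have "(y, y) \<in> P" "(y, z) \<in> P" "(z, x) \<in> P" using yx by (auto simp: P_iff)
    then have "y \<le> z" using * by blast
    have "z < y"
    proof (rule southwest_less[OF z(1)])
      show "z \<noteq> y" using z(3) lt by auto
    qed (use yx z in \<open>simp_all add: P_iff\<close>)
    then show False using \<open>y \<le> z\<close> by simp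
  qed
qed

text \<open>Incomparable elements are ordered by their labels, comparable ones by \<open>P\<close> and by whether their interval fills one row. So
  the preorder of the rows can be expressed by \<open>P\<close>.\<close>

lemma row_le_iff:
  assumes "x \<in> {1..n}" "y \<in> {1..n}"
  shows "row x \<le> row y \<longleftrightarrow> (x, y) \<in> P \<or>
    (if (y, x) \<in> P then (\<forall>u v. (y, u) \<in> P \<and> (u, v) \<in> P \<and> (v, x) \<in> P \<longrightarrow> v \<le> u) else x < y)"
proof (cases "(x, y) \<in> P \<or> (y, x) \<in> P")
  case True
  then show ?thesis using same_row_iff[of y x] by (auto simp: P_iff)
next
  case False
  then have "row x \<le> row y \<longleftrightarrow> x < y"
    using southwest_less[of x y] southwest_less[of y x] assms by (fastforce simp: P_iff)
  then show ?thesis using False by simp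
qed

lemma col_le_iff:
  assumes "x \<in> {1..n}" "y \<in> {1..n}"
  shows "col x \<le> col y \<longleftrightarrow> (x, y) \<in> P \<or>
    (if (y, x) \<in> P then (\<forall>u v. (y, u) \<in> P \<and> (u, v) \<in> P \<and> (v, x) \<in> P \<longrightarrow> u \<le> v) else y < x)"
proof (cases "(x, y) \<in> P \<or> (y, x) \<in> P")
  case True
  then show ?thesis using same_col_iff[of y x] by (auto simp: P_iff)
next
  case False
  then have "col x \<le> col y \<longleftrightarrow> y < x"
    using southwest_less[of x y] southwest_less[of y x] assms by (fastforce simp: P_iff)
  then show ?thesis using False by simp
qed

end

text \<open>The preorders of rows and columns are determined by \<open>P\<close>, and rows and columns are numbered without gaps.\<close>

lemma regular_grid_unique:
  assumes "regular_grid n P row col L C" "regular_grid n P row' col' L' C'" and x: "x \<in> {1..n}"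
  shows "row x = row' x" "col x = col' x"
proof -
  interpret A: regular_grid n P row col L C by fact
  interpret B: regular_grid n P row' col' L' C' by fact
  show "row x = row' x"
  proof (rule rank_unique[OF A.rows B.rows _ x])
    show "row u \<le> row v \<longleftrightarrow> row' u \<le> row' v" if "u \<in> {1..n}" "v \<in> {1..n}" for u v
      by (simp only: A.row_le_iff[OF that] B.row_le_iff[OF that])
  qed
  show "col x = col' x"
  proof (rule rank_unique[OF A.cols B.cols _ x])
    show "col u \<le> col v \<longleftrightarrow> col' u \<le> col' v" if "u \<in> {1..n}" "v \<in> {1..n}" for u v
      by (simp only: A.col_le_iff[OF that] B.col_le_iff[OF that])
  qed
qed


section \<open>The canonical labeling of a regular poset\<close>

definition positions :: "nat \<Rightarrow> tableau \<Rightarrow> (nat \<Rightarrow> nat) \<Rightarrow> (nat \<Rightarrow> nat) \<Rightarrow> bool" where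
  "positions n \<tau> row col \<longleftrightarrow>
     boxes \<tau> = (\<lambda>x. (row x, col x)) ` {1..n} \<and> (\<forall>x\<in>{1..n}. entry \<tau> (row x, col x) = x)"

lemma poset_of_positions:
  assumes "positions n \<tau> row col"
  shows "(x, y) \<in> poset_of \<tau> \<longleftrightarrow> x \<in> {1..n} \<and> y \<in> {1..n} \<and> row x \<le> row y \<and> col x \<le> col y"
proof
  assume "(x, y) \<in> poset_of \<tau>"
  then obtain i j i' j' where "(i, j) \<in> boxes \<tau>" "(i', j') \<in> boxes \<tau>" "i \<le> i'" "j \<le> j'"
    "x = entry \<tau> (i, j)" "y = entry \<tau> (i', j')" by (auto simp: poset_of_def)
  moreover obtain u v where "u \<in> {1..n}" "(i, j) = (row u, col u)" "v \<in> {1..n}" "(i', j') = (row v, col v)"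
    using assms calculation(1,2) unfolding positions_def by blast
  moreover have "entry \<tau> (row u, col u) = u" "entry \<tau> (row v, col v) = v"
    using assms calculation(7,9) unfolding positions_def by blast+
  ultimately show "x \<in> {1..n} \<and> y \<in> {1..n} \<and> row x \<le> row y \<and> col x \<le> col y" by simp
next
  assume *: "x \<in> {1..n} \<and> y \<in> {1..n} \<and> row x \<le> row y \<and> col x \<le> col y"
  then have "(row x, col x) \<in> boxes \<tau>" "(row y, col y) \<in> boxes \<tau>"
    "entry \<tau> (row x, col x) = x" "entry \<tau> (row y, col y) = y"
    using assms unfolding positions_def by blast+
  then show "(x, y) \<in> poset_of \<tau>"
    using * unfolding poset_of_def
    by (intro CollectI exI[of _ "row x"] exI[of _ "col x"] exI[of _ "row y"] exI[of _ "col y"]) simp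
qed

lemma labeling_grid:
  assumes \<tau>: "schur_labeling n \<tau>"
  obtains row col L C where "schur_grid n (poset_of \<tau>) row col L C" "positions n \<tau> row col"
proof -
  have bij: "bij_betw (entry \<tau>) (boxes \<tau>) {1..n}" and basic: "basic_skew_partition (sh \<tau>)"
    and dec: "\<And>i j j'. (i, j) \<in> boxes \<tau> \<Longrightarrow> (i, j') \<in> boxes \<tau> \<Longrightarrow> j < j' \<Longrightarrow> entry \<tau> (i, j') < entry \<tau> (i, j)"
    and inc: "\<And>i i' j. (i, j) \<in> boxes \<tau> \<Longrightarrow> (i', j) \<in> boxes \<tau> \<Longrightarrow> i < i' \<Longrightarrow> entry \<tau> (i, j) < entry \<tau> (i', j)"
    using \<tau> by (auto simp: schur_labeling_def bijective_tableau_def)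
  define pos where "pos = inv_into (boxes \<tau>) (entry \<tau>)"
  have pos: "bij_betw pos {1..n} (boxes \<tau>)" unfolding pos_def by (rule bij_betw_inv_into[OF bij])
  define row col where "row x = fst (pos x)" and "col x = snd (pos x)" for x
  have pc: "(row x, col x) = pos x" for x by (simp add: row_def col_def)
  have im: "(\<lambda>x. (row x, col x)) ` {1..n} = boxes \<tau>"
    unfolding pc by (rule bij_betw_imp_surj_on[OF pos])
  have "entry \<tau> (row x, col x) = x" if "x \<in> {1..n}" for x
    unfolding pc pos_def by (rule bij_betw_inv_into_right[OF bij that])
  then have p: "positions n \<tau> row col" using im by (simp add: positions_def)
  have box: "(row x, col x) \<in> boxes \<tau>" if "x \<in> {1..n}" for x using im that by blast
  have lab: "entry \<tau> (row x, col x) = x" if "x \<in> {1..n}" for x using p that by (simp add: positions_def)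
  have "schur_grid n (poset_of \<tau>) row col (length (fst (sh \<tau>))) (part (fst (sh \<tau>)) 1)"
  proof unfold_locales
    show "x = y" if "x \<in> {1..n}" "y \<in> {1..n}" "row x = row y" "col x = col y" for x y
      using lab[OF that(1)] lab[OF that(2)] that(3,4) by metis
    show "(x, y) \<in> poset_of \<tau> \<longleftrightarrow> x \<in> {1..n} \<and> y \<in> {1..n} \<and> row x \<le> row y \<and> col x \<le> col y" for x y
      by (rule poset_of_positions[OF p])
    have "row ` {1..n} = fst ` boxes \<tau>" "col ` {1..n} = snd ` boxes \<tau>"
      unfolding im[symmetric] by (auto simp: image_image)
    then show "row ` {1..n} = {1..length (fst (sh \<tau>))}" "col ` {1..n} = {1..part (fst (sh \<tau>)) 1}"
      using skew_rows[OF basic] skew_cols[OF basic] by (simp_all only: boxes_def)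
    show "\<exists>z\<in>{1..n}. row z = a \<and> col z = b"
      if "x \<in> {1..n}" "y \<in> {1..n}" "row x \<le> a" "a \<le> row y" "col x \<le> b" "b \<le> col y" for x y a b
    proof -
      have "(a, b) \<in> boxes \<tau>"
        using rectangularD[OF skew_rectangular[OF basic], folded boxes_def, OF box[OF that(1)] box[OF that(2)]]
          that(3-6) by blast
      then show ?thesis unfolding im[symmetric] by blast
    qed
    show "y < x" if "x \<in> {1..n}" "y \<in> {1..n}" "row x = row y" "col x < col y" for x y
      using dec[of "row x" "col x" "col y"] box[OF that(1)] box[OF that(2)] lab[OF that(1)] lab[OF that(2)] that(3,4)
      by simp
    show "x < y" if "x \<in> {1..n}" "y \<in> {1..n}" "col x = col y" "row x < row y" for x y
      using inc[of "row x" "col x" "row y"] box[OF that(1)] box[OF that(2)] lab[OF that(1)] lab[OF that(2)] that(3,4)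
      by simp
  qed
  then show ?thesis using p that by blast
qed

text \<open>The boxes of a grid form a rectangular set without empty rows and columns, hence a basic skew diagram.\<close>

lemma (in schur_grid) labeling_of_grid:
  obtains \<tau> where "schur_labeling n \<tau>" "poset_of \<tau> = P" "positions n \<tau> row col"
proof -
  have "fst ` cells = row ` {1..n}" "snd ` cells = col ` {1..n}"
    by (auto simp: cells_def image_image)
  then have "fst ` cells = {1..L}" "snd ` cells = {1..C}" using rows cols by simp_all
  moreover have "finite cells" by (simp add: cells_def)
  ultimately obtain s where s: "basic_skew_partition s" "diagram s = cells"
    using skew_of_diagram[OF cells_rectangular] by blast
  have inj_pos: "inj_on (\<lambda>x. (row x, col x)) {1..n}" using inj by (auto simp: inj_on_def)
  then have bij_pos: "bij_betw (\<lambda>x. (row x, col x)) {1..n} cells" by (simp add: bij_betw_def cells_def)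
  define e where "e = restrict (inv_into {1..n} (\<lambda>x. (row x, col x))) cells"
  define \<tau> :: tableau where "\<tau> = (s, e)"
  have bx: "boxes \<tau> = cells" and en: "entry \<tau> = e" and sh: "sh \<tau> = s"
    by (simp_all add: \<tau>_def boxes_def sh_def entry_def s(2))
  have lab: "e (row x, col x) = x" if "x \<in> {1..n}" for x
    using inv_into_f_f[OF inj_pos that] that by (simp add: e_def cells_def)
  have p: "positions n \<tau> row col"
    using lab by (simp add: positions_def bx en cells_def)
  have "bij_betw (inv_into {1..n} (\<lambda>x. (row x, col x))) cells {1..n}"
    by (rule bij_betw_inv_into[OF bij_pos])
  then have bij: "bij_betw e cells {1..n}"
    by (rule bij_betw_cong[THEN iffD1, rotated]) (simp add: e_def)
  have "skew_size s = n"
    using skew_size_card[OF s(1)] bij_betw_same_card[OF bij] s(2) by simp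
  then have "bijective_tableau n \<tau>"
    using s bij by (simp add: bijective_tableau_def sh bx en) (simp add: e_def)
  moreover have "e (i, j') < e (i, j)" if ij: "(i, j) \<in> cells" "(i, j') \<in> cells" "j < j'" for i j j'
  proof -
    obtain x y where xy: "x \<in> {1..n}" "row x = i" "col x = j" "y \<in> {1..n}" "row y = i" "col y = j'"
      using ij(1,2) unfolding cells_iff by blast
    show ?thesis using lab[OF xy(1)] lab[OF xy(4)] row_dec[OF xy(1,4)] xy(2,3,5,6) ij(3) by simp
  qed
  moreover have "e (i, j) < e (i', j)" if ij: "(i, j) \<in> cells" "(i', j) \<in> cells" "i < i'" for i i' j
  proof -
    obtain x y where xy: "x \<in> {1..n}" "row x = i" "col x = j" "y \<in> {1..n}" "row y = i'" "col y = j"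
      using ij(1,2) unfolding cells_iff by blast
    show ?thesis using lab[OF xy(1)] lab[OF xy(4)] col_inc[OF xy(1,4)] xy(2,3,5,6) ij(3) by simp
  qed
  ultimately have "schur_labeling n \<tau>"
    unfolding schur_labeling_def bx en by blast
  moreover have "poset_of \<tau> = P"
    using poset_of_positions[OF p] P_iff by auto
  ultimately show ?thesis using p that by blast
qed

lemma share_edge_sym: "share_edge b c \<longleftrightarrow> share_edge c b"
  by (auto simp: share_edge_def)

context grid
begin

abbreviation box_linked :: "((nat \<times> nat) \<times> (nat \<times> nat)) set" where
  "box_linked \<equiv> {(b, c). b \<in> cells \<and> c \<in> cells \<and> share_edge b c}\<^sup>*"

lemma box_linked_sym: "(b, c) \<in> box_linked \<Longrightarrow> (c, b) \<in> box_linked"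
proof -
  have "sym {(b, c). b \<in> cells \<and> c \<in> cells \<and> share_edge b c}"
    using share_edge_sym by (intro symI) blast
  then have "sym box_linked" by (rule sym_rtrancl)
  moreover assume "(b, c) \<in> box_linked"
  ultimately show "(c, b) \<in> box_linked" by (rule symD)
qed

text \<open>Walk inside the rectangle that the two boxes span.\<close>

lemma box_linked_rectangle:
  assumes "(i, j) \<in> cells" "(i', j') \<in> cells" "i \<le> i'" "j \<le> j'"
  shows "((i, j), (i', j')) \<in> box_linked"
  using assms
proof (induction "(i' - i) + (j' - j)" arbitrary: i j rule: less_induct)
  case less
  consider "i = i'" "j = j'" | "j < j'" | "i < i'" using less.prems by linarith
  then show ?case
  proof cases
    case 2
    have c: "(i, Suc j) \<in> cells"
      by (rule rectangularD[OF cells_rectangular less.prems(1,2)]) (use 2 less.prems in auto)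
    then have "((i, j), (i, Suc j)) \<in> box_linked"
      using less.prems(1) by (intro r_into_rtrancl) (simp add: share_edge_def)
    also have "((i, Suc j), (i', j')) \<in> box_linked"
      using less.hyps[of i "Suc j"] c less.prems 2 by simp
    finally show ?thesis .
  next
    case 3
    have c: "(Suc i, j) \<in> cells"
      by (rule rectangularD[OF cells_rectangular less.prems(1,2)]) (use 3 less.prems in auto)
    then have "((i, j), (Suc i, j)) \<in> box_linked"
      using less.prems(1) by (intro r_into_rtrancl) (simp add: share_edge_def)
    also have "((Suc i, j), (i', j')) \<in> box_linked"
      using less.hyps[of "Suc i" j] c less.prems 3 by simp
    finally show ?thesis .
  qed simp
qed

text \<open>Boxes that share an edge carry comparable labels, and comparable labels stand in boxes joined by a walk.
  So the components of the diagram are those of \<open>P\<close>.\<close>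

lemma box_linked_iff:
  assumes x: "x \<in> {1..n}" and y: "y \<in> {1..n}"
  shows "((row x, col x), (row y, col y)) \<in> box_linked \<longleftrightarrow> (x, y) \<in> linked"
proof
  assume "((row x, col x), (row y, col y)) \<in> box_linked"
  then have "\<forall>z\<in>{1..n}. (row y, col y) = (row z, col z) \<longrightarrow> (x, z) \<in> linked"
  proof (induction rule: rtrancl_induct)
    case base
    then show ?case using inj[OF x] by auto
  next
    case (step b c)
    then obtain u where u: "u \<in> {1..n}" "b = (row u, col u)" by (auto simp: cells_def)
    show ?case
    proof (intro ballI impI)
      fix z assume z: "z \<in> {1..n}" "c = (row z, col z)"
      have "(u, z) \<in> comparable" using step(2) u z by (auto simp: share_edge_def P_iff)
      moreover have "(x, u) \<in> linked" using step.IH u by blast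
      ultimately show "(x, z) \<in> linked" by (rule rtrancl_into_rtrancl[rotated])
    qed
  qed
  then show "(x, y) \<in> linked" using y by simp
next
  assume "(x, y) \<in> linked"
  then show "((row x, col x), (row y, col y)) \<in> box_linked"
  proof (induction rule: rtrancl_induct)
    case (step u v)
    have "((row a, col a), (row b, col b)) \<in> box_linked" if "(a, b) \<in> P" for a b
    proof -
      have "a \<in> {1..n}" "b \<in> {1..n}" "row a \<le> row b" "col a \<le> col b"
        using that unfolding P_iff by blast+
      moreover from this have "(row a, col a) \<in> cells" "(row b, col b) \<in> cells"
        unfolding cells_iff by blast+
      ultimately show ?thesis by (intro box_linked_rectangle)
    qed
    from this[of u v] this[of v u] have "((row u, col u), (row v, col v)) \<in> box_linked"
      using step(2) box_linked_sym by blast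
    then show ?case by (rule rtrancl_trans[OF step.IH])
  qed simp
qed

lemma component_entries:
  assumes p: "positions n \<tau> row col" and x: "x \<in> {1..n}"
  shows "box_linked `` {(row x, col x)} = (\<lambda>y. (row y, col y)) ` (linked `` {x})"
    and "entry \<tau> ` (box_linked `` {(row x, col x)}) = linked `` {x}"
proof -
  have in_cells: "c \<in> cells" if "((row x, col x), c) \<in> box_linked" for c
    using that
  proof (induction rule: rtrancl_induct)
    case base
    show ?case unfolding cells_def using x by (rule imageI)
  qed blast
  have in1: "box_linked `` {(row x, col x)} \<subseteq> (\<lambda>y. (row y, col y)) ` (linked `` {x})"
  proof
    fix c assume "c \<in> box_linked `` {(row x, col x)}"
    then have c: "((row x, col x), c) \<in> box_linked" by (rule Image_singleton_iff[THEN iffD1])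
    have "c \<in> cells" by (rule in_cells[OF c])
    then obtain y where y: "y \<in> {1..n}" "c = (row y, col y)"
      unfolding cells_def by blast
    have "(x, y) \<in> linked"
      using c unfolding y(2) by (rule box_linked_iff[OF x y(1), THEN iffD1])
    then show "c \<in> (\<lambda>y. (row y, col y)) ` (linked `` {x})"
      unfolding y(2) by (intro imageI) (rule Image_singleton_iff[THEN iffD2])
  qed
  have in2: "(\<lambda>y. (row y, col y)) ` (linked `` {x}) \<subseteq> box_linked `` {(row x, col x)}"
  proof
    fix c assume "c \<in> (\<lambda>y. (row y, col y)) ` (linked `` {x})"
    then obtain y where y: "(x, y) \<in> linked" "c = (row y, col y)" by blast
    show "c \<in> box_linked `` {(row x, col x)}"
      unfolding y(2) Image_singleton_iff
      by (rule box_linked_iff[OF x linked_range[OF y(1) x], THEN iffD2, OF y(1)])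
  qed
  show eq: "box_linked `` {(row x, col x)} = (\<lambda>y. (row y, col y)) ` (linked `` {x})"
    by (rule equalityI[OF in1 in2])
  have "entry \<tau> (row y, col y) = y" if "y \<in> linked `` {x}" for y
    using p linked_range[OF _ x] that unfolding positions_def by blast
  then show "entry \<tau> ` (box_linked `` {(row x, col x)}) = linked `` {x}"
    unfolding eq image_image by simp
qed

lemma components_increasing_iff:
  assumes p: "positions n \<tau> row col"
  shows "components_increasing \<tau> \<longleftrightarrow>
    (\<forall>x\<in>{1..n}. \<forall>y\<in>{1..n}. (x, y) \<notin> linked \<and> row x < row y \<longrightarrow> least_label x < least_label y)"
proof -
  let ?C = "\<lambda>x. box_linked `` {(row x, col x)}"
  have bx: "boxes \<tau> = cells" using p by (simp add: positions_def cells_def)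
  have comps: "components (boxes \<tau>) = ?C ` {1..n}"
    unfolding bx components_def quotient_def by (auto simp: cells_def)
  have mins: "Min (entry \<tau> ` ?C x) = least_label x" if "x \<in> {1..n}" for x
    unfolding component_entries(2)[OF p that] least_label_def ..
  have above: "above (?C x) (?C y) \<longleftrightarrow> (x, y) \<notin> linked \<and> row x < row y"
    if x: "x \<in> {1..n}" and y: "y \<in> {1..n}" for x y
  proof
    assume a: "above (?C x) (?C y)"
    have less: "fst b < fst c" if "b \<in> ?C x" "c \<in> ?C y" for b c
      using a that unfolding above_def by blast
    have self: "(row z, col z) \<in> ?C z" for z by (rule ImageI[OF rtrancl_refl singletonI])
    have "row x < row y" using less[OF self self] by simp
    moreover have "(x, y) \<notin> linked"
    proof
      assume "(x, y) \<in> linked"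
      then have "(row y, col y) \<in> ?C x"
        unfolding Image_singleton_iff by (rule box_linked_iff[OF x y, THEN iffD2])
      from less[OF this self] show False by simp
    qed
    ultimately show "(x, y) \<notin> linked \<and> row x < row y" by blast
  next
    assume a: "(x, y) \<notin> linked \<and> row x < row y"
    then have "northeast x y" using unlinked_northeast[OF x y] by (auto simp: northeast_def)
    then show "above (?C x) (?C y)"
      unfolding above_def component_entries(1)[OF p x] component_entries(1)[OF p y]
      using northeast_linked[OF x y] a by (auto simp: northeast_def)
  qed
  have "components_increasing \<tau> \<longleftrightarrow> (\<forall>x\<in>{1..n}. \<forall>y\<in>{1..n}.
      above (?C x) (?C y) \<longrightarrow> Min (entry \<tau> ` ?C x) < Min (entry \<tau> ` ?C y))"
    unfolding components_increasing_def comps by blast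
  also have "\<dots> \<longleftrightarrow> (\<forall>x\<in>{1..n}. \<forall>y\<in>{1..n}. (x, y) \<notin> linked \<and> row x < row y \<longrightarrow> least_label x < least_label y)"
    using above mins by (intro ball_cong refl) simp
  finally show ?thesis .
qed

end

lemma lex_key_le_iff:
  fixes a b r s N :: nat
  assumes "r < N" "s < N"
  shows "a * N + r \<le> b * N + s \<longleftrightarrow> a < b \<or> a = b \<and> r \<le> s"
proof -
  have "a * N + r < b * N + s" if "a < b" "r < N" for a b r s :: nat
  proof -
    have "Suc a * N \<le> b * N" using that(1) by (intro mult_right_mono) auto
    then show ?thesis using that(2) by simp
  qed
  from this[of a b r s] this[of b a s r] show ?thesis
    using assms by (cases a b rule: linorder_cases) auto
qed

context schur_grid
begin

text \<open>Components can be stacked in any order. The new row index ranks boxes by component first and by old row second; columns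
  do the same with the components in the opposite order, so that later components lie to the left.\<close>

lemma reordered_grid:
  obtains row' col' L' C' where "schur_grid n P row' col' L' C'"
    "\<And>x y. x \<in> {1..n} \<Longrightarrow> y \<in> {1..n} \<Longrightarrow> (x, y) \<notin> linked \<Longrightarrow> row' x < row' y \<Longrightarrow> least_label x < least_label y"
proof -
  let ?N = "Suc (L + C)"
  let ?m = least_label
  \<comment> \<open>Lexicographic keys: \<open>N\<close> exceeds all row and column indices.\<close>
  define kr where "kr x = ?m x * ?N + row x" for x
  define kc where "kc x = (n - ?m x) * ?N + col x" for x
  have lt: "row x < ?N" "col x < ?N" if "x \<in> {1..n}" for x
  proof -
    have "row x \<in> {1..L}" "col x \<in> {1..C}" using rows cols that by blast+
    then show "row x < ?N" "col x < ?N" by auto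
  qed
  have mr: "?m x \<in> {1..n}" if "x \<in> {1..n}" for x by (rule linked_range[OF least_label_linked[OF that] that])
  obtain row' where row': "row' ` {1..n} = {1..card (kr ` {1..n})}"
    and row'_le: "\<And>x y. x \<in> {1..n} \<Longrightarrow> y \<in> {1..n} \<Longrightarrow> row' x \<le> row' y \<longleftrightarrow> kr x \<le> kr y"
    using rank_exists[of "{1..n}" kr] by blast
  obtain col' where col': "col' ` {1..n} = {1..card (kc ` {1..n})}"
    and col'_le: "\<And>x y. x \<in> {1..n} \<Longrightarrow> y \<in> {1..n} \<Longrightarrow> col' x \<le> col' y \<longleftrightarrow> kc x \<le> kc y"
    using rank_exists[of "{1..n}" kc] by blast
  have rle: "row' x \<le> row' y \<longleftrightarrow> ?m x < ?m y \<or> ?m x = ?m y \<and> row x \<le> row y"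
    if "x \<in> {1..n}" "y \<in> {1..n}" for x y
    unfolding row'_le[OF that] kr_def by (rule lex_key_le_iff[OF lt(1)[OF that(1)] lt(1)[OF that(2)]])
  have cle: "col' x \<le> col' y \<longleftrightarrow> ?m y < ?m x \<or> ?m x = ?m y \<and> col x \<le> col y"
    if "x \<in> {1..n}" "y \<in> {1..n}" for x y
    unfolding col'_le[OF that] kc_def lex_key_le_iff[OF lt(2)[OF that(1)] lt(2)[OF that(2)]]
    using mr[OF that(1)] mr[OF that(2)] by auto
  have le_both: "row' x \<le> row' y \<and> col' x \<le> col' y \<longleftrightarrow> ?m x = ?m y \<and> row x \<le> row y \<and> col x \<le> col y"
    if "x \<in> {1..n}" "y \<in> {1..n}" for x y
    using rle[OF that] cle[OF that] by auto
  have "schur_grid n P row' col' (card (kr ` {1..n})) (card (kc ` {1..n}))"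
  proof
    show "row' ` {1..n} = {1..card (kr ` {1..n})}" "col' ` {1..n} = {1..card (kc ` {1..n})}"
      by (rule row', rule col')
    show "x = y" if "x \<in> {1..n}" "y \<in> {1..n}" "row' x = row' y" "col' x = col' y" for x y
      using le_both[OF that(1,2)] le_both[OF that(2,1)] inj[OF that(1,2)] that(3,4) by simp
    show "(x, y) \<in> P \<longleftrightarrow> x \<in> {1..n} \<and> y \<in> {1..n} \<and> row' x \<le> row' y \<and> col' x \<le> col' y" for x y
    proof (cases "x \<in> {1..n} \<and> y \<in> {1..n}")
      case True
      then have "(x, y) \<in> P \<longrightarrow> ?m x = ?m y" using least_label_eq_iff comparable_imp_linked by blast
      then show ?thesis using le_both[of x y] True P_iff[of x y] by blast
    next
      case False
      then show ?thesis using P_iff[of x y] by blast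
    qed
    show "\<exists>z\<in>{1..n}. row' z = a \<and> col' z = b"
      if xy: "x \<in> {1..n}" "y \<in> {1..n}" and ab: "row' x \<le> a" "a \<le> row' y" "col' x \<le> b" "b \<le> col' y" for x y a b
    proof -
      have "row' x \<in> {1..card (kr ` {1..n})}" "row' y \<in> {1..card (kr ` {1..n})}"
        "col' x \<in> {1..card (kc ` {1..n})}" "col' y \<in> {1..card (kc ` {1..n})}"
        using row' col' xy by blast+
      then have "a \<in> row' ` {1..n}" "b \<in> col' ` {1..n}" using ab row' col' by simp_all
      then obtain u v where uv: "u \<in> {1..n}" "a = row' u" "v \<in> {1..n}" "b = col' v" by blast
      have m: "?m x = ?m y" "row x \<le> row y" "col x \<le> col y"
        using le_both[OF xy] ab by simp_all
      have u: "?m u = ?m x" "row x \<le> row u" "row u \<le> row y"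
        using rle[OF xy(1) uv(1)] rle[OF uv(1) xy(2)] ab(1,2) uv(2) m(1) by auto
      have v: "?m v = ?m x" "col x \<le> col v" "col v \<le> col y"
        using cle[OF xy(1) uv(3)] cle[OF uv(3) xy(2)] ab(3,4) uv(4) m(1) by auto
      obtain z where z: "z \<in> {1..n}" "row z = row u" "col z = col v"
        using rect[OF xy u(2,3) v(2,3)] by blast
      have "(x, z) \<in> P" using xy z u v by (simp add: P_iff)
      then have mz: "?m z = ?m x" using least_label_eq_iff[OF z(1) xy(1)] linked_sym comparable_imp_linked by blast
      have "row' z = row' u" using rle[OF z(1) uv(1)] rle[OF uv(1) z(1)] mz u z by simp
      moreover have "col' z = col' v" using cle[OF z(1) uv(3)] cle[OF uv(3) z(1)] mz v z by simp
      ultimately show ?thesis using z(1) uv by blast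
    qed
    show "y < x" if xy: "x \<in> {1..n}" "y \<in> {1..n}" and rc: "row' x = row' y" "col' x < col' y" for x y
    proof -
      have "?m x = ?m y" "row x = row y" using rle[OF xy] rle[OF xy(2,1)] rc by auto
      moreover have "col x < col y" using cle[OF xy(2,1)] rc calculation by auto
      ultimately show ?thesis using row_dec[OF xy] by blast
    qed
    show "x < y" if xy: "x \<in> {1..n}" "y \<in> {1..n}" and rc: "col' x = col' y" "row' x < row' y" for x y
    proof -
      have "?m x = ?m y" "col x = col y" using cle[OF xy] cle[OF xy(2,1)] rc by auto
      moreover have "row x < row y" using rle[OF xy(2,1)] rc calculation by auto
      ultimately show ?thesis using col_inc[OF xy] by blast
    qed
  qed
  moreover have "?m x < ?m y" if "x \<in> {1..n}" "y \<in> {1..n}" "(x, y) \<notin> linked" "row' x < row' y" for x y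
    using rle[OF that(1,2)] least_label_eq_iff[OF that(1,2)] that(3,4) by auto
  ultimately show ?thesis using that by blast
qed

text \<open>Within a component the walk of \<open>linked_southwest_less\<close> applies. Between components the upper one has the smaller minimum, and
  then all its labels are smaller.\<close>

lemma regular_grid_of_increasing:
  assumes reg: "regular n P"
    and inc: "\<And>x y. x \<in> {1..n} \<Longrightarrow> y \<in> {1..n} \<Longrightarrow> (x, y) \<notin> linked \<Longrightarrow> row x < row y \<Longrightarrow> least_label x < least_label y"
  shows "regular_grid n P row col L C"
proof
  show "x < y" if xy: "x \<in> {1..n}" "y \<in> {1..n}" "row x \<le> row y" "col y \<le> col x" "x \<noteq> y" for x y
  proof (cases "(x, y) \<in> linked")
    case True
    then show ?thesis using linked_southwest_less that by blast
  next
    case False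
    then have "northeast x y" using unlinked_northeast[OF xy(1,2)] xy(3) by (auto simp: northeast_def)
    then show ?thesis
      using regular_linked_interval[OF reg xy(1,2) False] inc[OF xy(1,2) False] by (simp add: northeast_def)
  qed
qed

end

text \<open>Some Schur labeling of \<open>P\<close> exists by assumption; reordering its components makes it increasing, and
  \<open>regular_grid_unique\<close> shows that the result is the only increasing one.\<close>

lemma tableau_of_grid:
  assumes "P \<in> RSP n"
  obtains row col L C where "regular_grid n P row col L C"
    "basic_skew_partition (sh (tableau_of n P))" "diagram (sh (tableau_of n P)) = (\<lambda>x. (row x, col x)) ` {1..n}"
proof -
  let ?good = "\<lambda>\<tau>. schur_labeling n \<tau> \<and> poset_of \<tau> = P \<and> components_increasing \<tau>"
  obtain \<tau>0 where \<tau>0: "schur_labeling n \<tau>0" "poset_of \<tau>0 = P" and reg: "regular n P"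
    using assms by (auto simp: RSP_def SP_def)
  obtain row0 col0 L0 C0 where g0: "schur_grid n P row0 col0 L0 C0"
    using labeling_grid[OF \<tau>0(1)] \<tau>0(2) by metis
  interpret G0: schur_grid n P row0 col0 L0 C0 by (rule g0)
  obtain row col L C where g: "schur_grid n P row col L C"
    and inc: "\<And>x y. x \<in> {1..n} \<Longrightarrow> y \<in> {1..n} \<Longrightarrow> (x, y) \<notin> G0.linked \<Longrightarrow> row x < row y \<Longrightarrow>
      G0.least_label x < G0.least_label y"
    using G0.reordered_grid by metis
  interpret G: schur_grid n P row col L C by (rule g)
  have rg: "regular_grid n P row col L C"
    by (rule G.regular_grid_of_increasing[OF reg inc])
  obtain \<tau> where \<tau>: "schur_labeling n \<tau>" "poset_of \<tau> = P" "positions n \<tau> row col"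
    using G.labeling_of_grid by blast
  have good: "?good \<tau>"
    using \<tau> G.components_increasing_iff[OF \<tau>(3)] inc by blast
  have "\<tau>' = \<tau>" if "?good \<tau>'" for \<tau>'
  proof -
    have s: "schur_labeling n \<tau>'" "poset_of \<tau>' = P" using that by blast+
    obtain row' col' L' C' where g': "schur_grid n P row' col' L' C'" and p': "positions n \<tau>' row' col'"
      by (rule labeling_grid[OF s(1), unfolded s(2)])
    interpret G': schur_grid n P row' col' L' C' by (rule g')
    have "regular_grid n P row' col' L' C'"
      using G'.regular_grid_of_increasing[OF reg] G'.components_increasing_iff[OF p'] that by blast
    note eq = regular_grid_unique[OF this rg]
    have bx: "boxes \<tau>' = boxes \<tau>"
      using p' \<tau>(3) eq by (simp add: positions_def)
    have "fst \<tau>' = fst \<tau>"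
      using diagram_inject[of "sh \<tau>'" "sh \<tau>"] bx that \<tau>(1)
      by (simp add: boxes_def sh_def schur_labeling_def bijective_tableau_def)
    moreover have "entry \<tau>' = entry \<tau>"
    proof (rule extensionalityI[of _ "boxes \<tau>"])
      show "entry \<tau>' \<in> extensional (boxes \<tau>)" "entry \<tau> \<in> extensional (boxes \<tau>)"
        using that \<tau>(1) bx by (auto simp: schur_labeling_def bijective_tableau_def)
      fix b assume "b \<in> boxes \<tau>"
      then obtain x where x: "x \<in> {1..n}" "b = (row x, col x)" using \<tau>(3) by (auto simp: positions_def)
      have "entry \<tau>' (row' x, col' x) = x" "entry \<tau> (row x, col x) = x"
        using p' \<tau>(3) x(1) unfolding positions_def by blast+
      then show "entry \<tau>' b = entry \<tau> b" using eq[OF x(1)] x(2) by simp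
    qed
    ultimately show ?thesis by (simp add: entry_def prod_eq_iff)
  qed
  then have "tableau_of n P = \<tau>"
    unfolding tableau_of_def using good by (intro the_equality) blast+
  then show ?thesis
    using that[OF rg] \<tau> by (simp add: schur_labeling_def bijective_tableau_def positions_def boxes_def)
qed


section \<open>Linear extensions read by rows\<close>

lemma place_simps:
  assumes "\<gamma> permutes {1..n}"
  shows "\<gamma> (place \<gamma> v) = v" "place \<gamma> (\<gamma> x) = x"
  using permutes_inverses[OF assms] by auto

lemma place_in_range:
  assumes "\<gamma> permutes {1..n}" "i \<in> {1..n - 1}"
  shows "place \<gamma> i \<in> {1..n}" "place \<gamma> (Suc i) \<in> {1..n}"
proof -
  have "i \<in> {1..n}" "Suc i \<in> {1..n}" using assms(2) by auto
  then show "place \<gamma> i \<in> {1..n}" "place \<gamma> (Suc i) \<in> {1..n}"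
    using inv_in_range[OF assms(1)] by blast+
qed

lemma card_values_le:
  assumes "\<gamma> permutes {1..n}" "k \<le> n"
  shows "card {x \<in> {1..n}. \<gamma> x \<le> k} = k"
proof -
  have "\<gamma> ` {x \<in> {1..n}. \<gamma> x \<le> k} = {1..k}"
  proof (intro equalityI subsetI)
    fix v assume v: "v \<in> {1..k}"
    then have "v \<in> {1..n}" using assms(2) by simp
    then have "place \<gamma> v \<in> {1..n}" by (rule inv_in_range[OF assms(1)])
    then show "v \<in> \<gamma> ` {x \<in> {1..n}. \<gamma> x \<le> k}"
      using v place_simps(1)[OF assms(1), of v] by (intro image_eqI[of _ _ "place \<gamma> v"]) simp_all
  next
    fix v assume "v \<in> \<gamma> ` {x \<in> {1..n}. \<gamma> x \<le> k}"
    then obtain x where "x \<in> {1..n}" "\<gamma> x \<le> k" "v = \<gamma> x" by blast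
    moreover from this(1) have "\<gamma> x \<in> {1..n}" using permutes_in_image[OF assms(1)] by blast
    ultimately show "v \<in> {1..k}" by simp
  qed
  moreover have "card (\<gamma> ` {x \<in> {1..n}. \<gamma> x \<le> k}) = card {x \<in> {1..n}. \<gamma> x \<le> k}"
    using permutes_inj[OF assms(1)] by (intro card_image) (erule inj_on_subset, rule subset_UNIV)
  ultimately have "card {x \<in> {1..n}. \<gamma> x \<le> k} = card {1..k}" by (simp only:)
  then show ?thesis by (simp only: card_atLeastAtMost diff_Suc_1)
qed

context grid
begin

lemma Sigma_L_from_key:
  assumes inj: "inj_on \<kappa> {1..n}" and mono: "\<And>x y. (x, y) \<in> P \<Longrightarrow> \<kappa> x \<le> (\<kappa> y :: nat)"
  obtains \<gamma> where "\<gamma> \<in> Sigma_L n P"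
    "\<And>x y. x \<in> {1..n} \<Longrightarrow> y \<in> {1..n} \<Longrightarrow> \<gamma> x \<le> \<gamma> y \<longleftrightarrow> \<kappa> x \<le> \<kappa> y"
proof -
  obtain f where f: "f ` {1..n} = {1..card (\<kappa> ` {1..n})}"
    and le: "\<And>x y. x \<in> {1..n} \<Longrightarrow> y \<in> {1..n} \<Longrightarrow> f x \<le> f y \<longleftrightarrow> \<kappa> x \<le> \<kappa> y"
    using rank_exists[of "{1..n}" \<kappa>] by blast
  have "card (\<kappa> ` {1..n}) = n" using card_image[OF inj] by simp
  then have im: "f ` {1..n} = {1..n}" using f by (simp only:)
  define \<gamma> where "\<gamma> x = (if x \<in> {1..n} then f x else x)" for x
  have "inj_on f {1..n}" by (rule eq_card_imp_inj_on) (simp_all only: im finite_atLeastAtMost)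
  then have "bij_betw f {1..n} {1..n}" using im by (simp add: bij_betw_def)
  then have "bij_betw \<gamma> {1..n} {1..n}"
    by (rule bij_betw_cong[THEN iffD1, rotated]) (simp add: \<gamma>_def)
  then have "\<gamma> permutes {1..n}" by (rule bij_imp_permutes) (simp add: \<gamma>_def del: atLeastAtMost_iff)
  moreover have "\<gamma> x \<le> \<gamma> y \<longleftrightarrow> \<kappa> x \<le> \<kappa> y" if "x \<in> {1..n}" "y \<in> {1..n}" for x y
    using le[OF that] that by (simp add: \<gamma>_def)
  moreover from this have "\<gamma> x \<le> \<gamma> y" if "(x, y) \<in> P" for x y
    using mono[OF that] that unfolding P_iff by blast
  ultimately show ?thesis using that[of \<gamma>] by (auto simp: Sigma_L_def)
qed

definition row_word :: "(nat \<Rightarrow> nat) \<Rightarrow> nat \<Rightarrow> nat" where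
  "row_word \<gamma> v = row (place \<gamma> v)"

abbreviation row_pairs :: "(nat \<times> nat) set" where
  "row_pairs \<equiv> {(x, y). x \<in> {1..n} \<and> y \<in> {1..n} \<and> row x < row y}"

definition row_inversions :: "(nat \<Rightarrow> nat) \<Rightarrow> (nat \<times> nat) set" where
  "row_inversions = inversions row_pairs"

lemma row_inversions_def':
  "row_inversions \<gamma> = {(x, y). x \<in> {1..n} \<and> y \<in> {1..n} \<and> row x < row y \<and> \<gamma> y < \<gamma> x}"
  by (auto simp: row_inversions_def inversions_def)

lemma finite_row_inversions: "finite (row_inversions \<gamma>)"
  unfolding row_inversions_def
  by (rule finite_inversions, rule finite_subset[of _ "{1..n} \<times> {1..n}"]) auto

text \<open>The value at which the row reading completes row \<open>s\<close>.\<close>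

definition row_cut :: "nat \<Rightarrow> nat" where
  "row_cut s = card {x \<in> {1..n}. row x \<le> s}"

lemma row_cut_le: "row_cut s \<le> n"
  unfolding row_cut_def by (rule order_trans[OF card_mono[of "{1..n}"]]) auto

lemma row_cut_mono: "s \<le> t \<Longrightarrow> row_cut s \<le> row_cut t"
  unfolding row_cut_def by (rule card_mono) auto

text \<open>Both sets have the same number of elements. If they differed, each would contain an element missing from the
  other, and these two would be inverted across the boundary below row \<open>s\<close>.\<close>

lemma values_below_cut:
  assumes \<gamma>: "\<gamma> permutes {1..n}"
    and no: "\<And>x y. (x, y) \<in> row_inversions \<gamma> \<Longrightarrow> \<not> (row x \<le> s \<and> s < row y)"
  shows "{x \<in> {1..n}. \<gamma> x \<le> row_cut s} = {x \<in> {1..n}. row x \<le> s}" (is "?B = ?A")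
proof -
  have card: "card ?B = card ?A"
    using card_values_le[OF \<gamma> row_cut_le[of s]] by (simp only: row_cut_def)
  have "?A \<subseteq> ?B \<or> ?B \<subseteq> ?A"
  proof (rule ccontr)
    assume "\<not> ?thesis"
    then obtain a b where ab: "a \<in> ?A" "a \<notin> ?B" "b \<in> ?B" "b \<notin> ?A" by blast
    then have "(a, b) \<in> row_inversions \<gamma>" by (auto simp: row_inversions_def')
    from no[OF this] ab show False by simp
  qed
  then show ?thesis
    using card_subset_eq[of ?A ?B] card_subset_eq[of ?B ?A] card by auto
qed

lemma card_row_word:
  assumes \<gamma>: "\<gamma> permutes {1..n}"
  shows "card {u \<in> {1..n}. u \<le> v \<and> row_word \<gamma> u = r} = card {x \<in> {1..n}. \<gamma> x \<le> v \<and> row x = r}"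
proof -
  have "bij_betw \<gamma> {x \<in> {1..n}. \<gamma> x \<le> v \<and> row x = r} {u \<in> {1..n}. u \<le> v \<and> row_word \<gamma> u = r}"
  proof (rule bij_betw_imageI)
    show "inj_on \<gamma> {x \<in> {1..n}. \<gamma> x \<le> v \<and> row x = r}"
      using permutes_inj[OF \<gamma>] by (rule inj_on_subset) (rule subset_UNIV)
    show "\<gamma> ` {x \<in> {1..n}. \<gamma> x \<le> v \<and> row x = r} = {u \<in> {1..n}. u \<le> v \<and> row_word \<gamma> u = r}"
    proof (intro equalityI subsetI)
      fix u assume "u \<in> \<gamma> ` {x \<in> {1..n}. \<gamma> x \<le> v \<and> row x = r}"
      then obtain x where x: "x \<in> {1..n}" "\<gamma> x \<le> v" "row x = r" "u = \<gamma> x" by blast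
      then have "\<gamma> x \<in> {1..n}" using permutes_in_image[OF \<gamma>] by blast
      then show "u \<in> {u \<in> {1..n}. u \<le> v \<and> row_word \<gamma> u = r}"
        using x by (simp add: row_word_def place_simps[OF \<gamma>])
    next
      fix u assume u: "u \<in> {u \<in> {1..n}. u \<le> v \<and> row_word \<gamma> u = r}"
      then have "place \<gamma> u \<in> {1..n}" using inv_in_range[OF \<gamma>] by blast
      then show "u \<in> \<gamma> ` {x \<in> {1..n}. \<gamma> x \<le> v \<and> row x = r}"
        using u by (intro image_eqI[of _ _ "place \<gamma> u"]) (simp_all add: row_word_def place_simps[OF \<gamma>])
    qed
  qed
  then show ?thesis by (rule bij_betw_same_card[symmetric])
qed

end

context regular_grid
begin

text \<open>If \<open>y\<close> is weakly above \<open>x\<close>, it is also weakly to the right, as otherwise it would precede \<open>x\<close> in \<open>P\<close>.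
  If \<open>y\<close> is below \<open>x\<close>, it is weakly to the left: otherwise the corner of the rectangle
  between them would need a value strictly between \<open>i\<close> and \<open>i + 1\<close>. In both cases the labels are
  compared by the south-west rule.\<close>

lemma descent_iff_row:
  assumes \<gamma>: "\<gamma> \<in> Sigma_L n P" and i: "i \<in> {1..n - 1}"
  shows "place \<gamma> (Suc i) < place \<gamma> i \<longleftrightarrow> row (place \<gamma> (Suc i)) \<le> row (place \<gamma> i)"
proof -
  note p = Sigma_L_permutes[OF \<gamma>]
  define x y where "x = place \<gamma> i" and "y = place \<gamma> (Suc i)"
  have xy: "x \<in> {1..n}" "y \<in> {1..n}" "\<gamma> x = i" "\<gamma> y = Suc i"
    using place_in_range[OF p i] by (simp_all add: x_def y_def place_simps[OF p])
  have ne: "x \<noteq> y" using xy by auto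
  have "y < x" if le: "row y \<le> row x"
  proof (rule southwest_less[OF xy(2,1) le])
    show "y \<noteq> x" using ne by simp
    show "col x \<le> col y"
    proof (rule ccontr)
      assume "\<not> col x \<le> col y"
      then have "(y, x) \<in> P" using le xy by (simp add: P_iff)
      then show False using Sigma_L_le[OF \<gamma>, of y x] xy by simp
    qed
  qed
  moreover have "x < y" if lt: "row x < row y"
  proof (rule southwest_less[OF xy(1,2) less_imp_le[OF lt] _ ne])
    show "col y \<le> col x"
    proof (rule ccontr)
      assume c: "\<not> col y \<le> col x"
      obtain z where z: "z \<in> {1..n}" "row z = row x" "col z = col y"
        using rect[OF xy(1,2), of "row x" "col y"] lt c by auto
      have "(x, z) \<in> P" "(z, y) \<in> P" using z xy lt c by (simp_all add: P_iff)
      then have "i \<le> \<gamma> z" "\<gamma> z \<le> Suc i" using Sigma_L_le[OF \<gamma>] xy by force+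
      then have "z = x \<or> z = y"
        using place_simps(2)[OF p, of z] by (auto simp: le_Suc_eq x_def y_def)
      then show False using z c lt by auto
    qed
  qed
  ultimately show ?thesis unfolding x_def[symmetric] y_def[symmetric] by (cases "row y \<le> row x") auto
qed

lemma step_eq:
  assumes \<gamma>: "\<gamma> \<in> Sigma_L n P" and i: "i \<in> {1..n - 1}"
  shows "step P i \<gamma> = (if row_word \<gamma> (Suc i) \<le> row_word \<gamma> i then Some \<gamma>
    else if (place \<gamma> i, place \<gamma> (Suc i)) \<in> P then None else Some (simple_transp i \<circ> \<gamma>))"
  using descent_iff_row[OF assms] by (simp add: step_def row_word_def)

lemma transp_comp_neq: "\<gamma> permutes {1..n} \<Longrightarrow> simple_transp i \<circ> \<gamma> \<noteq> \<gamma>"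
  by (metis comp_apply n_not_Suc_n place_simps(1) simple_transp_simps(1))

lemma step_fixed_iff:
  assumes \<gamma>: "\<gamma> \<in> Sigma_L n P" and i: "i \<in> {1..n - 1}"
  shows "step P i \<gamma> = Some \<gamma> \<longleftrightarrow> row_word \<gamma> (Suc i) \<le> row_word \<gamma> i"
  using step_eq[OF assms] transp_comp_neq[OF Sigma_L_permutes[OF \<gamma>]] by (simp split: if_splits)

lemma row_inversions_transp:
  assumes \<gamma>: "\<gamma> permutes {1..n}" and i: "i \<in> {1..n - 1}" and up: "row_word \<gamma> i < row_word \<gamma> (Suc i)"
  shows "row_inversions (simple_transp i \<circ> \<gamma>) = insert (place \<gamma> i, place \<gamma> (Suc i)) (row_inversions \<gamma>)"
    and "(place \<gamma> i, place \<gamma> (Suc i)) \<notin> row_inversions \<gamma>"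
proof -
  have "(place \<gamma> i, place \<gamma> (Suc i)) \<in> row_pairs" "(place \<gamma> (Suc i), place \<gamma> i) \<notin> row_pairs"
    using place_in_range[OF \<gamma> i] up by (simp_all add: row_word_def)
  note * = inversions_transp[OF \<gamma> this]
  show "row_inversions (simple_transp i \<circ> \<gamma>) = insert (place \<gamma> i, place \<gamma> (Suc i)) (row_inversions \<gamma>)"
    unfolding row_inversions_def by (rule *(1))
  show "(place \<gamma> i, place \<gamma> (Suc i)) \<notin> row_inversions \<gamma>"
    unfolding row_inversions_def by (rule *(2))
qed

lemma row_inversions_step:
  assumes \<gamma>: "\<gamma> \<in> Sigma_L n P" and i: "i \<in> {1..n - 1}" and st: "step P i \<gamma> = Some \<delta>"
  shows "row_inversions \<gamma> \<subseteq> row_inversions \<delta>"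
proof (cases "row_word \<gamma> (Suc i) \<le> row_word \<gamma> i")
  case True
  then show ?thesis using st step_eq[OF \<gamma> i] by simp
next
  case False
  then have "\<delta> = simple_transp i \<circ> \<gamma>" using st step_eq[OF \<gamma> i] by (simp split: if_splits)
  then show ?thesis using row_inversions_transp(1)[OF Sigma_L_permutes[OF \<gamma>] i] False by auto
qed

lemma row_inversions_word_step:
  assumes \<gamma>: "\<gamma> \<in> Sigma_L n P" and ws: "ws \<in> lists {1..n - 1}" and st: "word_step P ws \<gamma> = Some \<delta>"
  shows "row_inversions \<gamma> \<subseteq> row_inversions \<delta>"
  using ws st
proof (induction ws arbitrary: \<delta> rule: list.induct)
  case (Cons i ws)
  obtain \<epsilon> where e: "word_step P ws \<gamma> = Some \<epsilon>" "step P i \<epsilon> = Some \<delta>"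
    using Cons.prems(2) by (auto simp: bind_eq_Some_conv)
  have ws: "ws \<in> lists {1..n - 1}" and i: "i \<in> {1..n - 1}" using Cons.prems(1) by simp_all
  have "\<epsilon> \<in> Sigma_L n P" by (rule word_step_in_Sigma_L[OF \<gamma> ws e(1)])
  then show ?case using row_inversions_step[OF _ i e(2)] Cons.IH[OF ws e(1)] by blast
qed simp

lemma order_without_row_inversions:
  assumes \<gamma>: "\<gamma> \<in> Sigma_L n P" and e: "row_inversions \<gamma> = {}" and xy: "x \<in> {1..n}" "y \<in> {1..n}"
  shows "\<gamma> x \<le> \<gamma> y \<longleftrightarrow> row x < row y \<or> row x = row y \<and> col x \<le> col y"
proof -
  have inj: "\<gamma> a = \<gamma> b \<Longrightarrow> a = b" for a b
    using permutes_inj[OF Sigma_L_permutes[OF \<gamma>]] by (auto simp: inj_on_def)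
  have row: "\<gamma> a < \<gamma> b" if ab: "a \<in> {1..n}" "b \<in> {1..n}" "row a < row b" for a b
  proof -
    have "(a, b) \<notin> row_inversions \<gamma>" using e by blast
    then have "\<gamma> a \<le> \<gamma> b" using ab by (simp add: row_inversions_def')
    moreover have "\<gamma> a \<noteq> \<gamma> b" using inj[of a b] ab by auto
    ultimately show ?thesis by simp
  qed
  have col: "\<gamma> a \<le> \<gamma> b" if "a \<in> {1..n}" "b \<in> {1..n}" "row a = row b" "col a \<le> col b" for a b
    using Sigma_L_le[OF \<gamma>, of a b] that by (simp add: P_iff)
  show ?thesis
  proof (cases "row x" "row y" rule: linorder_cases)
    case equal
    then show ?thesis
      using col[OF xy] col[OF xy(2,1)] inj[of x y] by (cases "col x \<le> col y") auto
  qed (use row[OF xy] row[OF xy(2,1)] in auto)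
qed

lemma row_reading_exists: "\<exists>\<gamma>\<in>Sigma_L n P. row_inversions \<gamma> = {}"
proof -
  define \<kappa> where "\<kappa> x = row x * Suc C + col x" for x
  have lt: "col x < Suc C" if "x \<in> {1..n}" for x
  proof -
    have "col x \<in> {1..C}" using cols that by blast
    then show ?thesis by simp
  qed
  have le: "\<kappa> x \<le> \<kappa> y \<longleftrightarrow> row x < row y \<or> row x = row y \<and> col x \<le> col y"
    if "x \<in> {1..n}" "y \<in> {1..n}" for x y
    unfolding \<kappa>_def by (rule lex_key_le_iff[OF lt[OF that(1)] lt[OF that(2)]])
  have "inj_on \<kappa> {1..n}"
  proof (rule inj_onI)
    fix x y assume xy: "x \<in> {1..n}" "y \<in> {1..n}" "\<kappa> x = \<kappa> y"
    have "\<kappa> x \<le> \<kappa> y" "\<kappa> y \<le> \<kappa> x" using xy(3) by simp_all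
    then have "row x = row y \<and> col x = col y"
      unfolding le[OF xy(1,2)] le[OF xy(2,1)] by auto
    then show "x = y" using inj[OF xy(1,2)] by blast
  qed
  moreover have "\<kappa> x \<le> \<kappa> y" if "(x, y) \<in> P" for x y
  proof -
    have "x \<in> {1..n}" "y \<in> {1..n}" "row x \<le> row y" "col x \<le> col y" using that unfolding P_iff by blast+
    then show ?thesis using le[of x y] by auto
  qed
  ultimately obtain \<gamma> where \<gamma>: "\<gamma> \<in> Sigma_L n P"
    "\<And>x y. x \<in> {1..n} \<Longrightarrow> y \<in> {1..n} \<Longrightarrow> \<gamma> x \<le> \<gamma> y \<longleftrightarrow> \<kappa> x \<le> \<kappa> y"
    using Sigma_L_from_key[of \<kappa>] by blast
  have "(x, y) \<notin> row_inversions \<gamma>" for x y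
  proof
    assume "(x, y) \<in> row_inversions \<gamma>"
    then have xy: "x \<in> {1..n}" "y \<in> {1..n}" "row x < row y" "\<gamma> y < \<gamma> x"
      unfolding row_inversions_def' by blast+
    then show False using \<gamma>(2)[OF xy(1,2)] le[OF xy(1,2)] by simp
  qed
  then show ?thesis using \<gamma>(1) by (intro bexI[of _ \<gamma>]) auto
qed

definition row_reading :: "nat \<Rightarrow> nat" where
  "row_reading = (SOME \<gamma>. \<gamma> \<in> Sigma_L n P \<and> row_inversions \<gamma> = {})"

lemma row_reading_in: "row_reading \<in> Sigma_L n P" and row_inversions_row_reading: "row_inversions row_reading = {}"
  using someI_ex[of "\<lambda>\<gamma>. \<gamma> \<in> Sigma_L n P \<and> row_inversions \<gamma> = {}"] row_reading_exists
  unfolding row_reading_def by blast+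

lemma row_reading_unique:
  assumes "\<gamma> \<in> Sigma_L n P" "row_inversions \<gamma> = {}"
  shows "\<gamma> = row_reading"
  using Sigma_L_permutes[OF assms(1)] Sigma_L_permutes[OF row_reading_in]
proof (rule permutes_eqI_order)
  fix x y assume "x \<in> {1..n}" "y \<in> {1..n}"
  then show "\<gamma> x \<le> \<gamma> y \<longleftrightarrow> row_reading x \<le> row_reading y"
    by (simp only: order_without_row_inversions assms row_reading_in row_inversions_row_reading)
qed

text \<open>An extension with a row inversion has two consecutive values of which the larger one stands in
  a higher row. Exchanging them gives an extension with fewer inversions, from which \<open>\<pi>_i\<close> leads back.\<close>

lemma row_reading_generates:
  assumes "\<gamma> \<in> Sigma_L n P"
  shows "\<exists>ws\<in>lists {1..n - 1}. word_step P ws row_reading = Some \<gamma>"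
  using assms
proof (induction "card (row_inversions \<gamma>)" arbitrary: \<gamma> rule: less_induct)
  case less
  note p = Sigma_L_permutes[OF less.prems]
  show ?case
  proof (cases "row_inversions \<gamma> = {}")
    case True
    then show ?thesis using row_reading_unique[OF less.prems] by (intro bexI[of _ "[]"]) auto
  next
    case False
    then obtain a b where ab: "a \<in> {1..n}" "b \<in> {1..n}" "row a < row b" "\<gamma> b < \<gamma> a"
      unfolding row_inversions_def' by blast
    have "\<exists>i\<in>{1..n - 1}. row_word \<gamma> (Suc i) < row_word \<gamma> i"
    proof (rule ccontr)
      assume "\<not> ?thesis"
      then have up: "row_word \<gamma> i \<le> row_word \<gamma> (Suc i)" if "i \<in> {1..n - 1}" for i
        using that by (meson not_less)
      have "\<gamma> a \<in> {1..n}" "\<gamma> b \<in> {1..n}" using ab permutes_in_image[OF p] by blast+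
      then have "row_word \<gamma> (\<gamma> b) \<le> row_word \<gamma> (\<gamma> a)"
        unfolding atLeastAtMost_iff using ab(4)
        by (intro increasing_on_interval[of n "row_word \<gamma>", OF up]) simp_all
      then show False using ab(3) by (simp add: row_word_def place_simps[OF p])
    qed
    then obtain i where i: "i \<in> {1..n - 1}" "row_word \<gamma> (Suc i) < row_word \<gamma> i" by blast
    define \<delta> where "\<delta> = simple_transp i \<circ> \<gamma>"
    have "(place \<gamma> i, place \<gamma> (Suc i)) \<notin> P" using i(2) by (simp add: P_iff row_word_def)
    then have \<delta>: "\<delta> \<in> Sigma_L n P" unfolding \<delta>_def using transp_in_Sigma_L_iff[OF less.prems i(1)] by blast
    have pl: "place \<delta> i = place \<gamma> (Suc i)" "place \<delta> (Suc i) = place \<gamma> i"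
      by (simp_all add: \<delta>_def inv_transp_comp[OF p])
    have up: "row_word \<delta> i < row_word \<delta> (Suc i)" using i(2) by (simp add: row_word_def pl)
    have "(place \<delta> i, place \<delta> (Suc i)) \<notin> P"
    proof
      assume "(place \<delta> i, place \<delta> (Suc i)) \<in> P"
      from Sigma_L_le[OF less.prems this] show False by (simp add: pl place_simps[OF p])
    qed
    then have st: "step P i \<delta> = Some \<gamma>"
      using step_eq[OF \<delta> i(1)] up by (simp add: \<delta>_def)
    have "simple_transp i \<circ> \<delta> = \<gamma>" by (simp add: \<delta>_def)
    then have "row_inversions \<delta> \<subset> row_inversions \<gamma>"
      using row_inversions_transp[OF Sigma_L_permutes[OF \<delta>] i(1) up] by auto
    then have "card (row_inversions \<delta>) < card (row_inversions \<gamma>)"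
      by (rule psubset_card_mono[OF finite_row_inversions])
    from less.hyps[OF this \<delta>] obtain ws where
      "ws \<in> lists {1..n - 1}" "word_step P ws row_reading = Some \<delta>" by blast
    then show ?thesis using st i(1) by (intro bexI[of _ "i # ws"]) simp_all
  qed
qed

end


section \<open>Simple quotients of the module\<close>

lemma basis_bijection_induces_iso:
  assumes bij: "bij_betw \<beta> (Sigma_L n P) (Sigma_L n Q)"
    and step: "\<And>\<gamma> i. \<gamma> \<in> Sigma_L n P \<Longrightarrow> i \<in> {1..n - 1} \<Longrightarrow> step Q i (\<beta> \<gamma>) = map_option \<beta> (step P i \<gamma>)"
  shows "\<exists>F. module_iso n P Q F"
proof -
  define F where "F = linear_extension (\<lambda>\<gamma>. single (\<beta> \<gamma>) (1::complex))"
  define \<beta>' where "\<beta>' = inv_into (Sigma_L n P) \<beta>"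
  define F' where "F' = linear_extension (\<lambda>\<gamma>. single (\<beta>' \<gamma>) (1::complex))"
  have lin: "linear_map F" "linear_map F'" by (simp_all add: F_def F'_def linear_extension_linear)
  have single: "F (single \<gamma> c) = single (\<beta> \<gamma>) c"
    "F' (single \<gamma> c) = single (\<beta>' \<gamma>) c" for \<gamma> c
    by (simp_all add: F_def F'_def)
  have \<beta>: "\<beta> \<gamma> \<in> Sigma_L n Q" "\<beta>' (\<beta> \<gamma>) = \<gamma>" if "\<gamma> \<in> Sigma_L n P" for \<gamma>
    using bij_betwE[OF bij] bij_betw_inv_into_left[OF bij that] that by (auto simp: \<beta>'_def)
  have \<beta>': "\<beta>' \<gamma> \<in> Sigma_L n P" "\<beta> (\<beta>' \<gamma>) = \<gamma>" if "\<gamma> \<in> Sigma_L n Q" for \<gamma>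
    using bij_betwE[OF bij_betw_inv_into[OF bij]] bij_betw_inv_into_right[OF bij that] that
    by (auto simp: \<beta>'_def)
  have F: "F v \<in> vectors n Q" if "v \<in> vectors n P" for v
    unfolding F_def linear_extension_def using that \<beta>(1)
    by (intro vectors_sum vectors_scale vectors_single) (auto simp: vectors_def)
  have F': "F' v \<in> vectors n P" if "v \<in> vectors n Q" for v
    unfolding F'_def linear_extension_def using that \<beta>'(1)
    by (intro vectors_sum vectors_scale vectors_single) (auto simp: vectors_def)
  have lin_id: "linear_map (\<lambda>v. v)" by (simp add: linear_map_def)
  have "F' (F v) = v" if "v \<in> vectors n P" for v
    by (rule linear_map_eqI[OF linear_map_comp[OF lin(2,1)] lin_id])
      (use that \<beta>(2) in \<open>auto simp: single vectors_def\<close>)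
  moreover have "F (F' v) = v" if "v \<in> vectors n Q" for v
    by (rule linear_map_eqI[OF linear_map_comp[OF lin] lin_id])
      (use that \<beta>'(2) in \<open>auto simp: single vectors_def\<close>)
  ultimately have "bij_betw F (vectors n P) (vectors n Q)"
    using F F' by (intro bij_betw_byWitness[of _ F']) auto
  moreover have "F (gen_action n P i v) = gen_action n Q i (F v)"
    if v: "v \<in> vectors n P" and i: "i \<in> {1..n - 1}" for v i
  proof (rule linear_map_eqI[OF linear_map_comp[OF lin(1) gen_action_linear] linear_map_comp[OF gen_action_linear lin(1)]])
    fix \<gamma> assume "\<gamma> \<in> keys v"
    then have \<gamma>: "\<gamma> \<in> Sigma_L n P" using v by (auto simp: vectors_def)
    show "F (gen_action n P i (single \<gamma> 1)) = gen_action n Q i (F (single \<gamma> 1))"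
      using step[OF \<gamma> i] \<beta>(1)[OF \<gamma>]
      by (cases "step P i \<gamma>")
        (simp_all add: single gen_action_def gen_on_basis_eq_step[OF _ i] \<gamma> linear_map_zero[OF lin(1)])
  qed
  ultimately show ?thesis using lin(1) unfolding module_iso_def linear_map_def by blast
qed

text \<open>The functionals that detect the shape arise by adding up the coefficients on a set of basis elements.\<close>

definition weight :: "'a set \<Rightarrow> ('a \<Rightarrow>\<^sub>0 complex) \<Rightarrow> complex" where
  "weight G v = (\<Sum>\<gamma>\<in>G. lookup v \<gamma>)"

lemma weight_add: "weight G (v + w) = weight G v + weight G w"
  and weight_scale: "weight G (scale c v) = c * weight G v"
  and weight_zero: "weight G 0 = 0"
  by (simp_all add: weight_def lookup_add sum.distrib sum_distrib_left)

lemma weight_keys: "finite G \<Longrightarrow> weight G v = (\<Sum>\<gamma>\<in>keys v. if \<gamma> \<in> G then lookup v \<gamma> else 0)"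
  unfolding weight_def
  by (simp add: sum.If_cases) (rule sum.mono_neutral_cong_right, auto simp: in_keys_iff)

lemma weight_basis_vec: "finite G \<Longrightarrow> weight G (basis_vec b) = (if \<exists>\<delta>\<in>G. b = Some \<delta> then 1 else 0)"
  by (cases b) (simp_all add: weight_def lookup_single when_def)

lemma lookup_basis_vec: "lookup (basis_vec b) \<delta> = (if b = Some \<delta> then 1 else 0)"
  by (cases b) (simp_all add: lookup_single when_def)

lemma finite_Sigma_L: "finite (Sigma_L n P)"
  by (rule finite_subset[OF _ finite_permutations[of "{1..n}"]]) (auto simp: Sigma_L_def)

lemma word_action_expansion:
  assumes v: "v \<in> vectors n P" and ws: "ws \<in> lists {1..n - 1}"
  shows "word_action n P ws v = linear_extension (\<lambda>\<gamma>. basis_vec (word_step P ws \<gamma>)) v"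
proof (rule linear_map_eqI[OF word_action_linear linear_extension_linear])
  fix \<gamma> assume "\<gamma> \<in> keys v"
  then have "\<gamma> \<in> Sigma_L n P" using v by (auto simp: vectors_def)
  then show "word_action n P ws (single \<gamma> 1) =
      linear_extension (\<lambda>\<gamma>. basis_vec (word_step P ws \<gamma>)) (single \<gamma> 1)"
    using word_action_single ws by simp
qed

lemma gen_action_expansion:
  assumes "v \<in> vectors n P" "i \<in> {1..n - 1}"
  shows "gen_action n P i v = linear_extension (\<lambda>\<gamma>. basis_vec (step P i \<gamma>)) v"
  using word_action_expansion[OF assms(1), of "[i]"] assms(2) by (simp add: word_action_Cons)

lemma lookup_word_action:
  assumes "v \<in> vectors n P" "ws \<in> lists {1..n - 1}"
  shows "lookup (word_action n P ws v) \<delta> =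
    (\<Sum>\<gamma>\<in>keys v. if word_step P ws \<gamma> = Some \<delta> then lookup v \<gamma> else 0)"
  unfolding word_action_expansion[OF assms] lookup_linear_extension
  by (rule sum.cong) (simp_all add: lookup_basis_vec)

text \<open>Each \<open>\<pi>_i\<close> sends a basis element to a basis element or to zero, so the coefficients on \<open>G\<close> may be merged but their
  sum changes only by what enters or leaves \<open>G\<close>.\<close>

lemma weight_gen_action:
  assumes G: "finite G" and v: "v \<in> vectors n P" and i: "i \<in> {1..n - 1}"
    and h: "\<And>\<gamma>. \<gamma> \<in> Sigma_L n P \<Longrightarrow> (\<exists>\<delta>\<in>G. step P i \<gamma> = Some \<delta>) \<longleftrightarrow> b \<and> \<gamma> \<in> G"
  shows "weight G (gen_action n P i v) = (if b then weight G v else 0)"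
proof -
  have "weight G (gen_action n P i v) = (\<Sum>\<delta>\<in>G. \<Sum>\<gamma>\<in>keys v.
      lookup v \<gamma> * lookup (basis_vec (step P i \<gamma>)) \<delta>)"
    by (simp add: weight_def gen_action_expansion[OF v i] lookup_linear_extension)
  also have "\<dots> = (\<Sum>\<gamma>\<in>keys v. lookup v \<gamma> * weight G (basis_vec (step P i \<gamma>)))"
    by (subst sum.swap) (simp add: weight_def sum_distrib_left)
  also have "\<dots> = (\<Sum>\<gamma>\<in>keys v. if b \<and> \<gamma> \<in> G then lookup v \<gamma> else 0)"
  proof (rule sum.cong[OF refl])
    fix \<gamma> assume "\<gamma> \<in> keys v"
    then have "\<gamma> \<in> Sigma_L n P" using v by (auto simp: vectors_def)
    from h[OF this] show "lookup v \<gamma> * weight G (basis_vec (step P i \<gamma>)) =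
        (if b \<and> \<gamma> \<in> G then lookup v \<gamma> else 0)"
      by (simp only: weight_basis_vec[OF G]) simp
  qed
  also have "\<dots> = (if b then weight G v else 0)" by (simp add: weight_keys[OF G])
  finally show ?thesis .
qed

lemma step_idempotent:
  assumes "\<gamma> \<in> Sigma_L n P" "step P i \<gamma> = Some \<delta>"
  shows "step P i \<delta> = Some \<delta>"
  using step_idem[OF Sigma_L_permutes[OF assms(1)], of P i] assms(2) by simp

text \<open>Everything in the image of \<open>\<pi>_i\<close> is a combination of basis elements fixed by \<open>\<pi>_i\<close>, because \<open>\<pi>_i\<close> is idempotent.\<close>

lemma keys_fixed_by_step:
  assumes v: "v \<in> vectors n P" and i: "i \<in> {1..n - 1}" and fixed: "gen_action n P i v = v"
    and \<gamma>: "\<gamma> \<in> keys v"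
  shows "step P i \<gamma> = Some \<gamma>"
proof (rule ccontr)
  assume *: "step P i \<gamma> \<noteq> Some \<gamma>"
  have none: "step P i \<delta> \<noteq> Some \<gamma>" if "\<delta> \<in> keys v" for \<delta>
    using step_idempotent[of \<delta> n P i \<gamma>] * that v by (auto simp: vectors_def)
  have "lookup (word_action n P [i] v) \<gamma> =
      (\<Sum>\<delta>\<in>keys v. if word_step P [i] \<delta> = Some \<gamma> then lookup v \<delta> else 0)"
    by (rule lookup_word_action[OF v]) (use i in simp)
  also have "\<dots> = 0" using none by (intro sum.neutral) simp
  finally show False using \<gamma> fixed by (simp add: word_action_Cons in_keys_iff)
qed

context regular_grid
begin

text \<open>A row in \<open>R\<close> stands for the boundary below it; a pair may be inverted if it is separated by such boundaries only.\<close>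

definition allowed :: "nat set \<Rightarrow> (nat \<times> nat) set" where
  "allowed R = {(x, y). x \<in> {1..n} \<and> y \<in> {1..n} \<and> row x < row y \<and> (\<forall>s. row x \<le> s \<and> s < row y \<longrightarrow> s \<in> R)}"

text \<open>Adding up the coefficients on this set is the homomorphism to a one-dimensional module.\<close>

definition head_basis :: "nat set \<Rightarrow> (nat \<Rightarrow> nat) set" where
  "head_basis R = {\<gamma> \<in> Sigma_L n P. row_inversions \<gamma> \<subseteq> allowed R}"

text \<open>The generators that act by \<open>1\<close> on the one-dimensional quotient.\<close>

definition head_descents :: "nat set \<Rightarrow> nat set" where
  "head_descents R = {i \<in> {1..n - 1}. \<forall>s. s \<notin> R \<longrightarrow> i \<noteq> row_cut s}"

definition disconnecting :: "nat \<Rightarrow> bool" where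
  "disconnecting s \<longleftrightarrow> (\<forall>x\<in>{1..n}. \<forall>y\<in>{1..n}. row x = s \<and> row y = Suc s \<longrightarrow> col x \<noteq> col y)"

lemma finite_head_basis: "finite (head_basis R)"
  unfolding head_basis_def using finite_Sigma_L by (rule rev_finite_subset) blast

lemma head_basis_empty: "head_basis {} = {row_reading}"
proof -
  have "allowed {} = {}" by (auto simp: allowed_def)
  then show ?thesis
    unfolding head_basis_def
    using row_reading_in row_inversions_row_reading row_reading_unique by blast
qed

lemma disconnecting_not_comparable:
  assumes xy: "(x, y) \<in> P" and s: "row x \<le> s" "s < row y"
  shows "\<not> disconnecting s"
proof -
  have r: "x \<in> {1..n}" "y \<in> {1..n}" "col x \<le> col y" using xy unfolding P_iff by blast+
  obtain z where "z \<in> {1..n}" "row z = s" "col z = col x"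
    using rect[OF r(1,2), of s "col x"] s r(3) by auto
  moreover obtain w where "w \<in> {1..n}" "row w = Suc s" "col w = col x"
    using rect[OF r(1,2), of "Suc s" "col x"] s r(3) by auto
  ultimately show ?thesis unfolding disconnecting_def by metis
qed

text \<open>An inversion that has been created is never removed, so no element outside \<open>head_basis R\<close> is sent into it. For a member
  \<open>\<gamma>\<close>, the value \<open>i\<close> is the end of a row outside \<open>R\<close> iff a forbidden boundary separates the rows of \<open>i\<close> and \<open>i + 1\<close>;
  then \<open>\<pi>_i\<close> leaves the set or gives zero. Otherwise \<open>\<pi>_i\<close> fixes \<open>\<gamma>\<close> or exchanges two values that
  are incomparable, because the rows in \<open>R\<close> are disconnected from the next ones.\<close>

lemma head_step:
  assumes R: "\<And>s. s \<in> R \<Longrightarrow> disconnecting s" and \<gamma>: "\<gamma> \<in> Sigma_L n P" and i: "i \<in> {1..n - 1}"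
  shows "(\<exists>\<delta>\<in>head_basis R. step P i \<gamma> = Some \<delta>) \<longleftrightarrow> i \<in> head_descents R \<and> \<gamma> \<in> head_basis R"
proof -
  note p = Sigma_L_permutes[OF \<gamma>]
  define x y where "x = place \<gamma> i" and "y = place \<gamma> (Suc i)"
  have xy: "x \<in> {1..n}" "y \<in> {1..n}" "\<gamma> x = i" "\<gamma> y = Suc i"
    using place_in_range[OF p i] by (simp_all add: x_def y_def place_simps[OF p])
  have word: "row_word \<gamma> i = row x" "row_word \<gamma> (Suc i) = row y" by (simp_all add: row_word_def x_def y_def)
  have "i \<le> n" using i by auto
  have cut: "row x \<le> s \<and> s < row y"
    if g: "\<gamma> \<in> head_basis R" and s: "s \<notin> R" "i = row_cut s" for s
  proof -
    have "\<not> (row a \<le> s \<and> s < row b)" if "(a, b) \<in> row_inversions \<gamma>" for a b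
      using g that s(1) by (auto simp: head_basis_def allowed_def)
    from values_below_cut[OF p this] have *: "{x \<in> {1..n}. \<gamma> x \<le> i} = {x \<in> {1..n}. row x \<le> s}"
      by (simp only: s(2)[symmetric])
    have "x \<in> {x \<in> {1..n}. \<gamma> x \<le> i}" "y \<notin> {x \<in> {1..n}. \<gamma> x \<le> i}" using xy by simp_all
    then show ?thesis unfolding * using xy(1,2) by simp
  qed
  have cut': "i = row_cut s"
    if g: "\<gamma> \<in> head_basis R" and s: "s \<notin> R" "row x \<le> s" "s < row y" for s
  proof -
    have no: "(a, b) \<notin> row_inversions \<gamma>" if "row a \<le> s" "s < row b" for a b
      using g that s(1) by (auto simp: head_basis_def allowed_def)
    have "{z \<in> {1..n}. \<gamma> z \<le> i} = {z \<in> {1..n}. row z \<le> s}"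
    proof (intro equalityI subsetI)
      fix z assume z: "z \<in> {z \<in> {1..n}. \<gamma> z \<le> i}"
      show "z \<in> {z \<in> {1..n}. row z \<le> s}"
      proof (rule ccontr)
        assume "z \<notin> {z \<in> {1..n}. row z \<le> s}"
        then have "s < row z" using z by simp
        moreover from this have "z \<noteq> x" using s(2) by auto
        then have "\<gamma> z \<noteq> \<gamma> x" using permutes_inj[OF p] by (simp add: inj_eq)
        ultimately have "(x, z) \<in> row_inversions \<gamma>" using z xy s(2) by (simp add: row_inversions_def')
        then show False using no[OF s(2) \<open>s < row z\<close>] by blast
      qed
    next
      fix z assume z: "z \<in> {z \<in> {1..n}. row z \<le> s}"
      show "z \<in> {z \<in> {1..n}. \<gamma> z \<le> i}"
      proof (rule ccontr)
        assume "z \<notin> {z \<in> {1..n}. \<gamma> z \<le> i}"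
        then have "i < \<gamma> z" using z by simp
        moreover have "z \<noteq> y" using z s(3) by auto
        then have "\<gamma> z \<noteq> \<gamma> y" using permutes_inj[OF p] by (simp add: inj_eq)
        ultimately have "(z, y) \<in> row_inversions \<gamma>" using z xy s(3) by (simp add: row_inversions_def')
        then show False using no[of z y] z s(3) by simp
      qed
    qed
    then show ?thesis using card_values_le[OF p \<open>i \<le> n\<close>] by (simp only: row_cut_def)
  qed
  show ?thesis
  proof (cases "row y \<le> row x")
    case True
    then have "step P i \<gamma> = Some \<gamma>" using step_fixed_iff[OF \<gamma> i] by (simp add: word)
    moreover have "i \<in> head_descents R" if g: "\<gamma> \<in> head_basis R"
    proof -
      have "i \<noteq> row_cut s" if "s \<notin> R" for s
      proof
        assume "i = row_cut s"
        from cut[OF g that this] show False using True by linarith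
      qed
      then show ?thesis using i unfolding head_descents_def by blast
    qed
    ultimately show ?thesis by (metis option.inject)
  next
    case False
    then have up: "row x < row y" by simp
    have st: "step P i \<gamma> = (if (x, y) \<in> P then None else Some (simple_transp i \<circ> \<gamma>))"
      using step_eq[OF \<gamma> i] up by (simp add: word x_def y_def)
    have inv: "row_inversions (simple_transp i \<circ> \<gamma>) = insert (x, y) (row_inversions \<gamma>)"
      using row_inversions_transp(1)[OF p i] up by (simp add: word x_def y_def)
    have all: "(x, y) \<in> allowed R \<longleftrightarrow> (\<forall>s. row x \<le> s \<and> s < row y \<longrightarrow> s \<in> R)"
      using xy up by (simp add: allowed_def)
    show ?thesis
    proof
      assume "\<exists>\<delta>\<in>head_basis R. step P i \<gamma> = Some \<delta>"
      then have "simple_transp i \<circ> \<gamma> \<in> head_basis R" using st by (auto split: if_splits)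
      then have al: "(x, y) \<in> allowed R" and g: "\<gamma> \<in> head_basis R"
        using inv \<gamma> by (auto simp: head_basis_def)
      have "i \<in> head_descents R"
        using cut[OF g] al i unfolding head_descents_def all by blast
      then show "i \<in> head_descents R \<and> \<gamma> \<in> head_basis R" using g by blast
    next
      assume h: "i \<in> head_descents R \<and> \<gamma> \<in> head_basis R"
      have al: "(x, y) \<in> allowed R"
        unfolding all using cut' h unfolding head_descents_def by blast
      have "row x \<in> R" using al up unfolding all by simp
      then have "(x, y) \<notin> P" using disconnecting_not_comparable[of x y "row x"] R up by blast
      then have st': "step P i \<gamma> = Some (simple_transp i \<circ> \<gamma>)" using st by simp
      moreover have "simple_transp i \<circ> \<gamma> \<in> head_basis R"
        using step_in_Sigma_L[OF \<gamma> i st'] inv al h by (auto simp: head_basis_def)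
      ultimately show "\<exists>\<delta>\<in>head_basis R. step P i \<gamma> = Some \<delta>" by blast
    qed
  qed
qed

lemma weight_head_gen:
  assumes "\<And>s. s \<in> R \<Longrightarrow> disconnecting s" "v \<in> vectors n P" "i \<in> {1..n - 1}"
  shows "weight (head_basis R) (gen_action n P i v) =
    (if i \<in> head_descents R then weight (head_basis R) v else 0)"
  by (rule weight_gen_action[OF finite_head_basis assms(2,3)]) (rule head_step[OF assms(1) _ assms(3)])

lemma weight_head_word:
  assumes R: "\<And>s. s \<in> R \<Longrightarrow> disconnecting s" and v: "v \<in> vectors n P" and ws: "ws \<in> lists {1..n - 1}"
  shows "weight (head_basis R) (word_action n P ws v) =
    (if set ws \<subseteq> head_descents R then weight (head_basis R) v else 0)"
  using ws
proof (induction ws rule: list.induct)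
  case (Cons i ws)
  then have ws: "ws \<in> lists {1..n - 1}" and i: "i \<in> {1..n - 1}" by simp_all
  show ?case
    using weight_head_gen[OF R word_action_closed[OF v ws] i] Cons.IH[OF ws]
    by (simp add: word_action_Cons)
qed simp

lemma row_reading_in_head: "row_reading \<in> head_basis R"
  using row_reading_in row_inversions_row_reading by (simp add: head_basis_def)

lemma head_descents_empty_iff:
  assumes "i \<in> {1..n - 1}"
  shows "i \<in> head_descents {} \<longleftrightarrow> row_word row_reading (Suc i) \<le> row_word row_reading i"
  using head_step[of "{}", OF _ row_reading_in assms] step_fixed_iff[OF row_reading_in assms]
  by (simp add: head_basis_empty)

end

text \<open>The images of the basis elements span the target of an isomorphism.\<close>

lemma iso_functional_zero:
  assumes F: "module_iso n Q P F" and \<phi>_add: "\<And>v w. \<phi> (v + w) = \<phi> v + \<phi> w"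
    and \<phi>_scale: "\<And>c v. \<phi> (scale c v) = c * (\<phi> v :: complex)"
    and zero: "\<And>\<gamma>. \<gamma> \<in> Sigma_L n Q \<Longrightarrow> \<phi> (F (single \<gamma> 1)) = 0"
    and v: "v \<in> vectors n P"
  shows "\<phi> v = 0"
proof -
  have F0: "F 0 = 0" using F vectors_zero[of n Q] unfolding module_iso_def by (metis scale_simps(2))
  have F_add: "F (v + w) = F v + F w" if "v \<in> vectors n Q" "w \<in> vectors n Q" for v w
    using F that unfolding module_iso_def by blast
  have F_scale: "F (scale c v) = scale c (F v)" if "v \<in> vectors n Q" for c v
    using F that unfolding module_iso_def by blast
  have \<phi>0: "\<phi> 0 = 0" using \<phi>_scale[of 0 0] by simp
  have sum: "\<phi> (F (\<Sum>\<gamma>\<in>S. scale (c \<gamma>) (single \<gamma> 1))) = 0" if "S \<subseteq> Sigma_L n Q" for S c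
    using that
  proof (induction S rule: infinite_finite_induct)
    case (insert \<gamma> S)
    let ?w = "\<Sum>\<gamma>\<in>S. scale (c \<gamma>) (single \<gamma> 1)"
    have s: "single \<gamma> 1 \<in> vectors n Q" using insert.prems by (intro vectors_single) blast
    have w: "?w \<in> vectors n Q"
      using insert.prems by (intro vectors_sum vectors_scale vectors_single) blast
    have "F (scale (c \<gamma>) (single \<gamma> 1) + ?w) = scale (c \<gamma>) (F (single \<gamma> 1)) + F ?w"
      by (simp only: F_add[OF vectors_scale[OF s] w] F_scale[OF s])
    then have "\<phi> (F (\<Sum>\<gamma>\<in>insert \<gamma> S. scale (c \<gamma>) (single \<gamma> 1))) =
        c \<gamma> * \<phi> (F (single \<gamma> 1)) + \<phi> (F ?w)"
      unfolding sum.insert[OF insert.hyps(1,2)] by (simp only: \<phi>_add \<phi>_scale)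
    then show ?case using insert zero by simp
  qed (simp_all add: F0 \<phi>0)
  have "F ` vectors n Q = vectors n P"
    using F unfolding module_iso_def by (blast dest: bij_betw_imp_surj_on)
  then obtain w where w: "w \<in> vectors n Q" "F w = v"
    using v by (metis imageE)
  have "\<phi> (F (\<Sum>\<gamma>\<in>keys w. scale (lookup w \<gamma>) (single \<gamma> 1))) = 0"
    by (rule sum) (use w(1) in \<open>simp add: vectors_def\<close>)
  then show ?thesis unfolding vector_expansion[of w, symmetric] w(2) .
qed


section \<open>Row overlaps and delayed fillings\<close>

context grid
begin

definition first_col :: "nat \<Rightarrow> nat" where "first_col r = Min {c. (r, c) \<in> cells}"

definition last_col :: "nat \<Rightarrow> nat" where "last_col r = Max {c. (r, c) \<in> cells}"

text \<open>The number of columns that rows \<open>r\<close> and \<open>r + 1\<close> share. The truncated subtraction is exact, as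
  \<open>first_col_le_next\<close> shows.\<close>

definition overlap :: "nat \<Rightarrow> nat" where "overlap r = Suc (last_col (Suc r)) - first_col r"

lemma finite_row: "finite {c. (r, c) \<in> cells}"
  by (rule finite_subset[of _ "col ` {1..n}"]) (auto simp: cells_def)

lemma row_nonempty:
  assumes "r \<in> {1..L}"
  shows "{c. (r, c) \<in> cells} \<noteq> {}"
proof -
  have "r \<in> row ` {1..n}" using assms rows by (rule ssubst[rotated])
  then show ?thesis by (auto simp: cells_def)
qed

lemma row_ends:
  assumes "r \<in> {1..L}"
  shows "(r, first_col r) \<in> cells" "(r, last_col r) \<in> cells"
  using Min_in[OF finite_row row_nonempty[OF assms]] Max_in[OF finite_row row_nonempty[OF assms]]
  by (simp_all only: first_col_def last_col_def mem_Collect_eq)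

lemma row_cells_iff:
  assumes "r \<in> {1..L}"
  shows "(r, c) \<in> cells \<longleftrightarrow> first_col r \<le> c \<and> c \<le> last_col r"
proof
  assume "(r, c) \<in> cells"
  then show "first_col r \<le> c \<and> c \<le> last_col r"
    unfolding first_col_def last_col_def by (intro conjI Min_le[OF finite_row] Max_ge[OF finite_row]) simp_all
next
  assume "first_col r \<le> c \<and> c \<le> last_col r"
  then show "(r, c) \<in> cells"
    by (intro rectangularD[OF cells_rectangular row_ends[OF assms]]) simp_all
qed

lemma first_le_last: "r \<in> {1..L} \<Longrightarrow> first_col r \<le> last_col r"
  using row_ends(1) row_cells_iff by blast

lemma cells_range:
  assumes "(r, c) \<in> cells"
  shows "r \<in> {1..L}" "c \<in> {1..C}"
proof -
  obtain x where "x \<in> {1..n}" "row x = r" "col x = c" using assms unfolding cells_iff by blast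
  then show "r \<in> {1..L}" "c \<in> {1..C}" unfolding rows[symmetric] cols[symmetric] by blast+
qed

lemma cols_antimono:
  assumes "r \<in> {1..L}" "r' \<in> {1..L}" "r \<le> r'"
  shows "last_col r' \<le> last_col r" "first_col r' \<le> first_col r"
proof -
  have "fst ` cells = row ` {1..n}" by (auto simp: cells_def image_image)
  then have *: "fst ` cells = {1..L}" by (simp only: rows)
  have "finite cells" by (simp add: cells_def)
  note b = rectangular_row_bounds[OF cells_rectangular this * assms]
  show "last_col r' \<le> last_col r" unfolding last_col_def by (rule b(1))
  show "first_col r' \<le> first_col r" unfolding first_col_def by (rule b(2))
qed

lemma col_occupied:
  assumes "c \<in> {1..C}"
  obtains r where "r \<in> {1..L}" "(r, c) \<in> cells"
proof -
  have "c \<in> col ` {1..n}" using assms cols by (rule ssubst[rotated])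
  then obtain x where x: "x \<in> {1..n}" "c = col x" by blast
  then have "(row x, c) \<in> cells" by (auto simp: cells_def)
  then show ?thesis using that cells_range(1) by blast
qed

lemma first_col_last_row:
  assumes "1 \<le> L"
  shows "first_col L = 1"
proof -
  have L: "L \<in> {1..L}" using assms by simp
  have c: "first_col L \<in> {1..C}" by (rule cells_range(2)[OF row_ends(1)[OF L]])
  then have "1 \<in> {1..C}" by simp
  then obtain r where r: "r \<in> {1..L}" "(r, 1) \<in> cells" using col_occupied by blast
  have "first_col L \<le> first_col r" using r(1) by (intro cols_antimono(2)[OF r(1) L]) simp
  also have "\<dots> \<le> 1" using r row_cells_iff by blast
  finally show ?thesis using c by simp
qed

text \<open>Otherwise the column after the last one of row \<open>r + 1\<close> would be empty.\<close>

lemma first_col_le_next: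
  assumes r: "r \<in> {1..<L}"
  shows "first_col r \<le> Suc (last_col (Suc r))"
proof (rule ccontr)
  assume *: "\<not> ?thesis"
  have rL: "r \<in> {1..L}" "Suc r \<in> {1..L}" using r by simp_all
  let ?c = "Suc (last_col (Suc r))"
  have "first_col r \<in> {1..C}" by (rule cells_range(2)[OF row_ends(1)[OF rL(1)]])
  then have "?c \<in> {1..C}" using * by simp
  then obtain s where s: "s \<in> {1..L}" "(s, ?c) \<in> cells" by (rule col_occupied)
  then have b: "first_col s \<le> ?c" "?c \<le> last_col s" using row_cells_iff by blast+
  show False
  proof (cases "s \<le> r")
    case True
    then show False using cols_antimono(2)[OF s(1) rL(1)] b(1) * by simp
  next
    case False
    then show False using cols_antimono(1)[OF rL(2) s(1)] b(2) by simp
  qed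
qed

lemma cols_of_row:
  assumes "r \<in> {1..L}"
  shows "col ` {x \<in> {1..n}. row x = r} = {first_col r..last_col r}"
proof -
  have "col ` {x \<in> {1..n}. row x = r} = {c. (r, c) \<in> cells}" unfolding cells_iff by blast
  also have "\<dots> = {first_col r..last_col r}" unfolding row_cells_iff[OF assms] by auto
  finally show ?thesis .
qed

lemma inj_col_row: "inj_on col {x \<in> {1..n}. Q x \<and> row x = r}"
  using inj by (auto simp: inj_on_def)

lemma row_length:
  assumes "r \<in> {1..L}"
  shows "card {x \<in> {1..n}. row x = r} = Suc (last_col r) - first_col r"
proof -
  have "inj_on col {x \<in> {1..n}. row x = r}" using inj_col_row[of "\<lambda>_. True" r] by simp
  then have "card {x \<in> {1..n}. row x = r} = card (col ` {x \<in> {1..n}. row x = r})" by (rule card_image[symmetric])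
  also have "\<dots> = card {first_col r..last_col r}" by (simp only: cols_of_row[OF assms])
  finally show ?thesis by simp
qed

end

text \<open>The lowest row starts in column 1. Going upwards, the overlap with the row below gives the first column of a row and the length gives its last one.\<close>

lemma cells_determined:
  assumes "grid n P row col L C" "grid n Q row' col' L C'"
    and len: "\<And>r. r \<in> {1..L} \<Longrightarrow> card {x \<in> {1..n}. row x = r} = card {x \<in> {1..n}. row' x = r}"
    and ov: "\<And>r. r \<in> {1..<L} \<Longrightarrow> grid.overlap n row col r = grid.overlap n row' col' r"
  shows "grid.cells n row col = grid.cells n row' col'"
proof -
  interpret A: grid n P row col L C by fact
  interpret B: grid n Q row' col' L C' by fact
  have eq: "A.first_col r = B.first_col r \<and> A.last_col r = B.last_col r" if "r \<in> {1..L}" for r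
    using that
  proof (induction "L - r" arbitrary: r rule: less_induct)
    case less
    note r = less.prems
    have "A.first_col r = B.first_col r"
    proof (cases "r = L")
      case True
      then have "1 \<le> L" using r by simp
      then show ?thesis using True A.first_col_last_row B.first_col_last_row by simp
    next
      case False
      then have r': "r \<in> {1..<L}" "Suc r \<in> {1..L}" "L - Suc r < L - r" using r by auto
      show ?thesis
        using ov[OF r'(1)] less.hyps[OF r'(3,2)] A.first_col_le_next[OF r'(1)] B.first_col_le_next[OF r'(1)]
        unfolding A.overlap_def B.overlap_def by simp
    qed
    then show ?case
      using len[OF r] A.first_le_last[OF r] B.first_le_last[OF r]
      unfolding A.row_length[OF r] B.row_length[OF r] by simp
  qed
  show ?thesis
  proof (rule Set.set_eqI)
    fix b show "b \<in> A.cells \<longleftrightarrow> b \<in> B.cells"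
    proof (cases b)
      case (Pair r c)
      show ?thesis
      proof (cases "r \<in> {1..L}")
        case True
        then show ?thesis unfolding Pair A.row_cells_iff[OF True] B.row_cells_iff[OF True] using eq by simp
      next
        case False
        then show ?thesis unfolding Pair using A.cells_range(1) B.cells_range(1) by blast
      qed
    qed
  qed
qed

context regular_grid
begin

lemma row_word_reading_first:
  assumes "1 \<le> n"
  shows "row_word row_reading 1 = 1"
proof -
  note p = Sigma_L_permutes[OF row_reading_in]
  have x: "place row_reading 1 \<in> {1..n}" using assms by (intro inv_in_range[OF p]) simp
  then have r: "row (place row_reading 1) \<in> {1..L}" unfolding rows[symmetric] by (rule imageI)
  then have "1 \<in> {1..L}" by simp
  then have "1 \<in> row ` {1..n}" using rows by (rule ssubst[rotated])
  then obtain z where z: "z \<in> {1..n}" "row z = 1" by auto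
  have "\<not> row z < row (place row_reading 1)"
  proof
    assume lt: "row z < row (place row_reading 1)"
    have "(z, place row_reading 1) \<notin> row_inversions row_reading" using row_inversions_row_reading by blast
    then have le: "row_reading z \<le> 1" using z x lt by (simp add: row_inversions_def' place_simps[OF p])
    have "row_reading z \<in> {1..n}" using z(1) permutes_in_image[OF p] by blast
    then have "row_reading z = 1" using le by simp
    then have "z = place row_reading 1" using place_simps(2)[OF p, of z] by simp
    then show False using lt by simp
  qed
  then show ?thesis using r z(2) by (simp add: row_word_def)
qed

text \<open>The row reading fills one row after the other, and there are no empty rows.\<close>

lemma row_word_reading_Suc:
  assumes i: "i \<in> {1..n - 1}"
  shows "row_word row_reading (Suc i) =
    (if i \<in> head_descents {} then row_word row_reading i else Suc (row_word row_reading i))"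
proof -
  note p = Sigma_L_permutes[OF row_reading_in]
  define x y where "x = place row_reading i" and "y = place row_reading (Suc i)"
  have xy: "x \<in> {1..n}" "y \<in> {1..n}" "row_reading x = i" "row_reading y = Suc i"
    using place_in_range[OF p i] by (simp_all add: x_def y_def place_simps[OF p])
  have mono: "row_reading a \<le> row_reading b" if "a \<in> {1..n}" "b \<in> {1..n}" "row a < row b" for a b
    using order_without_row_inversions[OF row_reading_in row_inversions_row_reading that(1,2)] that(3) by simp
  have le: "row x \<le> row y" using mono[of y x] xy by (cases "row y < row x") auto
  have "row y \<le> Suc (row x)"
  proof (rule ccontr)
    assume *: "\<not> ?thesis"
    have "row x \<in> {1..L}" "row y \<in> {1..L}" unfolding rows[symmetric] using xy by blast+
    then have "Suc (row x) \<in> {1..L}" using * by simp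
    then have "Suc (row x) \<in> row ` {1..n}" using rows by (rule ssubst[rotated])
    then obtain z where z: "z \<in> {1..n}" "row z = Suc (row x)" by auto
    have "i \<le> row_reading z" "row_reading z \<le> Suc i"
      using mono[OF xy(1) z(1)] mono[OF z(1) xy(2)] z(2) * xy by simp_all
    then have "z = x \<or> z = y"
      using place_simps(2)[OF p, of z] by (auto simp: le_Suc_eq x_def y_def)
    then show False using z(2) * by auto
  qed
  moreover have "row_word row_reading (Suc i) = row y" "row_word row_reading i = row x"
    by (simp_all add: row_word_def x_def y_def)
  ultimately show ?thesis using le head_descents_empty_iff[OF i] by auto
qed

text \<open>Boxes are counted from 1, so the \<open>k\<close>-th box of row \<open>r\<close> is in column \<open>first_col r + (k - 1)\<close>.\<close>

definition late :: "nat \<Rightarrow> nat \<Rightarrow> nat \<Rightarrow> bool" where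
  "late r k x \<longleftrightarrow> row x = r \<and> first_col r + (k - 1) \<le> col x"

definition delaying :: "nat \<Rightarrow> nat \<Rightarrow> (nat \<times> nat) set" where
  "delaying r k = {(x, y). x \<in> {1..n} \<and> y \<in> {1..n} \<and> late r k x \<and> row y = Suc r}"

text \<open>Postpone the late boxes of row \<open>r\<close> until row \<open>r + 1\<close> is complete. This respects \<open>P\<close> because no box of row \<open>r + 1\<close> lies weakly to the right of
  a late box: row \<open>r + 1\<close> ends before the \<open>k\<close>-th column of row \<open>r\<close>.\<close>

lemma delayed_extension:
  assumes r: "r \<in> {1..<L}" and k: "1 \<le> k" "overlap r < k"
  obtains T v where "T \<in> Sigma_L n P" "row_inversions T \<subseteq> delaying r k"
    "card {x \<in> {1..n}. T x \<le> v \<and> row x = Suc r} = card {x \<in> {1..n}. row x = Suc r}"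
    "card {x \<in> {1..n}. T x \<le> v \<and> row x = r} < k"
proof -
  have rL: "r \<in> {1..L}" "Suc r \<in> {1..L}" using r by simp_all
  \<comment> \<open>Doubling the row indices leaves room for the late boxes between rows \<open>r + 1\<close> and \<open>r + 2\<close>.\<close>
  define block where "block x = (if late r k x then 2 * r + 3 else 2 * row x)" for x
  define \<kappa> where "\<kappa> x = block x * Suc C + col x" for x
  have lt: "col x < Suc C" if "x \<in> {1..n}" for x
  proof -
    have "col x \<in> {1..C}" unfolding cols[symmetric] using that by (rule imageI)
    then show ?thesis by simp
  qed
  have le: "\<kappa> x \<le> \<kappa> y \<longleftrightarrow> block x < block y \<or> block x = block y \<and> col x \<le> col y"
    if "x \<in> {1..n}" "y \<in> {1..n}" for x y
    unfolding \<kappa>_def by (rule lex_key_le_iff[OF lt[OF that(1)] lt[OF that(2)]])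
  have block_ge: "2 * row x \<le> block x" for x by (simp add: block_def late_def)
  have block_inj: "row x = row y" if "block x = block y" for x y
  proof -
    have "2 * a \<noteq> 2 * b + 3" "2 * b + 3 \<noteq> 2 * a" for a b :: nat by presburger+
    then show ?thesis using that by (auto simp: block_def late_def split: if_splits)
  qed
  have "inj_on \<kappa> {1..n}"
  proof (rule inj_onI)
    fix x y assume xy: "x \<in> {1..n}" "y \<in> {1..n}" "\<kappa> x = \<kappa> y"
    then have "\<kappa> x \<le> \<kappa> y" "\<kappa> y \<le> \<kappa> x" by simp_all
    then have "block x = block y \<and> col x = col y"
      unfolding le[OF xy(1,2)] le[OF xy(2,1)] by auto
    then show "x = y" using inj[OF xy(1,2)] block_inj by blast
  qed
  moreover have "\<kappa> x \<le> \<kappa> y" if "(x, y) \<in> P" for x y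
  proof -
    have xy: "x \<in> {1..n}" "y \<in> {1..n}" "row x \<le> row y" "col x \<le> col y" using that unfolding P_iff by blast+
    have "block x \<le> block y"
    proof (cases "late r k x")
      case False
      then show ?thesis using block_ge[of y] xy(3) by (simp add: block_def)
    next
      case True
      have "row y \<noteq> Suc r"
      proof
        assume y: "row y = Suc r"
        have "(Suc r, col y) \<in> cells" using xy(2) y unfolding cells_iff by blast
        then have "col y \<le> last_col (Suc r)" using row_cells_iff[OF rL(2)] by blast
        moreover have "first_col r + (k - 1) \<le> col x" using True by (simp add: late_def)
        ultimately show False using xy(4) k unfolding overlap_def by arith
      qed
      then consider "row y = r" | "row y \<ge> r + 2" using True xy(3) by (fastforce simp: late_def)
      then show ?thesis
      proof cases
        case 1
        then have "late r k y" using True xy(4) by (simp add: late_def)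
        then show ?thesis using True by (simp add: block_def)
      next
        case 2
        then show ?thesis using True by (simp add: block_def late_def)
      qed
    qed
    then show ?thesis using le[OF xy(1,2)] xy(4) by auto
  qed
  ultimately obtain T where T: "T \<in> Sigma_L n P"
    "\<And>x y. x \<in> {1..n} \<Longrightarrow> y \<in> {1..n} \<Longrightarrow> T x \<le> T y \<longleftrightarrow> \<kappa> x \<le> \<kappa> y"
    using Sigma_L_from_key[of \<kappa>] by blast
  have inv: "row_inversions T \<subseteq> delaying r k"
  proof (rule subrelI)
    fix x y assume "(x, y) \<in> row_inversions T"
    then have xy: "x \<in> {1..n}" "y \<in> {1..n}" "row x < row y" "T y < T x"
      unfolding row_inversions_def' by blast+
    have "T y \<le> T x" using xy(4) by simp
    then have b: "block y \<le> block x" unfolding T(2)[OF xy(2,1)] le[OF xy(2,1)] by auto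
    have l: "late r k x"
    proof (rule ccontr)
      assume "\<not> late r k x"
      then show False using b block_ge[of y] xy(3) by (simp add: block_def)
    qed
    then have "row x = r" "2 * row y \<le> 2 * r + 3" using b block_ge[of y] by (simp_all add: block_def late_def)
    then have "row y = Suc r" using xy(3) by linarith
    then show "(x, y) \<in> delaying r k" using l xy(1,2) by (simp add: delaying_def)
  qed
  obtain y where y: "y \<in> {1..n}" "row y = Suc r" "col y = last_col (Suc r)"
    using row_ends(2)[OF rL(2)] unfolding cells_iff by blast
  have bs: "block z = 2 * Suc r" if "row z = Suc r" for z using that by (simp add: block_def late_def)
  have "{x \<in> {1..n}. T x \<le> T y \<and> row x = Suc r} = {x \<in> {1..n}. row x = Suc r}"
  proof -
    have "T x \<le> T y" if x: "x \<in> {1..n}" "row x = Suc r" for x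
    proof -
      have "(Suc r, col x) \<in> cells" using x unfolding cells_iff by blast
      then have "col x \<le> col y" using row_cells_iff[OF rL(2)] y(3) by simp
      then show ?thesis unfolding T(2)[OF x(1) y(1)] le[OF x(1) y(1)] using bs[OF x(2)] bs[OF y(2)] by simp
    qed
    then show ?thesis by blast
  qed
  moreover have "card {x \<in> {1..n}. T x \<le> T y \<and> row x = r} < k"
  proof -
    have "col ` {x \<in> {1..n}. T x \<le> T y \<and> row x = r} \<subseteq> {first_col r..<first_col r + (k - 1)}"
    proof
      fix c assume "c \<in> col ` {x \<in> {1..n}. T x \<le> T y \<and> row x = r}"
      then obtain x where x: "x \<in> {1..n}" "T x \<le> T y" "row x = r" "c = col x" by blast
      have "block x \<le> 2 * Suc r" using x(2) unfolding T(2)[OF x(1) y(1)] le[OF x(1) y(1)] bs[OF y(2)] by auto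
      then have "\<not> late r k x" by (auto simp: block_def)
      moreover have "(r, c) \<in> cells" using x unfolding cells_iff by blast
      ultimately show "c \<in> {first_col r..<first_col r + (k - 1)}"
        using x row_cells_iff[OF rL(1)] by (simp add: late_def)
    qed
    then have "card (col ` {x \<in> {1..n}. T x \<le> T y \<and> row x = r}) \<le> card {first_col r..<first_col r + (k - 1)}"
      by (intro card_mono) simp_all
    moreover have "card (col ` {x \<in> {1..n}. T x \<le> T y \<and> row x = r}) = card {x \<in> {1..n}. T x \<le> T y \<and> row x = r}"
      by (rule card_image[OF inj_col_row])
    ultimately show ?thesis using k(1) by simp
  qed
  ultimately show ?thesis using that[OF T(1) inv, of "T y"] by simp
qed

text \<open>The box of row \<open>r + 1\<close> below the \<open>k\<close>-th box of row \<open>r\<close> can only be filled after the first \<open>k\<close> boxes of row \<open>r\<close>.\<close>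

lemma overlap_forces_row:
  assumes r: "r \<in> {1..<L}" and k: "1 \<le> k" "k \<le> overlap r" and \<gamma>: "\<gamma> \<in> Sigma_L n P"
    and full: "card {x \<in> {1..n}. \<gamma> x \<le> v \<and> row x = Suc r} = card {x \<in> {1..n}. row x = Suc r}"
  shows "k \<le> card {x \<in> {1..n}. \<gamma> x \<le> v \<and> row x = r}"
proof -
  have rL: "r \<in> {1..L}" "Suc r \<in> {1..L}" using r by simp_all
  let ?c = "first_col r + (k - 1)"
  have c: "?c \<le> last_col (Suc r)" using k by (simp add: overlap_def)
  have "{x \<in> {1..n}. \<gamma> x \<le> v \<and> row x = Suc r} = {x \<in> {1..n}. row x = Suc r}"
    by (rule card_subset_eq[OF _ _ full]) auto
  moreover have "(Suc r, ?c) \<in> cells"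
    unfolding row_cells_iff[OF rL(2)] using c cols_antimono(2)[OF rL] by simp
  then obtain y where y: "y \<in> {1..n}" "row y = Suc r" "col y = ?c" unfolding cells_iff by blast
  ultimately have yv: "\<gamma> y \<le> v" by blast
  have "{first_col r..?c} \<subseteq> col ` {x \<in> {1..n}. \<gamma> x \<le> v \<and> row x = r}"
  proof
    fix d assume d: "d \<in> {first_col r..?c}"
    then have "(r, d) \<in> cells"
      unfolding row_cells_iff[OF rL(1)] using c cols_antimono(1)[OF rL] by simp
    then obtain x where x: "x \<in> {1..n}" "row x = r" "col x = d" unfolding cells_iff by blast
    then have "(x, y) \<in> P" using y d by (simp add: P_iff)
    then have "\<gamma> x \<le> v" using Sigma_L_le[OF \<gamma>] yv by (meson order_trans)
    then show "d \<in> col ` {x \<in> {1..n}. \<gamma> x \<le> v \<and> row x = r}" using x by blast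
  qed
  then have "card {first_col r..?c} \<le> card (col ` {x \<in> {1..n}. \<gamma> x \<le> v \<and> row x = r})"
    by (intro card_mono) simp_all
  also have "\<dots> \<le> card {x \<in> {1..n}. \<gamma> x \<le> v \<and> row x = r}" by (rule card_image_le) simp
  finally show ?thesis using k(1) by simp
qed

text \<open>Suppose a late box of row \<open>r\<close> is inverted, and let \<open>i + 1\<close> be the smallest value below row \<open>r\<close>. Then \<open>\<pi>_i\<close> does not
  fix \<open>\<gamma>\<close>, so \<open>i\<close> must be the end of a row \<open>s\<close> in the row reading. All values up to \<open>i\<close> lie in the rows up to \<open>r\<close> and miss the
  inverted box, so \<open>s < r\<close>. There are no inversions across the boundary below \<open>s\<close>, so the values up to \<open>i\<close>
  fill the rows up to \<open>s\<close>. But the first box of row \<open>r\<close>, which is not late because \<open>k \<ge> 2\<close>, has a value at most \<open>i\<close>.\<close>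

lemma delayed_only_row_reading:
  assumes r: "r \<in> {1..<L}" and k: "2 \<le> k" and \<gamma>: "\<gamma> \<in> Sigma_L n P"
    and inv: "row_inversions \<gamma> \<subseteq> delaying r k"
    and fixed: "\<And>i. i \<in> head_descents {} \<Longrightarrow> step P i \<gamma> = Some \<gamma>"
  shows "\<gamma> = row_reading"
proof (rule row_reading_unique[OF \<gamma>], rule ccontr)
  note p = Sigma_L_permutes[OF \<gamma>]
  assume "row_inversions \<gamma> \<noteq> {}"
  then obtain x y where "(x, y) \<in> row_inversions \<gamma>" by auto
  then have xy: "x \<in> {1..n}" "y \<in> {1..n}" "\<gamma> y < \<gamma> x" "row x = r" "row y = Suc r"
    using inv by (auto simp: row_inversions_def' delaying_def late_def)
  have "r \<in> {1..L}" using r by simp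
  then obtain a where a: "a \<in> {1..n}" "row a = r" "col a = first_col r"
    using row_ends(1) unfolding cells_iff by blast
  have not_late: "\<not> late r k a" using a k by (simp add: late_def)
  have a_first: "\<gamma> a < \<gamma> z" if "z \<in> {1..n}" "r < row z" for z
  proof -
    have "(a, z) \<notin> row_inversions \<gamma>" using inv not_late by (auto simp: delaying_def)
    then have "\<gamma> a \<le> \<gamma> z" using that a by (simp add: row_inversions_def')
    moreover have "a \<noteq> z" using that a by auto
    then have "\<gamma> a \<noteq> \<gamma> z" using permutes_inj[OF p] by (simp add: inj_eq)
    ultimately show ?thesis by simp
  qed
  \<comment> \<open>\<open>a\<close> is the first box of row \<open>r\<close>; \<open>b\<close> below carries the smallest value beneath row \<open>r\<close>.\<close>
  define B where "B = \<gamma> ` {z \<in> {1..n}. r < row z}"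
  have B: "finite B" "B \<noteq> {}" using xy(2,5) by (auto simp: B_def)
  obtain b where b: "b \<in> {1..n}" "r < row b" "\<gamma> b = Min B"
    using Min_in[OF B] unfolding B_def by auto
  have b_min: "\<gamma> b \<le> \<gamma> z" if "z \<in> {1..n}" "r < row z" for z
    unfolding b(3) using that B(1) by (intro Min_le) (auto simp: B_def)
  define i where "i = \<gamma> b - 1"
  have "\<gamma> a \<in> {1..n}" using a(1) permutes_in_image[OF p] by blast
  then have i: "\<gamma> b = Suc i" "1 \<le> i" "\<gamma> a \<le> i" using a_first[OF b(1,2)] by (auto simp: i_def)
  have "\<gamma> b \<in> {1..n}" using b(1) permutes_in_image[OF p] by blast
  then have i_range: "i \<in> {1..n - 1}" "i \<in> {1..n}" using i by auto
  have low: "row z \<le> r" if "z \<in> {1..n}" "\<gamma> z \<le> i" for z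
    using b_min[OF that(1)] that(2) i(1) by (cases "r < row z") auto
  have "place \<gamma> i \<in> {1..n}" by (rule inv_in_range[OF p i_range(2)])
  then have "row_word \<gamma> i \<le> r" using low[of "place \<gamma> i"] by (simp add: row_word_def place_simps[OF p])
  moreover have "place \<gamma> (Suc i) = b" using place_simps(2)[OF p, of b] i(1) by simp
  then have "r < row_word \<gamma> (Suc i)" using b(2) by (simp add: row_word_def)
  ultimately have "step P i \<gamma> \<noteq> Some \<gamma>" using step_fixed_iff[OF \<gamma> i_range(1)] by simp
  then have "i \<notin> head_descents {}" using fixed by blast
  then obtain s where s: "i = row_cut s" using i_range(1) unfolding head_descents_def by blast
  have "s < r"
  proof (rule ccontr)
    assume "\<not> s < r"
    then have "row_cut r \<le> i" using row_cut_mono[of r s] s by simp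
    moreover have "{z \<in> {1..n}. \<gamma> z \<le> i} \<subset> {z \<in> {1..n}. row z \<le> r}"
    proof
      show "{z \<in> {1..n}. \<gamma> z \<le> i} \<subseteq> {z \<in> {1..n}. row z \<le> r}" using low by blast
      have "\<gamma> b \<le> \<gamma> y" using b_min[OF xy(2)] xy(5) by simp
      then have "\<not> \<gamma> x \<le> i" using xy(3) i(1) by simp
      then show "{z \<in> {1..n}. \<gamma> z \<le> i} \<noteq> {z \<in> {1..n}. row z \<le> r}" using xy(1,4) by blast
    qed
    then have "card {z \<in> {1..n}. \<gamma> z \<le> i} < row_cut r"
      unfolding row_cut_def by (intro psubset_card_mono) simp_all
    moreover have "card {z \<in> {1..n}. \<gamma> z \<le> i} = i"
      using i_range(2) by (intro card_values_le[OF p]) simp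
    ultimately show False by simp
  qed
  have "\<not> (row c \<le> s \<and> s < row d)" if "(c, d) \<in> row_inversions \<gamma>" for c d
    using that inv \<open>s < r\<close> by (auto simp: delaying_def late_def)
  from values_below_cut[OF p this] have "{z \<in> {1..n}. \<gamma> z \<le> i} = {z \<in> {1..n}. row z \<le> s}"
    by (simp only: s[symmetric])
  moreover have "a \<in> {z \<in> {1..n}. \<gamma> z \<le> i}" using a(1) i(3) by simp
  ultimately have "row a \<le> s" by blast
  then show False using \<open>s < r\<close> a(2) by simp
qed

end


section \<open>Comparing two grids\<close>

locale grid_pair = A: regular_grid n P row col L C + B: regular_grid n Q row' col' L' C'
  for n P row col L C Q row' col' L' C'
begin

text \<open>Whether \<open>\<pi>_i\<close> fixes an extension is visible in the row word, and so is the effect of an exchange. Only the distinction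
  between an exchange and zero depends on the shape.\<close>

lemma word_step_row_words:
  assumes \<gamma>: "\<gamma> \<in> Sigma_L n P" "\<gamma>' \<in> Sigma_L n Q"
    and eq: "\<And>v. v \<in> {1..n} \<Longrightarrow> A.row_word \<gamma> v = B.row_word \<gamma>' v"
    and ws: "ws \<in> lists {1..n - 1}"
    and st: "word_step P ws \<gamma> = Some \<delta>" "word_step Q ws \<gamma>' = Some \<delta>'" and v: "v \<in> {1..n}"
  shows "A.row_word \<delta> v = B.row_word \<delta>' v"
  using ws st v
proof (induction ws arbitrary: \<delta> \<delta>' v rule: list.induct)
  case Nil
  then show ?case using eq[OF Nil.prems(4)] by simp
next
  case (Cons i ws)
  have ws: "ws \<in> lists {1..n - 1}" and i: "i \<in> {1..n - 1}" using Cons.prems(1) by simp_all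
  obtain \<epsilon> where e: "word_step P ws \<gamma> = Some \<epsilon>" "step P i \<epsilon> = Some \<delta>"
    using Cons.prems(2) by (auto simp: bind_eq_Some_conv)
  obtain \<epsilon>' where e': "word_step Q ws \<gamma>' = Some \<epsilon>'" "step Q i \<epsilon>' = Some \<delta>'"
    using Cons.prems(3) by (auto simp: bind_eq_Some_conv)
  have S: "\<epsilon> \<in> Sigma_L n P" by (rule word_step_in_Sigma_L[OF \<gamma>(1) ws e(1)])
  have S': "\<epsilon>' \<in> Sigma_L n Q" by (rule word_step_in_Sigma_L[OF \<gamma>(2) ws e'(1)])
  note IH = Cons.IH[OF ws e(1) e'(1)]
  have ii: "i \<in> {1..n}" "Suc i \<in> {1..n}" using i by auto
  show ?case
  proof (cases "A.row_word \<epsilon> (Suc i) \<le> A.row_word \<epsilon> i")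
    case True
    then have "step P i \<epsilon> = Some \<epsilon>" "step Q i \<epsilon>' = Some \<epsilon>'"
      using A.step_fixed_iff[OF S i] B.step_fixed_iff[OF S' i] IH[OF ii(1)] IH[OF ii(2)] by simp_all
    then show ?thesis using e e' IH[OF Cons.prems(4)] by simp
  next
    case False
    then have "\<delta> = simple_transp i \<circ> \<epsilon>" "\<delta>' = simple_transp i \<circ> \<epsilon>'"
      using A.step_eq[OF S i] B.step_eq[OF S' i] IH[OF ii(1)] IH[OF ii(2)] e(2) e'(2)
      by (simp_all split: if_splits)
    then have "A.row_word \<delta> v = A.row_word \<epsilon> (simple_transp i v)"
      "B.row_word \<delta>' v = B.row_word \<epsilon>' (simple_transp i v)"
      using inv_transp_comp[OF Sigma_L_permutes[OF S]] inv_transp_comp[OF Sigma_L_permutes[OF S']]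
      by (simp_all add: A.row_word_def B.row_word_def)
    moreover have "simple_transp i v \<in> {1..n}"
      using permutes_in_image[OF simple_transp_permutes[OF i]] Cons.prems(4) by blast
    ultimately show ?thesis using IH by simp
  qed
qed

text \<open>The row word of the row reading starts with 1 and increases exactly at the row ends.\<close>

lemma row_readings_agree:
  assumes heads: "A.head_descents {} = B.head_descents {}" and v: "v \<in> {1..n}"
  shows "A.row_word A.row_reading v = B.row_word B.row_reading v"
proof -
  have "1 \<le> v" "v \<le> n" using v by simp_all
  then show ?thesis
  proof (induction v rule: dec_induct)
    case base
    then show ?case using A.row_word_reading_first B.row_word_reading_first by simp
  next
    case (step i)
    then have "i \<in> {1..n - 1}" by simp
    then show ?case
      using step A.row_word_reading_Suc B.row_word_reading_Suc heads by simp
  qed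
qed

lemma row_lengths_agree:
  assumes eq: "\<And>v. v \<in> {1..n} \<Longrightarrow> A.row_word A.row_reading v = B.row_word B.row_reading v"
  shows "card {x \<in> {1..n}. row x = r} = card {x \<in> {1..n}. row' x = r}"
proof -
  have all: "\<gamma> x \<le> n" if "\<gamma> permutes {1..n}" "x \<in> {1..n}" for \<gamma> x
  proof -
    have "\<gamma> x \<in> {1..n}" using permutes_in_image[OF that(1)] that(2) by blast
    then show ?thesis by simp
  qed
  note pA = Sigma_L_permutes[OF A.row_reading_in] and pB = Sigma_L_permutes[OF B.row_reading_in]
  have "{x \<in> {1..n}. row x = r} = {x \<in> {1..n}. A.row_reading x \<le> n \<and> row x = r}"
    "{x \<in> {1..n}. row' x = r} = {x \<in> {1..n}. B.row_reading x \<le> n \<and> row' x = r}"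
    using all[OF pA] all[OF pB] by blast+
  moreover have "{u \<in> {1..n}. u \<le> n \<and> A.row_word A.row_reading u = r} =
      {u \<in> {1..n}. u \<le> n \<and> B.row_word B.row_reading u = r}"
    using eq by auto
  ultimately show ?thesis
    using A.card_row_word[OF pA, of n r] B.card_row_word[OF pB, of n r] by (simp only:)
qed

end

locale isomorphic_grids = grid_pair +
  fixes F
  assumes iso: "module_iso n Q P F"
begin

definition generator :: "(nat \<Rightarrow> nat) \<Rightarrow>\<^sub>0 complex" where
  "generator = F (single B.row_reading 1)"

lemma F_closed: "v \<in> vectors n Q \<Longrightarrow> F v \<in> vectors n P"
  using iso bij_betwE unfolding module_iso_def by blast

lemma F_zero: "F 0 = 0"
proof -
  have "F (scale 0 0) = scale 0 (F 0)" using iso vectors_zero[of n Q] unfolding module_iso_def by blast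
  then show ?thesis by simp
qed

lemma reading_vector: "single B.row_reading 1 \<in> vectors n Q"
  by (rule vectors_single[OF B.row_reading_in])

lemma generator_in: "generator \<in> vectors n P"
  unfolding generator_def by (rule F_closed[OF reading_vector])

lemma word_on_generator:
  assumes "ws \<in> lists {1..n - 1}"
  shows "word_action n P ws generator = F (basis_vec (word_step Q ws B.row_reading))"
  unfolding generator_def
  using module_iso_word[OF iso reading_vector assms] word_action_single[OF B.row_reading_in assms] by simp

text \<open>The functional is a homomorphism to a one-dimensional module and does not vanish on the row reading of \<open>P\<close>, so its kernel contains
  no generator of the module.\<close>

lemma weight_generator_nonzero:
  assumes R: "\<And>s. s \<in> R \<Longrightarrow> A.disconnecting s"
  shows "weight (A.head_basis R) generator \<noteq> 0"
proof
  let ?\<phi> = "weight (A.head_basis R)"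
  assume zero: "?\<phi> generator = 0"
  have "?\<phi> (F (single \<gamma> 1)) = 0" if \<gamma>: "\<gamma> \<in> Sigma_L n Q" for \<gamma>
  proof -
    obtain ws where ws: "ws \<in> lists {1..n - 1}" "word_step Q ws B.row_reading = Some \<gamma>"
      using B.row_reading_generates[OF \<gamma>] by blast
    then have "F (single \<gamma> 1) = word_action n P ws generator"
      using word_on_generator[OF ws(1)] by simp
    then show ?thesis using A.weight_head_word[OF R generator_in ws(1)] zero by simp
  qed
  then have "?\<phi> v = 0" if "v \<in> vectors n P" for v
    using iso_functional_zero[OF iso, of ?\<phi>] weight_add weight_scale that by blast
  from this[OF vectors_single[OF A.row_reading_in, of 1]] show False
    using weight_basis_vec[OF A.finite_head_basis, of R "Some A.row_reading"] A.row_reading_in_head[of R]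
    by (simp split: if_splits)
qed

lemma generator_fixed:
  assumes i: "i \<in> B.head_descents {}"
  shows "gen_action n P i generator = generator"
proof -
  have i': "i \<in> {1..n - 1}" using i unfolding B.head_descents_def by blast
  then have "step Q i B.row_reading = Some B.row_reading"
    using i B.head_descents_empty_iff[OF i'] B.step_fixed_iff[OF B.row_reading_in i'] by simp
  then show ?thesis
    using word_on_generator[of "[i]"] i' by (simp add: word_action_Cons generator_def)
qed

text \<open>A generator \<open>\<pi>_i\<close> that fixes the row reading of \<open>Q\<close> fixes its image, on which the coefficient of the
  row reading of \<open>P\<close> does not vanish.\<close>

lemma head_descents_subset: "B.head_descents {} \<subseteq> A.head_descents {}"
proof
  fix i assume i: "i \<in> B.head_descents {}"
  then have "i \<in> {1..n - 1}" unfolding B.head_descents_def by blast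
  from A.weight_head_gen[OF _ generator_in this, of "{}"] show "i \<in> A.head_descents {}"
    using generator_fixed[OF i] weight_generator_nonzero[of "{}"] by (simp split: if_splits)
qed

text \<open>A word that reaches a delayed extension for \<open>P\<close> but kills the row reading of \<open>Q\<close> would kill the image of the latter.\<close>

lemma overlap_le:
  assumes heads: "A.head_descents {} = B.head_descents {}" and L: "L = L'" and r: "r \<in> {1..<L}"
  shows "B.overlap r \<le> A.overlap r"
proof (rule ccontr)
  define k where "k = B.overlap r"
  assume "\<not> ?thesis"
  then have k: "1 \<le> k" "A.overlap r < k" "k \<le> B.overlap r" by (simp_all add: k_def)
  have r': "r \<in> {1..<L'}" using r L by simp
  note readings = row_readings_agree[OF heads]
  obtain T v where T: "T \<in> Sigma_L n P" "A.row_inversions T \<subseteq> A.delaying r k"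
    and full: "card {x \<in> {1..n}. T x \<le> v \<and> row x = Suc r} = card {x \<in> {1..n}. row x = Suc r}"
    and few: "card {x \<in> {1..n}. T x \<le> v \<and> row x = r} < k"
    by (rule A.delayed_extension[OF r k(1,2)])
  obtain ws where ws: "ws \<in> lists {1..n - 1}" "word_step P ws A.row_reading = Some T"
    using A.row_reading_generates[OF T(1)] by blast
  \<comment> \<open>A nonzero result would be an extension of \<open>Q\<close> with the row word of \<open>T\<close>, in which row \<open>r + 1\<close> is complete too early.\<close>
  have "word_step Q ws B.row_reading = None"
  proof (rule ccontr)
    assume "word_step Q ws B.row_reading \<noteq> None"
    then obtain T' where T': "word_step Q ws B.row_reading = Some T'" by blast
    have S': "T' \<in> Sigma_L n Q" by (rule word_step_in_Sigma_L[OF B.row_reading_in ws(1) T'])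
    have words: "A.row_word T u = B.row_word T' u" if "u \<in> {1..n}" for u
      using word_step_row_words[OF A.row_reading_in B.row_reading_in readings ws T' that] .
    have counts: "card {x \<in> {1..n}. T x \<le> v \<and> row x = s} = card {x \<in> {1..n}. T' x \<le> v \<and> row' x = s}" for s
    proof -
      have "{u \<in> {1..n}. u \<le> v \<and> A.row_word T u = s} = {u \<in> {1..n}. u \<le> v \<and> B.row_word T' u = s}"
        using words by auto
      then show ?thesis
        using A.card_row_word[OF Sigma_L_permutes[OF T(1)], of v s]
          B.card_row_word[OF Sigma_L_permutes[OF S'], of v s] by (simp only:)
    qed
    have "card {x \<in> {1..n}. T' x \<le> v \<and> row' x = Suc r} = card {x \<in> {1..n}. row' x = Suc r}"
      using full counts[of "Suc r"] row_lengths_agree[OF readings, of "Suc r"] by (simp only:)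
    from B.overlap_forces_row[OF r' k(1,3) S' this] show False using few counts[of r] by simp
  qed
  then have kill: "word_action n P ws generator = 0"
    using word_on_generator[OF ws(1)] F_zero by simp
  show False
  proof (cases "k = 1")
    case True
    \<comment> \<open>Rows \<open>r\<close> and \<open>r + 1\<close> share no column, so \<open>{r}\<close> has a one-dimensional quotient. It takes the value 1 on both \<open>T\<close> and the row reading, so every letter of \<open>ws\<close> acts on it by 1.\<close>
    have "A.disconnecting r"
      unfolding A.disconnecting_def
    proof (intro ballI impI notI)
      fix x y assume xy: "x \<in> {1..n}" "y \<in> {1..n}" "row x = r \<and> row y = Suc r" "col x = col y"
      have rL: "r \<in> {1..L}" "Suc r \<in> {1..L}" using r by simp_all
      have "(row x, col x) \<in> A.cells" "(row y, col y) \<in> A.cells"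
        unfolding A.cells_iff using xy(1,2) by blast+
      then have "(r, col x) \<in> A.cells" "(Suc r, col x) \<in> A.cells" using xy(3,4) by simp_all
      then have "A.first_col r \<le> col x" "col x \<le> A.last_col (Suc r)"
        unfolding A.row_cells_iff[OF rL(1)] A.row_cells_iff[OF rL(2)] by blast+
      then show False using k(2) True by (simp add: A.overlap_def)
    qed
    then have R: "A.disconnecting s" if "s \<in> {r}" for s using that by simp
    have "A.row_inversions T \<subseteq> A.allowed {r}"
      using T(2) by (force simp: A.delaying_def A.late_def A.allowed_def)
    then have "T \<in> A.head_basis {r}" using T(1) by (simp add: A.head_basis_def)
    then have "weight (A.head_basis {r}) (word_action n P ws (single A.row_reading 1)) = 1"
      using word_action_single[OF A.row_reading_in ws(1)] ws(2) weight_basis_vec[OF A.finite_head_basis, of "{r}" "Some T"]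
      by simp
    then have "set ws \<subseteq> A.head_descents {r}"
      using A.weight_head_word[of "{r}", OF R vectors_single[OF A.row_reading_in, of 1] ws(1)]
      by (simp split: if_splits)
    then have "weight (A.head_basis {r}) generator = 0"
      using A.weight_head_word[of "{r}", OF R generator_in ws(1)] kill by (simp add: weight_zero)
    then show False using weight_generator_nonzero[of "{r}", OF R] by blast
  next
    case False
    then have k2: "2 \<le> k" using k(1) by simp
    \<comment> \<open>A basis element that reaches \<open>T\<close> has at most the inversions of \<open>T\<close>.\<close>
    have only: "\<gamma> = A.row_reading"
      if \<gamma>: "\<gamma> \<in> keys generator" and st: "word_step P ws \<gamma> = Some T" for \<gamma>
    proof (rule A.delayed_only_row_reading[OF r k2])
      show S: "\<gamma> \<in> Sigma_L n P" using \<gamma> generator_in by (auto simp: vectors_def)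
      show "A.row_inversions \<gamma> \<subseteq> A.delaying r k"
        using A.row_inversions_word_step[OF S ws(1) st] T(2) by blast
      show "step P i \<gamma> = Some \<gamma>" if i: "i \<in> A.head_descents {}" for i
      proof -
        have "i \<in> {1..n - 1}" using i unfolding A.head_descents_def by blast
        moreover have "gen_action n P i generator = generator" using i heads by (intro generator_fixed) simp
        ultimately show ?thesis by (rule keys_fixed_by_step[OF generator_in _ _ \<gamma>])
      qed
    qed
    have "0 = lookup (word_action n P ws generator) T" by (simp add: kill)
    also have "\<dots> = (\<Sum>\<gamma>\<in>keys generator.
        if word_step P ws \<gamma> = Some T then lookup generator \<gamma> else 0)"
      by (rule lookup_word_action[OF generator_in ws(1)])
    also have "\<dots> = (\<Sum>\<gamma>\<in>keys generator.
        if \<gamma> = A.row_reading then lookup generator \<gamma> else 0)"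
    proof (rule sum.cong[OF refl])
      fix \<gamma> assume "\<gamma> \<in> keys generator"
      then have "word_step P ws \<gamma> = Some T \<longleftrightarrow> \<gamma> = A.row_reading"
        using only ws(2) by blast
      then show "(if word_step P ws \<gamma> = Some T then lookup generator \<gamma> else 0) =
          (if \<gamma> = A.row_reading then lookup generator \<gamma> else 0)" by (simp only:)
    qed
    also have "\<dots> = lookup generator A.row_reading"
      by (simp add: sum.delta in_keys_iff)
    also have "\<dots> = weight (A.head_basis {}) generator" by (simp add: A.head_basis_empty weight_def)
    finally show False using weight_generator_nonzero[of "{}"] by simp
  qed
qed

end

lemma isomorphic_imp_cells_eq:
  assumes A: "regular_grid n P row col L C" and B: "regular_grid n Q row' col' L' C'"
    and iso: "module_iso n P Q F"
  shows "grid.cells n row col = grid.cells n row' col'"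
proof -
  interpret A: regular_grid n P row col L C by (rule A)
  interpret B: regular_grid n Q row' col' L' C' by (rule B)
  obtain F' where F': "module_iso n Q P F'" using module_iso_sym[OF iso] by blast
  interpret AB: isomorphic_grids n P row col L C Q row' col' L' C' F'
    by unfold_locales (rule F')
  interpret BA: isomorphic_grids n Q row' col' L' C' P row col L C F
    by unfold_locales (rule iso)
  have heads: "A.head_descents {} = B.head_descents {}"
    using AB.head_descents_subset BA.head_descents_subset by blast
  have lengths: "card {x \<in> {1..n}. row x = r} = card {x \<in> {1..n}. row' x = r}" for r
    by (rule AB.row_lengths_agree[OF AB.row_readings_agree[OF heads]])
  have in_rows: "r \<in> {1..L} \<longleftrightarrow> card {x \<in> {1..n}. row x = r} \<noteq> 0"
    "r \<in> {1..L'} \<longleftrightarrow> card {x \<in> {1..n}. row' x = r} \<noteq> 0" for r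
    unfolding A.rows[symmetric] B.rows[symmetric] by auto
  have "r \<in> {1..L} \<longleftrightarrow> r \<in> {1..L'}" for r
    unfolding in_rows lengths ..
  then have "{1..L} = {1..L'}" by blast
  then have "card {1..L} = card {1..L'}" by (rule arg_cong)
  then have L: "L = L'" by simp
  show ?thesis
  proof (rule cells_determined[OF A.grid_axioms])
    show "grid n Q row' col' L C'" using B.grid_axioms L by simp
    show "card {x \<in> {1..n}. row x = r} = card {x \<in> {1..n}. row' x = r}" for r by (rule lengths)
    show "A.overlap r = B.overlap r" if r: "r \<in> {1..<L}" for r
    proof -
      have "r \<in> {1..<L'}" using r L by simp
      then show ?thesis
        using AB.overlap_le[OF heads L r] BA.overlap_le[OF heads[symmetric] L[symmetric]] by (intro le_antisym)
    qed
  qed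
qed

text \<open>Identify elements that stand in the same box. This identifies \<open>P\<close> with \<open>Q\<close> as posets but changes the labels; descents
  survive because they depend on rows only.\<close>

lemma cells_eq_imp_isomorphic:
  assumes A: "regular_grid n P row col L C" and B: "regular_grid n Q row' col' L' C'"
    and eq: "grid.cells n row col = grid.cells n row' col'"
  shows "\<exists>F. module_iso n P Q F"
proof -
  interpret A: regular_grid n P row col L C by (rule A)
  interpret B: regular_grid n Q row' col' L' C' by (rule B)
  have posA: "bij_betw (\<lambda>x. (row x, col x)) {1..n} A.cells"
    using A.inj by (auto simp: bij_betw_def inj_on_def A.cells_def)
  have posB: "bij_betw (\<lambda>x. (row' x, col' x)) {1..n} A.cells"
    unfolding eq using B.inj by (auto simp: bij_betw_def inj_on_def B.cells_def)
  define f where "f x = inv_into {1..n} (\<lambda>x. (row' x, col' x)) (row x, col x)" for x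
  have f_bij: "bij_betw f {1..n} {1..n}"
    using bij_betw_trans[OF posA bij_betw_inv_into[OF posB]] by (simp add: f_def[abs_def] comp_def)
  have f_pos: "row' (f x) = row x \<and> col' (f x) = col x" if "x \<in> {1..n}" for x
  proof -
    have "(row x, col x) \<in> A.cells" unfolding A.cells_iff using that by blast
    from bij_betw_inv_into_right[OF posB this] show ?thesis by (simp add: f_def)
  qed
  define \<theta> where "\<theta> x = (if x \<in> {1..n} then f x else x)" for x
  have "bij_betw \<theta> {1..n} {1..n}"
    using f_bij by (rule bij_betw_cong[THEN iffD1, rotated]) (simp add: \<theta>_def)
  then have \<theta>: "\<theta> permutes {1..n}"
    by (rule bij_imp_permutes) (simp add: \<theta>_def del: atLeastAtMost_iff)
  have pos: "row' (\<theta> x) = row x" "col' (\<theta> x) = col x" if "x \<in> {1..n}" for x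
    using f_pos[OF that] that by (simp_all add: \<theta>_def)
  have range: "\<theta> x \<in> {1..n} \<longleftrightarrow> x \<in> {1..n}" for x by (rule permutes_in_image[OF \<theta>])
  have PQ: "(x, y) \<in> P \<longleftrightarrow> (\<theta> x, \<theta> y) \<in> Q" for x y
    unfolding A.P_iff B.P_iff range using pos by auto
  define \<beta> where "\<beta> \<gamma> = \<gamma> \<circ> place \<theta>" for \<gamma> :: "nat \<Rightarrow> nat"
  have \<beta>_in: "\<beta> \<gamma> \<in> Sigma_L n Q" if \<gamma>: "\<gamma> \<in> Sigma_L n P" for \<gamma>
  proof -
    have "\<beta> \<gamma> permutes {1..n}"
      unfolding \<beta>_def by (rule permutes_compose[OF permutes_inv[OF \<theta>] Sigma_L_permutes[OF \<gamma>]])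
    moreover have "\<beta> \<gamma> a \<le> \<beta> \<gamma> b" if "(a, b) \<in> Q" for a b
    proof -
      have "(place \<theta> a, place \<theta> b) \<in> P" using that unfolding PQ by (simp add: place_simps[OF \<theta>])
      then show ?thesis using Sigma_L_le[OF \<gamma>] by (simp add: \<beta>_def)
    qed
    ultimately show ?thesis by (auto simp: Sigma_L_def)
  qed
  have back_in: "\<gamma> \<circ> \<theta> \<in> Sigma_L n P" if \<gamma>: "\<gamma> \<in> Sigma_L n Q" for \<gamma>
  proof -
    have "\<gamma> \<circ> \<theta> permutes {1..n}"
      by (rule permutes_compose[OF \<theta> Sigma_L_permutes[OF \<gamma>]])
    moreover have "(\<gamma> \<circ> \<theta>) a \<le> (\<gamma> \<circ> \<theta>) b" if "(a, b) \<in> P" for a b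
      using Sigma_L_le[OF \<gamma>, of "\<theta> a" "\<theta> b"] that unfolding PQ by simp
    ultimately show ?thesis by (auto simp: Sigma_L_def)
  qed
  have "bij_betw \<beta> (Sigma_L n P) (Sigma_L n Q)"
  proof (rule bij_betw_byWitness[of _ "\<lambda>\<gamma>. \<gamma> \<circ> \<theta>"])
    show "\<forall>\<gamma>\<in>Sigma_L n P. \<beta> \<gamma> \<circ> \<theta> = \<gamma>" "\<forall>\<gamma>\<in>Sigma_L n Q. \<beta> (\<gamma> \<circ> \<theta>) = \<gamma>"
      by (simp_all add: \<beta>_def fun_eq_iff place_simps[OF \<theta>])
  qed (use \<beta>_in back_in in blast)+
  moreover have "step Q i (\<beta> \<gamma>) = map_option \<beta> (step P i \<gamma>)"
    if \<gamma>: "\<gamma> \<in> Sigma_L n P" and i: "i \<in> {1..n - 1}" for \<gamma> i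
  proof -
    note p = Sigma_L_permutes[OF \<gamma>]
    have place: "place (\<beta> \<gamma>) v = \<theta> (place \<gamma> v)" for v
      unfolding \<beta>_def
      using o_inv_distrib[OF permutes_bij[OF p] permutes_bij[OF permutes_inv[OF \<theta>]]]
        permutes_inv_inv[OF \<theta>] by simp
    have "B.row_word (\<beta> \<gamma>) i = A.row_word \<gamma> i" "B.row_word (\<beta> \<gamma>) (Suc i) = A.row_word \<gamma> (Suc i)"
      using place_in_range[OF p i] by (simp_all only: A.row_word_def B.row_word_def place pos)
    moreover have "simple_transp i \<circ> \<beta> \<gamma> = \<beta> (simple_transp i \<circ> \<gamma>)" by (simp add: \<beta>_def comp_assoc)
    ultimately show ?thesis
      unfolding A.step_eq[OF \<gamma> i] B.step_eq[OF \<beta>_in[OF \<gamma>] i] place PQ[symmetric] by simp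
  qed
  ultimately show ?thesis by (rule basis_bijection_induces_iso)
qed

theorem theorem5p5:
  fixes n :: nat and P Q :: "nat rel"
  assumes "P \<in> RSP n" and "Q \<in> RSP n"
  shows "modules_isomorphic (hecke0 n) (poset_module n P) (poset_module n Q) \<longleftrightarrow>
         sh (tableau_of n P) = sh (tableau_of n Q)"
proof -
  obtain row col L C where A: "regular_grid n P row col L C"
    and bA: "basic_skew_partition (sh (tableau_of n P))"
    and dA: "diagram (sh (tableau_of n P)) = (\<lambda>x. (row x, col x)) ` {1..n}"
    using tableau_of_grid[OF assms(1)] by blast
  obtain row' col' L' C' where B: "regular_grid n Q row' col' L' C'"
    and bB: "basic_skew_partition (sh (tableau_of n Q))"
    and dB: "diagram (sh (tableau_of n Q)) = (\<lambda>x. (row' x, col' x)) ` {1..n}"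
    using tableau_of_grid[OF assms(2)] by blast
  interpret A: regular_grid n P row col L C by (rule A)
  interpret B: regular_grid n Q row' col' L' C' by (rule B)
  have "sh (tableau_of n P) = sh (tableau_of n Q) \<longleftrightarrow> A.cells = B.cells"
    unfolding A.cells_def B.cells_def dA[symmetric] dB[symmetric] using diagram_inject[OF bA bB] by metis
  also have "\<dots> \<longleftrightarrow> (\<exists>F. module_iso n P Q F)"
    using isomorphic_imp_cells_eq[OF A B] cells_eq_imp_isomorphic[OF A B] by blast
  finally show ?thesis unfolding modules_isomorphic_iff by simp
qed

end
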